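(* Let $n\ge1$, let $\beta>0$ and assume that the twice differentiable function $v:\mathbb{R}^n\to(0,\infty)$ belongs to $L^2(\gamma_\beta^{-1})$ and satisfies $\int_{\mathbb{R}^n}v\,dx=1$. Suppose that either (1) $\beta>1$ and $v$ is $\beta$-semi-log-subharmonic, or (2) $0<\beta<1$ and $v$ is $\beta$-semi-log-concave. Then $$\mathrm{Ent}_\gamma\Big(\frac v\gamma\Big)-\frac12\mathrm{I}_\gamma\Big(\frac v\gamma\Big)\le \mathrm{Ent}_\gamma\Big(\frac{\gamma_\beta}\gamma\Big)-\frac12\mathrm{I}_\gamma\Big(\frac{\gamma_\beta}\gamma\Big).$$
   Context: For $\beta>0$, $\gamma_\beta(x)=(2\pi\beta)^{-n/2}e^{-|x|^2/(2\beta)}$ on $\mathbb{R}^n$, $\gamma=\gamma_1$, $d\gamma=\gamma(x)\,dx$. $v\in L^2(\gamma_\beta^{-1})$ means $\int_{\mathbb{R}^n}v^2\gamma_\beta^{-1}\,dx<\infty$. Entropy and Fisher information: $$\mathrm{Ent}_\gamma(f)=\int_{\mathbb{R}^n}f\log f\,d\gamma-\Big(\int_{\mathbb{R}^n}f\,d\gamma\Big)\log\Big(\int_{\mathbb{R}^n}f\,d\gamma\Big),\qquad \mathrm{I}_\gamma(f)=\int_{\mathbb{R}^n}\frac{|\nabla f|^2}{f}\,d\gamma\in[0,\infty].$$ A twice differentiable $v:\mathbb{R}^n\to(0,\infty)$ is $\beta$-semi-log-subharmonic if $\Delta\log v\ge-\frac n\beta$ on $\mathbb{R}^n$, and $\beta$-semi-log-concave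 if $\nabla^2\log v\le-\frac1\beta\,\mathrm{id}$ on $\mathbb{R}^n$. *)

theory Defs
  imports "HOL-Analysis.Analysis"
begin

definition gauss :: "real \<Rightarrow> real ^ 'n \<Rightarrow> real" where
  "gauss \<beta> x = (2 * pi * \<beta>) powr (- real CARD('n) / 2) * exp (- (norm x)\<^sup>2 / (2 * \<beta>))"

definition gauss_measure :: "(real ^ 'n) measure" where
  "gauss_measure = density lborel (\<lambda>x. ennreal (gauss 1 x))"

definition gradient :: "(real ^ 'n \<Rightarrow> real) \<Rightarrow> real ^ 'n \<Rightarrow> real ^ 'n" where
  "gradient f x = (THE D. GDERIV f x :> D)"

text \<open>Twice differentiable in the Frechet sense; the second derivative need not be continuous.\<close>

definition twice_differentiable :: "(real ^ 'n \<Rightarrow> real) \<Rightarrow> bool" where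
  "twice_differentiable f \<longleftrightarrow>
     (\<forall>x. f differentiable (at x)) \<and> (\<forall>x. gradient f differentiable (at x))"

definition hessian :: "(real ^ 'n \<Rightarrow> real) \<Rightarrow> real ^ 'n \<Rightarrow> real ^ 'n ^ 'n" where
  "hessian f x = matrix (frechet_derivative (gradient f) (at x))"

definition laplacian :: "(real ^ 'n \<Rightarrow> real) \<Rightarrow> real ^ 'n \<Rightarrow> real" where
  "laplacian f x = trace (hessian f x)"

text \<open>The order of quadratic forms on symmetric matrices.\<close>

definition loewner_le :: "real ^ 'n ^ 'n \<Rightarrow> real ^ 'n ^ 'n \<Rightarrow> bool" where
  "loewner_le A B \<longleftrightarrow> (\<forall>h. h \<bullet> (A *v h) \<le> h \<bullet> (B *v h))"

text \<open>The next two predicates are meant for positive, twice differentiable \<open>v\<close> only.\<close>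

definition semi_log_subharmonic :: "real \<Rightarrow> (real ^ 'n \<Rightarrow> real) \<Rightarrow> bool" where
  "semi_log_subharmonic \<beta> v \<longleftrightarrow>
     (\<forall>x. laplacian (\<lambda>y. ln (v y)) x \<ge> - real CARD('n) / \<beta>)"

definition semi_log_concave :: "real \<Rightarrow> (real ^ 'n \<Rightarrow> real) \<Rightarrow> bool" where
  "semi_log_concave \<beta> v \<longleftrightarrow>
     (\<forall>x. loewner_le (hessian (\<lambda>y. ln (v y)) x) (mat (- 1 / \<beta>)))"

text \<open>
  \<open>Ent f\<close> is meaningful only if \<open>f\<close> and \<open>f log f\<close> are integrable. For \<open>f = v / \<gamma>\<close> with
  \<open>v > 0\<close> of integral \<open>1\<close> in \<open>L\<^sup>2(\<gamma>\<^sub>\<beta>\<^sup>-\<^sup>1)\<close> this is automatic: \<open>v\<close> is square integrable and has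
  finite moments, hence \<open>v log v\<close> and \<open>v log \<gamma>\<close> are integrable. The Fisher information is a
  Lebesgue integral in \<open>[0, \<infinity>]\<close> and may be infinite; it is used for positive \<open>f\<close> only.
\<close>

definition Ent :: "(real ^ 'n \<Rightarrow> real) \<Rightarrow> real" where
  "Ent f = (\<integral>x. f x * ln (f x) \<partial>gauss_measure)
           - (\<integral>x. f x \<partial>gauss_measure) * ln (\<integral>x. f x \<partial>gauss_measure)"

definition Fisher :: "(real ^ 'n \<Rightarrow> real) \<Rightarrow> ennreal" where
  "Fisher f = (\<integral>\<^sup>+ x. ennreal ((norm (gradient f x))\<^sup>2 / f x) \<partial>gauss_measure)"

end

(* For a density v put J = int |grad v|^2 / v and X = int x . grad v. Expanding the squares gives
   Ent(v/gamma) - I(v/gamma)/2 = int v ln v + (n/2) ln(2 pi) - J/2 - X, whereas the logarithmic Sobolev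
   inequality for gamma_beta, expanded in the same way, bounds int v ln v by
   (beta/2) J + X - (n/2) ln(2 pi beta). The terms X cancel, so the claim reduces to
   (beta - 1) (J - n/beta) <= 0.

   Semi-log-concavity yields J >= n/beta on every line parallel to an axis. Semi-log-subharmonicity
   yields J <= n/beta by testing Laplace(v) >= |grad v|^2 / v - (n/beta) v against cut-off functions;
   as second derivatives need not be locally integrable, this integration by parts is justified by a
   bisection argument with refinable cut-offs (quadratic B-splines).

   The logarithmic Sobolev inequality is proved in dimension one by monotone transport and extended to
   products by the chain rule for relative entropy and its joint convexity. *)

theory Submission
  imports Defs "HOL-Probability.Probability"
begin

section \<open>Monotone transport on the line\<close>


text \<open>The comparison function v = gamma_beta is the equality case: there J = n/beta and the
  logarithmic Sobolev inequality for gamma_beta is sharp. The obstacle is that the hypotheses give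
  no decay of v or grad v and no integrability of second derivatives. Inequalities are therefore
  stated for nonnegative integrals that may be infinite, and cut-offs are removed by Fatou's lemma.
  On the line, boundary terms vanish only along sequences supplied by the mean value theorem.
  Transport fits this setting, because it uses one derivative of f and no approximation of f.
  Tensorisation usually passes to marginals, but a marginal of v is not known to be differentiable.
  Joint convexity replaces the entropy of the marginal by those of slices, which inherit the
  regularity of v. The cut-offs must satisfy |grad phi|^2 <= C phi, so that their error can be
  absorbed, and must be positive combinations of smaller copies of themselves. Piecewise linear hat
  functions fail the first requirement; quadratic B-splines meet both.\<close>

lemma antiderivative_exists:
  fixes f :: "real \<Rightarrow> real"
  assumes cont: "continuous_on UNIV f" and int: "integrable lborel f"
  obtains F where "\<And>x. (F has_real_derivative f x) (at x)"
    and "(F \<longlongrightarrow> 0) at_bot" and "(F \<longlongrightarrow> (\<integral>x. f x \<partial>lborel)) at_top"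
proof
  define F where "F x = (LINT t:{..x}|lborel. f t)" for x
  have si: "set_integrable lborel A f" if "A \<in> sets borel" for A
    using that int by (simp add: set_integrable_def integrable_mult_indicator del: real_scaleR_def)
  show "(F has_real_derivative f x) (at x)" for x
  proof -
    \<comment> \<open>Splitting off the half-line below \<open>x - 1\<close> leaves an integral over
      a compact interval, to which the fundamental theorem of calculus applies; the part split off
      is constant in \<open>y\<close>.\<close>
    have eq: "F y = (LINT t:{..<x-1}|lborel. f t) + integral {x-1..y} f" if "y \<in> {x-1..x+1}" for y
    proof -
      have "{..y} = {..<x-1} \<union> {x-1..y}" using that by auto
      moreover have "(LINT t:{..<x-1} \<union> {x-1..y}|lborel. f t) = (LINT t:{..<x-1}|lborel. f t) + (LINT t:{x-1..y}|lborel. f t)"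
        by (rule set_integral_Un) (auto intro!: si)
      ultimately have "F y = (LINT t:{..<x-1}|lborel. f t) + (LINT t:{x-1..y}|lborel. f t)"
        by (simp add: F_def)
      then show ?thesis
        using set_borel_integral_eq_integral(2)[OF si[of "{x-1..y}"]] by simp
    qed
    have "((\<lambda>y. (LINT t:{..<x-1}|lborel. f t) + integral {x-1..y} f) has_real_derivative f x) (at x within {x-1..x+1})"
      using integral_has_real_derivative[of "x-1" "x+1" f x] continuous_on_subset[OF cont]
      by (auto intro!: derivative_eq_intros)
    then have "(F has_real_derivative f x) (at x within {x-1..x+1})"
      by (subst has_field_derivative_cong_eventually[where g="\<lambda>y. (LINT t:{..<x-1}|lborel. f t) + integral {x-1..y} f"]) (auto simp: eq eventually_at_filter)
    then show ?thesis
      by (simp add: at_within_Icc_at)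
  qed
  show "(F \<longlongrightarrow> (\<integral>x. f x \<partial>lborel)) at_top"
    using tendsto_integral_at_top[OF _ int] unfolding F_def set_lebesgue_integral_def by simp
  \<comment> \<open>The limit at minus infinity is taken along \<open>- y\<close>, so that dominated
    convergence can be used at \<open>at_top\<close>.\<close>
  have "((\<lambda>y. \<integral>x. indicator {..-y} x *\<^sub>R f x \<partial>lborel) \<longlongrightarrow> (\<integral>x. 0 \<partial>(lborel :: real measure))) at_top"
  proof (rule integral_dominated_convergence_at_top[where w="\<lambda>x. \<bar>f x\<bar>"])
    show "AE x in lborel. ((\<lambda>y. indicat_real {..- y} x *\<^sub>R f x) \<longlongrightarrow> 0) at_top"
    proof (rule AE_I2)
      fix x
      have "eventually (\<lambda>y. indicat_real {..- y} x *\<^sub>R f x = 0) at_top"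
        using eventually_gt_at_top[of "-x"] by eventually_elim (auto simp: indicator_def)
      then show "((\<lambda>y. indicat_real {..- y} x *\<^sub>R f x) \<longlongrightarrow> 0) at_top"
        by (rule tendsto_eventually)
    qed
  qed (use int borel_measurable_integrable[OF int] in \<open>auto simp: indicator_def\<close>)
  then show "(F \<longlongrightarrow> 0) at_bot"
    unfolding filterlim_at_bot_mirror F_def set_lebesgue_integral_def by simp
qed

lemma strict_mono_antiderivative:
  fixes F f :: "real \<Rightarrow> real"
  assumes "\<And>x. (F has_real_derivative f x) (at x)" "\<And>x. f x > 0"
  shows "strict_mono F"
proof (rule strict_monoI)
  fix x y :: real assume "x < y"
  then show "F x < F y"
    by (rule DERIV_pos_imp_increasing) (use assms in blast)
qed

text \<open>The limits alone give weak inequalities; a unit step from \<open>x\<close> to either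
  side makes them strict. Strictness puts the values of one distribution function inside the open
  range of another, where the inverse is defined.\<close>

lemma strict_mono_limits:
  fixes F :: "real \<Rightarrow> real"
  assumes F: "strict_mono F" "(F \<longlongrightarrow> a) at_bot" "(F \<longlongrightarrow> b) at_top"
  shows "a < F x" "F x < b"
proof -
  have "a \<le> F (x - 1)"
  proof (rule tendsto_upperbound[OF F(2)])
    show "\<forall>\<^sub>F y in at_bot. F y \<le> F (x - 1)"
      using eventually_le_at_bot[of "x-1"]
      by eventually_elim (use F(1) in \<open>simp add: strict_mono_less_eq\<close>)
  qed simp
  also have "F (x - 1) < F x" using F(1) by (simp add: strict_mono_less)
  finally show "a < F x" .
  have "F x < F (x + 1)" using F(1) by (simp add: strict_mono_less)
  also have "F (x + 1) \<le> b"
  proof (rule tendsto_lowerbound[OF F(3)])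
    show "\<forall>\<^sub>F y in at_top. F (x + 1) \<le> F y"
      using eventually_ge_at_top[of "x+1"]
      by eventually_elim (use F(1) in \<open>simp add: strict_mono_less_eq\<close>)
  qed simp
  finally show "F x < b" .
qed

text \<open>With antiderivatives F of f and G of g vanishing at minus infinity, T is the inverse of
  G composed with F; equal masses give both the same open range. Differentiating G(T x) = F x yields
  the one-dimensional Monge-Ampere equation.\<close>

lemma monotone_transport_exists:
  fixes f g :: "real \<Rightarrow> real"
  assumes f: "continuous_on UNIV f" "integrable lborel f" "\<And>x. f x > 0"
    and g: "continuous_on UNIV g" "integrable lborel g" "\<And>x. g x > 0"
    and eq: "(\<integral>x. f x \<partial>lborel) = (\<integral>x. g x \<partial>lborel)"
  obtains T where "\<And>x. (T has_real_derivative f x / g (T x)) (at x)"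
    and "filterlim T at_top at_top" and "filterlim T at_bot at_bot"
proof -
  obtain F where F: "\<And>x. (F has_real_derivative f x) (at x)"
    "(F \<longlongrightarrow> 0) at_bot" "(F \<longlongrightarrow> (\<integral>x. f x \<partial>lborel)) at_top"
    using antiderivative_exists[OF f(1,2)] by blast
  obtain G where G: "\<And>x. (G has_real_derivative g x) (at x)"
    "(G \<longlongrightarrow> 0) at_bot" "(G \<longlongrightarrow> (\<integral>x. f x \<partial>lborel)) at_top"
    using antiderivative_exists[OF g(1,2)] eq by metis
  let ?m = "\<integral>x. f x \<partial>lborel"
  have sF: "strict_mono F" and sG: "strict_mono G"
    using strict_mono_antiderivative F(1) G(1) f(3) g(3) by blast+
  note limF = strict_mono_limits[OF sF F(2,3)]
  note limG = strict_mono_limits[OF sG G(2,3)]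
  have contG: "isCont G x" for x using G(1) DERIV_isCont by blast
  have surj: "\<exists>x. G x = z" if z: "0 < z" "z < ?m" for z
  proof -
    obtain a where a: "G a < z"
      using order_tendstoD(2)[OF G(2) z(1)] by (auto simp: eventually_at_bot_linorder)
    obtain b where b: "G b > z"
      using order_tendstoD(1)[OF G(3) z(2)] by (auto simp: eventually_at_top_linorder)
    have "a \<le> b" using a b sG by (metis less_trans linorder_not_le not_less_iff_gr_or_eq strict_mono_less)
    with a b show ?thesis using IVT[of G a z b] contG by auto
  qed
  define iG where "iG = inv G"
  have injG: "inj G" using sG strict_mono_eq by (auto intro: injI)
  have GiG: "G (iG z) = z" if "0 < z" "z < ?m" for z
    using surj[OF that] unfolding iG_def by (auto intro: f_inv_into_f)
  have iGG: "iG (G x) = x" for x using injG by (simp add: iG_def)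
  have DiG: "(iG has_real_derivative inverse (g (iG z))) (at z)" if z: "0 < z" "z < ?m" for z
  proof (rule DERIV_inverse_function[where f=G and a=0 and b="?m"])
    show "isCont iG z"
      using isCont_inverse_function[of 1 "iG z" iG G] iGG contG GiG[OF z] by auto
  qed (use G(1) g(3)[of "iG z"] z GiG in auto)
  define T where "T x = iG (F x)" for x
  have GT: "G (T x) = F x" for x unfolding T_def using limF GiG by blast
  show ?thesis
  proof
    show "(T has_real_derivative f x / g (T x)) (at x)" for x
      using DERIV_chain2[OF DiG F(1), of x] limF[of x] unfolding T_def
      by (simp add: field_simps)
    show "filterlim T at_top at_top"
      unfolding filterlim_at_top
    proof
      fix y
      show "\<forall>\<^sub>F x in at_top. y \<le> T x"
        using order_tendstoD(1)[OF F(3) limG(2)[of y]]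
        by eventually_elim (use GT sG in \<open>metis less_eq_real_def strict_mono_less\<close>)
    qed
    show "filterlim T at_bot at_bot"
      unfolding filterlim_at_bot
    proof
      fix y
      show "\<forall>\<^sub>F x in at_bot. T x \<le> y"
        using order_tendstoD(2)[OF F(2) limG(1)[of y]]
        by eventually_elim (use GT sG in \<open>metis less_eq_real_def strict_mono_less\<close>)
    qed
  qed
qed

text \<open>By the mean value theorem each increment of \<open>g\<close> over [k, k + 1] is a value
  of \<open>g'\<close>, and the increments of a convergent sequence tend to 0.\<close>

lemma vanishing_derivative_at_top:
  fixes g :: "real \<Rightarrow> real"
  assumes g: "\<And>x. (g has_real_derivative g' x) (at x)" and conv: "convergent (\<lambda>k::nat. g (real k))"
  obtains b where "\<And>k::nat. real k \<le> b k" "(\<lambda>k. g' (b k)) \<longlonglongrightarrow> 0"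
proof -
  have "\<exists>z\<ge>real k. g' z = g (real k + 1) - g (real k)" for k
  proof -
    obtain z where "z > real k" "g (real k + 1) - g (real k) = (real k + 1 - real k) * g' z"
      using MVT2[of "real k" "real k + 1" g g'] g by auto
    then show ?thesis by (intro exI[of _ z]) auto
  qed
  then obtain b where b: "\<And>k. real k \<le> b k" "\<And>k. g' (b k) = g (real k + 1) - g (real k)"
    by metis
  obtain L where l1: "(\<lambda>k. g (real k)) \<longlonglongrightarrow> L"
    using conv by (auto simp: convergent_def)
  have "(\<lambda>k. g (real (Suc k))) \<longlonglongrightarrow> L" using l1 by (rule LIMSEQ_Suc)
  from tendsto_diff[OF this l1] have "(\<lambda>k. g' (b k)) \<longlonglongrightarrow> 0"
    by (simp add: b(2) add.commute)
  with b(1) show ?thesis using that by blast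
qed

lemma vanishing_derivative_at_bot:
  fixes g :: "real \<Rightarrow> real"
  assumes g: "\<And>x. (g has_real_derivative g' x) (at x)" and conv: "convergent (\<lambda>k::nat. g (- real k))"
  obtains a where "\<And>k::nat. a k \<le> - real k" "(\<lambda>k. g' (a k)) \<longlonglongrightarrow> 0"
proof -
  have "((\<lambda>x. g (- x)) has_real_derivative - g' (- x)) (at x)" for x
    using DERIV_chain2[OF g DERIV_minus[OF DERIV_ident], of x] by simp
  then obtain b where b: "\<And>k::nat. real k \<le> b k" "(\<lambda>k. - g' (- b k)) \<longlonglongrightarrow> 0"
    using vanishing_derivative_at_top[of "\<lambda>x. g (-x)" "\<lambda>x. - g' (- x)"] conv by blast
  show ?thesis
    by (rule that[of "\<lambda>k. - b k"]) (use b tendsto_minus[OF b(2)] in auto)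
qed

text \<open>\<open>\<Psi>\<close> carries the boundary terms of an integration by parts, controlled
  only at the endpoints \<open>a k\<close> and \<open>b k\<close>; \<open>\<kappa>\<close> is a
  signed correction of integral zero. The signs of \<open>h\<close> and \<open>\<rho>\<close> permit
  Fatou's lemma, so both integrals may be infinite.\<close>

lemma nn_integral_le_up_to_boundary:
  fixes h \<rho> \<kappa> \<Psi> :: "real \<Rightarrow> real"
  assumes cont: "continuous_on UNIV h" "continuous_on UNIV \<rho>" "continuous_on UNIV \<kappa>"
    and nonneg: "\<And>x. 0 \<le> h x" "\<And>x. 0 \<le> \<rho> x"
    and \<kappa>: "has_bochner_integral lborel \<kappa> 0"
    and \<Psi>: "\<And>x. (\<Psi> has_real_derivative \<psi> x) (at x)"
    and le: "\<And>x. h x \<le> \<psi> x + \<rho> x + \<kappa> x"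
    and ab: "\<And>k. a k \<le> - real k" "\<And>k. real k \<le> b k"
    and bd: "\<And>k. k \<ge> k0 \<Longrightarrow> \<Psi> (b k) - \<Psi> (a k) \<le> e k" and e: "e \<longlonglongrightarrow> 0"
  shows "(\<integral>\<^sup>+x. ennreal (h x) \<partial>lborel) \<le> (\<integral>\<^sup>+x. ennreal (\<rho> x) \<partial>lborel)"
proof (cases "(\<integral>\<^sup>+x. ennreal (\<rho> x) \<partial>lborel)")
  case (real r)
  have aleb: "a k \<le> b k" for k using ab[of k] by linarith
  have meas[measurable]: "h \<in> borel_measurable borel" "\<rho> \<in> borel_measurable borel" "\<kappa> \<in> borel_measurable borel"
    using cont borel_measurable_continuous_onI by auto
  have \<kappa>i: "integrable lborel \<kappa>" "(\<integral>x. \<kappa> x \<partial>lborel) = 0"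
    using \<kappa> by (auto simp: has_bochner_integral_iff)
  have ind: "(\<lambda>k. indicat_real {a k..b k} x) \<longlonglongrightarrow> 1" for x
  proof (rule tendsto_eventually)
    obtain N :: nat where "\<bar>x\<bar> \<le> real N" using real_arch_simple by blast
    then show "\<forall>\<^sub>F k in sequentially. indicat_real {a k..b k} x = 1"
      unfolding eventually_sequentially
    proof (intro exI[of _ N] allI impI)
      fix k assume "N \<le> k"
      then show "indicat_real {a k..b k} x = 1"
        using ab[of k] \<open>\<bar>x\<bar> \<le> real N\<close> of_nat_mono[OF \<open>N \<le> k\<close>, where 'a=real]
        by (auto simp: indicator_def abs_le_iff)
    qed
  qed
  define K where "K k = (LINT x|lborel. indicator {a k..b k} x *\<^sub>R \<kappa> x)" for k
  have "K \<longlonglongrightarrow> (LINT x|lborel. \<kappa> x)"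
    unfolding K_def
  proof (rule integral_dominated_convergence[where w="\<lambda>x. \<bar>\<kappa> x\<bar>"])
    show "AE x in lborel. (\<lambda>k. indicat_real {a k..b k} x *\<^sub>R \<kappa> x) \<longlonglongrightarrow> \<kappa> x"
      using tendsto_mult[OF ind tendsto_const] by auto
  qed (use \<kappa>i in \<open>auto simp: indicator_def\<close>)
  then have Klim: "K \<longlonglongrightarrow> 0" by (simp add: \<kappa>i)
  have si: "set_integrable lborel {a k..b k} u" if "continuous_on UNIV u" for u :: "real \<Rightarrow> real" and k
    using borel_integrable_atLeastAtMost'[of "a k" "b k" u] continuous_on_subset[OF that] by auto
  note sii = si[unfolded set_integrable_def]
  have bound: "(\<integral>\<^sup>+x. ennreal (h x) * indicator {a k..b k} x \<partial>lborel) \<le> ennreal (r + (e k + K k))" if "k \<ge> k0" for k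
  proof -
    have hk: "integral {a k..b k} h = (LINT x|lborel. indicator {a k..b k} x *\<^sub>R h x)"
      using set_borel_integral_eq_integral(2)[OF si[OF cont(1)]] by (simp add: set_lebesgue_integral_def)
    have rk: "integral {a k..b k} \<rho> = (LINT x|lborel. indicator {a k..b k} x *\<^sub>R \<rho> x)"
      using set_borel_integral_eq_integral(2)[OF si[OF cont(2)]] by (simp add: set_lebesgue_integral_def)
    have kk: "integral {a k..b k} \<kappa> = K k"
      using set_borel_integral_eq_integral(2)[OF si[OF cont(3)]] by (simp add: set_lebesgue_integral_def K_def)
    have hi: "(u has_integral integral {a k..b k} u) {a k..b k}" if "continuous_on UNIV u" for u :: "real \<Rightarrow> real"
      by (rule integrable_integral[OF integrable_continuous_real[OF continuous_on_subset[OF that subset_UNIV]]])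
    \<comment> \<open>The gauge integral integrates every derivative over a compact interval, so the
      integrability of \<open>\<psi>\<close> need not be checked.\<close>
    have p: "(\<psi> has_integral (\<Psi> (b k) - \<Psi> (a k))) {a k..b k}"
      using fundamental_theorem_of_calculus[OF aleb[of k], of \<Psi> \<psi>] \<Psi>
      by (simp add: has_real_derivative_iff_has_vector_derivative has_vector_derivative_at_within)
    have "integral {a k..b k} h \<le> (\<Psi> (b k) - \<Psi> (a k)) + integral {a k..b k} \<rho> + integral {a k..b k} \<kappa>"
      by (rule has_integral_le[OF hi[OF cont(1)] has_integral_add[OF has_integral_add[OF p hi[OF cont(2)]] hi[OF cont(3)]]])
        (use le in auto)
    moreover have "integral {a k..b k} \<rho> \<le> r"
    proof -
      have "ennreal (integral {a k..b k} \<rho>) = (\<integral>\<^sup>+x. ennreal (indicator {a k..b k} x *\<^sub>R \<rho> x) \<partial>lborel)"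
        unfolding rk by (rule nn_integral_eq_integral[symmetric, OF sii[OF cont(2)]]) (use nonneg in auto)
      also have "\<dots> \<le> (\<integral>\<^sup>+x. ennreal (\<rho> x) \<partial>lborel)"
        by (rule nn_integral_mono) (use nonneg in \<open>auto simp: indicator_def\<close>)
      finally show ?thesis using real by simp
    qed
    ultimately have "integral {a k..b k} h \<le> r + (e k + K k)" using bd[OF that] kk by linarith
    moreover have "(\<integral>\<^sup>+x. ennreal (h x) * indicator {a k..b k} x \<partial>lborel) = ennreal (integral {a k..b k} h)"
    proof -
      have "(\<integral>\<^sup>+x. ennreal (indicator {a k..b k} x *\<^sub>R h x) \<partial>lborel) = ennreal (integral {a k..b k} h)"
        unfolding hk by (rule nn_integral_eq_integral[OF sii[OF cont(1)]]) (use nonneg in auto)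
      moreover have "(\<integral>\<^sup>+x. ennreal (h x) * indicator {a k..b k} x \<partial>lborel) = (\<integral>\<^sup>+x. ennreal (indicator {a k..b k} x *\<^sub>R h x) \<partial>lborel)"
        by (rule nn_integral_cong) (auto simp: indicator_def)
      ultimately show ?thesis by simp
    qed
    ultimately show ?thesis by (simp add: ennreal_leI)
  qed
  have "(\<integral>\<^sup>+x. ennreal (h x) \<partial>lborel) = (\<integral>\<^sup>+x. liminf (\<lambda>k. ennreal (h x) * indicator {a k..b k} x) \<partial>lborel)"
  proof (rule nn_integral_cong)
    fix x
    have "(\<lambda>k. ennreal (h x * indicat_real {a k..b k} x)) \<longlonglongrightarrow> ennreal (h x * 1)"
      by (intro tendsto_ennrealI tendsto_mult ind tendsto_const)
    moreover have "ennreal (h x * indicat_real {a k..b k} x) = ennreal (h x) * indicator {a k..b k} x" for k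
      by (auto simp: indicator_def)
    ultimately have "(\<lambda>k. ennreal (h x) * indicator {a k..b k} x) \<longlonglongrightarrow> ennreal (h x)" by simp
    then show "ennreal (h x) = liminf (\<lambda>k. ennreal (h x) * indicator {a k..b k} x)"
      by (simp add: lim_imp_Liminf)
  qed
  also have "\<dots> \<le> liminf (\<lambda>k. \<integral>\<^sup>+x. ennreal (h x) * indicator {a k..b k} x \<partial>lborel)"
    by (rule nn_integral_liminf) measurable
  also have "\<dots> \<le> liminf (\<lambda>k. ennreal (r + (e k + K k)))"
    by (rule Liminf_mono) (use bound in \<open>auto simp: eventually_sequentially\<close>)
  also have "\<dots> = ennreal (r + (0 + 0))"
    by (intro lim_imp_Liminf tendsto_ennrealI tendsto_add e Klim tendsto_const) simp
  finally show ?thesis using real by simp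
qed simp

section \<open>One-dimensional inequalities\<close>


text \<open>The integrand of relative entropy for densities of arbitrary mass, i.e. the Bregman
  divergence of t ln t. The correction - a + b makes it pointwise nonnegative, so that its integral
  always exists in [0, inf]; for equal masses the correction integrates to zero.\<close>

definition kl :: "real \<Rightarrow> real \<Rightarrow> real" where
  "kl a b = a * ln (a / b) - a + b"

text \<open>The left side is the tangent plane of \<open>kl\<close> at (A, B); it has no constant
  term because \<open>kl\<close> is homogeneous of degree 1. Integrating it gives Jensen's
  inequality for the jointly convex \<open>kl\<close>. The proof is ln t <= t - 1 at t = bA /
  (aB).\<close>

lemma kl_ge_tangent:
  assumes "a > 0" "b > 0" "A > 0" "B > 0"
  shows "a * ln (A / B) + b * (1 - A / B) \<le> kl a b"
proof -
  have "ln ((b * A) / (a * B)) \<le> (b * A) / (a * B) - 1"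
    using assms by (intro ln_le_minus_one) auto
  then have "a * ln ((b * A) / (a * B)) \<le> a * ((b * A) / (a * B) - 1)"
    using assms by (intro mult_left_mono) auto
  also have "\<dots> = b * (A / B) - a"
    using assms by (simp add: field_simps)
  finally show ?thesis
    using assms by (simp add: kl_def ln_div ln_mult algebra_simps)
qed

lemma kl_nonneg: "a > 0 \<Longrightarrow> b > 0 \<Longrightarrow> 0 \<le> kl a b"
  using kl_ge_tangent[of a b 1 1] by simp

lemma kl_measurable[measurable]:
  assumes [measurable]: "f \<in> borel_measurable M" "g \<in> borel_measurable M"
  shows "(\<lambda>x. kl (f x) (g x)) \<in> borel_measurable M"
  unfolding kl_def by measurable

section \<open>Normal densities and the inequalities on the line\<close>

abbreviation centered_normal :: "real \<Rightarrow> real \<Rightarrow> real" where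
  "centered_normal \<beta> \<equiv> normal_density 0 (sqrt \<beta>)"

lemma centered_normal_deriv:
  assumes "\<beta> > 0"
  shows "(centered_normal \<beta> has_real_derivative - (x / \<beta>) * centered_normal \<beta> x) (at x)"
  unfolding normal_density_def using assms
  by (auto intro!: derivative_eq_intros simp: field_simps)

lemma centered_normal_tendsto_0:
  assumes "\<beta> > 0"
  shows "(centered_normal \<beta> \<longlongrightarrow> 0) at_top" "(centered_normal \<beta> \<longlongrightarrow> 0) at_bot"
proof -
  have *: "filterlim (\<lambda>x. - (x\<^sup>2 / (2 * \<beta>))) at_bot F" if "filterlim (\<lambda>x::real. x\<^sup>2) at_top F" for F
    unfolding filterlim_uminus_at_bot[symmetric]
    using filterlim_tendsto_pos_mult_at_top[OF tendsto_const[of "1 / (2 * \<beta>)"] _ that] assms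
    by (simp add: filterlim_uminus_at_bot)
  have **: "((\<lambda>x. c * exp (- (x\<^sup>2 / (2 * \<beta>)))) \<longlongrightarrow> 0) F" if "filterlim (\<lambda>x::real. x\<^sup>2) at_top F" for F and c :: real
    using tendsto_mult_right[OF filterlim_compose[OF exp_at_bot *[OF that]], of c] by (simp add: mult.commute)
  have "filterlim (\<lambda>x::real. x\<^sup>2) at_top at_top"
    by (intro filterlim_pow_at_top filterlim_ident) simp
  moreover have "filterlim (\<lambda>x::real. x\<^sup>2) at_top at_bot"
    by (intro filterlim_pow_at_bot_even filterlim_ident) auto
  ultimately show "(centered_normal \<beta> \<longlongrightarrow> 0) at_top" "(centered_normal \<beta> \<longlongrightarrow> 0) at_bot"
    unfolding normal_density_def using **[of at_top "1 / sqrt (2 * pi * \<beta>)"] **[of at_bot "1 / sqrt (2 * pi * \<beta>)"]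
      assms by auto
qed

text \<open>With \<open>T = id + \<theta>\<close> transporting \<open>f\<close> to \<open>m \<cdot> centered_normal \<beta>\<close>, the integrands differ at most by the
  derivative of \<open>f \<theta>\<close>, whose boundary terms vanish along suitable sequences because \<open>f T\<close> is, up to a
  constant, the derivative of a convergent function.\<close>

lemma gaussian_log_sobolev_real:
  fixes f f' :: "real \<Rightarrow> real"
  assumes \<beta>: "\<beta> > 0" and pos: "\<And>x. f x > 0" and deriv: "\<And>x. (f has_real_derivative f' x) (at x)"
    and cont': "continuous_on UNIV f'" and int: "integrable lborel f"
  shows "(\<integral>\<^sup>+x. ennreal (kl (f x) ((\<integral>t. f t \<partial>lborel) * centered_normal \<beta> x)) \<partial>lborel)
    \<le> (\<integral>\<^sup>+x. ennreal (\<beta> / 2 * ((f' x + x * f x / \<beta>)\<^sup>2 / f x)) \<partial>lborel)"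
proof -
  define m where "m = (\<integral>t. f t \<partial>lborel)"
  define g where "g x = m * centered_normal \<beta> x" for x
  have cont: "continuous_on UNIV f"
    using deriv DERIV_isCont by (auto simp: continuous_on_eq_continuous_at)
  obtain F where F: "\<And>x. (F has_real_derivative f x) (at x)" "(F \<longlongrightarrow> 0) at_bot" "(F \<longlongrightarrow> m) at_top"
    using antiderivative_exists[OF cont int] unfolding m_def by blast
  have "m > 0"
    using strict_mono_limits[OF strict_mono_antiderivative[OF F(1) pos] F(2,3), of 0] by linarith
  have gpos: "g x > 0" for x using \<open>m > 0\<close> \<beta> by (simp add: g_def normal_density_pos)
  have gderiv: "(g has_real_derivative - (x / \<beta>) * g x) (at x)" for x
    unfolding g_def by (rule DERIV_cmult[OF centered_normal_deriv[OF \<beta>], THEN DERIV_cong]) simp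
  have gcont: "continuous_on UNIV g"
    using gderiv DERIV_isCont by (auto simp: continuous_on_eq_continuous_at)
  have gint: "has_bochner_integral lborel g m"
    unfolding g_def using has_bochner_integral_mult_right[of m lborel "centered_normal \<beta>" 1] \<beta>
    by (simp add: has_bochner_integral_iff)
  obtain T where T: "\<And>x. (T has_real_derivative f x / g (T x)) (at x)"
    "filterlim T at_top at_top" "filterlim T at_bot at_bot"
    using monotone_transport_exists[OF cont int pos gcont _ gpos] gint
    by (metis has_bochner_integral_iff m_def)
  \<comment> \<open>Since T' = f / (g o T), the factor g(T x) cancels in the derivative of g o T;
    that function tends to 0 at both ends.\<close>
  define D where "D x = - (T x / \<beta>) * f x" for x
  have D: "((\<lambda>x. g (T x)) has_real_derivative D x) (at x)" for x
    unfolding D_def by (rule DERIV_chain2[OF gderiv T(1), THEN DERIV_cong]) (use gpos[of "T x"] in auto)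
  have g0: "(g \<longlongrightarrow> 0) at_top" "(g \<longlongrightarrow> 0) at_bot"
    unfolding g_def using tendsto_mult_right_zero[OF centered_normal_tendsto_0(1)[OF \<beta>]]
      tendsto_mult_right_zero[OF centered_normal_tendsto_0(2)[OF \<beta>]] by auto
  obtain b where b: "\<And>k::nat. real k \<le> b k" "(\<lambda>k. D (b k)) \<longlonglongrightarrow> 0"
    using vanishing_derivative_at_top[OF D]
      filterlim_compose[OF filterlim_compose[OF g0(1) T(2)] filterlim_real_sequentially]
    by (auto simp: convergent_def)
  obtain a where a: "\<And>k::nat. a k \<le> - real k" "(\<lambda>k. D (a k)) \<longlonglongrightarrow> 0"
    using vanishing_derivative_at_bot[OF D] filterlim_compose[OF filterlim_compose[OF g0(2) T(3)]
      filterlim_uminus_at_bot_at_top[THEN filterlim_compose, OF filterlim_real_sequentially]]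
    by (auto simp: convergent_def)
  have \<beta>D: "\<beta> * \<bar>D x\<bar> = f x * \<bar>T x\<bar>" for x
    using \<beta> pos[of x] by (simp add: D_def abs_mult)
  show ?thesis
    unfolding m_def[symmetric] g_def[symmetric]
  proof (rule nn_integral_le_up_to_boundary[where \<kappa>="\<lambda>x. g x - f x" and \<Psi>="\<lambda>x. f x * (T x - x)"
        and \<psi>="\<lambda>x. f' x * (T x - x) + f x * (f x / g (T x) - 1)" and a=a and b=b and ?k0.0=0
        and e="\<lambda>k. \<beta> * \<bar>D (b k)\<bar> + \<beta> * \<bar>D (a k)\<bar>"])
    show "continuous_on UNIV (\<lambda>x. kl (f x) (g x))"
      unfolding kl_def using pos gpos
      by (auto intro!: continuous_intros cont gcont simp: less_imp_neq[THEN not_sym])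
    show "continuous_on UNIV (\<lambda>x. \<beta> / 2 * ((f' x + x * f x / \<beta>)\<^sup>2 / f x))"
      using \<beta> pos by (auto intro!: continuous_intros cont cont' simp: less_imp_neq[THEN not_sym])
    show "continuous_on UNIV (\<lambda>x. g x - f x)"
      by (intro continuous_intros cont gcont)
    show "0 \<le> kl (f x) (g x)" for x using kl_nonneg pos gpos by blast
    show "0 \<le> \<beta> / 2 * ((f' x + x * f x / \<beta>)\<^sup>2 / f x)" for x using \<beta> pos[of x] by simp
    show "has_bochner_integral lborel (\<lambda>x. g x - f x) 0"
      using has_bochner_integral_diff[OF gint] int unfolding m_def
      by (metis diff_self has_bochner_integral_integrable)
    show "((\<lambda>x. f x * (T x - x)) has_real_derivative f' x * (T x - x) + f x * (f x / g (T x) - 1)) (at x)" for x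
      by (auto intro!: derivative_eq_intros deriv T(1))
    show "kl (f x) (g x) \<le> f' x * (T x - x) + f x * (f x / g (T x) - 1)
        + \<beta> / 2 * ((f' x + x * f x / \<beta>)\<^sup>2 / f x) + (g x - f x)" for x
    proof -
      define \<theta> where "\<theta> = T x - x"
      have Tx: "T x = x + \<theta>" by (simp add: \<theta>_def)
      have "ln (g (T x)) - ln (g x) = (x\<^sup>2 - (T x)\<^sup>2) / (2 * \<beta>)"
        using \<open>m > 0\<close> \<beta> by (simp add: g_def normal_density_def ln_mult ln_div field_simps)
      \<comment> \<open>As f / g(T) is T', this is ln T' <= T' - 1. The right side is the derivative
        of \<theta> and combines with the term containing \<open>f'\<close> to the derivative of f
        \<theta>.\<close>
      moreover have "ln (f x / g (T x)) \<le> f x / g (T x) - 1"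
        using pos gpos by (intro ln_le_minus_one) auto
      ultimately have "ln (f x / g x) \<le> f x / g (T x) - 1 + (x\<^sup>2 - (T x)\<^sup>2) / (2 * \<beta>)"
        using pos[of x] gpos[of x] gpos[of "T x"] by (simp add: ln_div)
      then have "f x * ln (f x / g x) \<le> f x * (f x / g (T x) - 1 + (x\<^sup>2 - (T x)\<^sup>2) / (2 * \<beta>))"
        using pos[of x] by (intro mult_left_mono) auto
      then have 1: "kl (f x) (g x) \<le> f x * (f x / g (T x) - 1) + f x * ((x\<^sup>2 - (T x)\<^sup>2) / (2 * \<beta>)) + (g x - f x)"
        by (simp add: kl_def algebra_simps)
      define c where "c = f' x + x * f x / \<beta>"
      \<comment> \<open>Young's inequality as a square: c / f is the logarithmic derivative of f /
        g, and the square vanishes for the displacement \<theta> = - \<beta> c / f.\<close>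
      have "0 \<le> \<beta> / (2 * f x) * (c + f x * \<theta> / \<beta>)\<^sup>2"
        using \<beta> pos[of x] by simp
      also have "\<dots> = \<beta> / 2 * (c\<^sup>2 / f x) + c * \<theta> + f x * \<theta>\<^sup>2 / (2 * \<beta>)"
        using \<beta> pos[of x] by (simp add: power2_sum field_simps) (simp add: power2_eq_square)
      also have "\<dots> = f' x * \<theta> + \<beta> / 2 * (c\<^sup>2 / f x) - f x * ((x\<^sup>2 - (T x)\<^sup>2) / (2 * \<beta>))"
      proof -
        have eq: "x\<^sup>2 - (T x)\<^sup>2 = - (2 * x * \<theta> + \<theta>\<^sup>2)" unfolding Tx by (simp add: power2_sum)
        show ?thesis unfolding eq using \<beta> by (simp add: c_def field_simps)
      qed
      finally show ?thesis using 1 by (simp add: \<theta>_def c_def)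
    qed
    \<comment> \<open>Only an upper bound is needed. As \<open>b k\<close> is nonnegative and
      \<open>a k\<close> nonpositive, the parts containing these points themselves have a favourable
      sign, and f T remains.\<close>
    show "f (b k) * (T (b k) - b k) - f (a k) * (T (a k) - a k) \<le> \<beta> * \<bar>D (b k)\<bar> + \<beta> * \<bar>D (a k)\<bar>" for k
    proof -
      have "T (b k) - b k \<le> \<bar>T (b k)\<bar>" "a k - T (a k) \<le> \<bar>T (a k)\<bar>"
        using a(1)[of k] b(1)[of k] by linarith+
      then have "f (b k) * (T (b k) - b k) \<le> f (b k) * \<bar>T (b k)\<bar>" "f (a k) * (a k - T (a k)) \<le> f (a k) * \<bar>T (a k)\<bar>"
        using pos[of "a k"] pos[of "b k"] by (simp_all add: mult_left_mono)
      then show ?thesis unfolding \<beta>D by (simp add: algebra_simps)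
    qed
    show "(\<lambda>k. \<beta> * \<bar>D (b k)\<bar> + \<beta> * \<bar>D (a k)\<bar>) \<longlonglongrightarrow> 0"
      using a(2) b(2) by (auto intro!: tendsto_eq_intros)
  qed (use a b in auto)
qed

text \<open>The logarithmic derivative \<open>p\<close> of \<open>f\<close> has a zero \<open>m\<close> and \<open>\<bar>p\<bar>\<close> dominates \<open>\<bar>x - m\<bar> / \<beta>\<close> with the opposite
  sign, so \<open>p\<^sup>2 f \<ge> - (x - m) / \<beta> \<cdot> f'\<close>; integrate by parts.\<close>

lemma fisher_lower_bound_real:
  fixes f f' :: "real \<Rightarrow> real"
  assumes \<beta>: "\<beta> > 0" and pos: "\<And>x. f x > 0" and deriv: "\<And>x. (f has_real_derivative f' x) (at x)"
    and cont': "continuous_on UNIV f'"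
    and dec: "\<And>x y. x \<le> y \<Longrightarrow> f' y / f y + y / \<beta> \<le> f' x / f x + x / \<beta>"
  shows "(\<integral>\<^sup>+x. ennreal (f x / \<beta>) \<partial>lborel) \<le> (\<integral>\<^sup>+x. ennreal ((f' x)\<^sup>2 / f x) \<partial>lborel)"
proof -
  have cont: "continuous_on UNIV f"
    using deriv DERIV_isCont by (auto simp: continuous_on_eq_continuous_at)
  define p where "p x = f' x / f x" for x
  have contp: "continuous_on UNIV p"
    unfolding p_def using pos by (auto intro!: continuous_intros cont cont' simp: less_imp_neq[THEN not_sym])
  have dec: "p y + y / \<beta> \<le> p x + x / \<beta>" if "x \<le> y" for x y
    using dec[OF that] by (simp add: p_def)
  obtain m where m: "p m = 0"
  proof -
    \<comment> \<open>Since p + x / \<beta> decreases, moving a distance \<beta> |p 0| away from the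
      origin changes p by at least |p 0|, enough to force a sign change.\<close>
    let ?c = "\<beta> * \<bar>p 0\<bar>"
    have "p ?c \<le> 0" using dec[of 0 ?c] \<beta> by simp
    moreover have "0 \<le> p (- ?c)" using dec[of "- ?c" 0] \<beta> by simp
    ultimately have "\<exists>x\<ge>- ?c. x \<le> ?c \<and> p x = 0"
      using \<beta> contp by (intro IVT2') (auto intro: continuous_on_subset)
    then show ?thesis using that by blast
  qed
  have right: "p x \<le> - ((x - m) / \<beta>)" if "m \<le> x" for x
    using dec[OF that] m by (simp add: diff_divide_distrib)
  have left: "- ((x - m) / \<beta>) \<le> p x" if "x \<le> m" for x
    using dec[OF that] m by (simp add: diff_divide_distrib)
  have f'p: "f' x = f x * p x" for x using pos[of x] by (simp add: p_def)
  \<comment> \<open>f is unimodal with mode m, hence monotone and bounded below towards either end.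
    Its convergence along the integers supplies points where \<open>f'\<close> tends to 0.\<close>
  have anti: "f y \<le> f x" if "m \<le> x" "x \<le> y" for x y
  proof (rule DERIV_nonpos_imp_nonincreasing[OF that(2)])
    fix t assume "x \<le> t" "t \<le> y"
    then have "p t \<le> 0" using right[of t] that \<beta> by (smt (verit) divide_nonneg_pos)
    then show "\<exists>y. DERIV f t :> y \<and> y \<le> 0"
      using deriv f'p pos[of t] by (metis mult_nonneg_nonpos less_imp_le)
  qed
  have mono: "f x \<le> f y" if "x \<le> y" "y \<le> m" for x y
  proof (rule DERIV_nonneg_imp_nondecreasing[OF that(1)])
    fix t assume "x \<le> t" "t \<le> y"
    then have "0 \<le> p t" using left[of t] that \<beta> by (smt (verit) divide_nonpos_pos)
    then show "\<exists>y. DERIV f t :> y \<and> 0 \<le> y"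
      using deriv f'p pos[of t] by (metis mult_nonneg_nonneg less_imp_le)
  qed
  have "convergent (\<lambda>k. f (real k))"
  proof -
    obtain N :: nat where N: "m \<le> real N" using real_arch_simple by blast
    have "decseq (\<lambda>k. f (real (k + N)))"
      using N by (intro decseq_SucI anti) auto
    moreover have "\<forall>k. 0 \<le> f (real (k + N))" using pos less_imp_le by blast
    ultimately have "convergent (\<lambda>k. f (real (k + N)))"
      using decseq_convergent[of _ 0] by (metis convergent_def)
    then show ?thesis using convergent_ignore_initial_segment[of "\<lambda>k. f (real k)" N] by simp
  qed
  then obtain b where b: "\<And>k::nat. real k \<le> b k" "(\<lambda>k. f' (b k)) \<longlonglongrightarrow> 0"
    using vanishing_derivative_at_top[OF deriv] by blast
  have "convergent (\<lambda>k. f (- real k))"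
  proof -
    obtain N :: nat where N: "- m \<le> real N" using real_arch_simple by blast
    have "decseq (\<lambda>k. f (- real (k + N)))"
      using N by (intro decseq_SucI mono) auto
    moreover have "\<forall>k. 0 \<le> f (- real (k + N))" using pos less_imp_le by blast
    ultimately have "convergent (\<lambda>k. f (- real (k + N)))"
      using decseq_convergent[of _ 0] by (metis convergent_def)
    then show ?thesis using convergent_ignore_initial_segment[of "\<lambda>k. f (- real k)" N] by simp
  qed
  then obtain a where a: "\<And>k::nat. a k \<le> - real k" "(\<lambda>k. f' (a k)) \<longlonglongrightarrow> 0"
    using vanishing_derivative_at_bot[OF deriv] by blast
  obtain k0 :: nat where k0: "\<bar>m\<bar> \<le> real k0" using real_arch_simple by blast
  show ?thesis
  proof (rule nn_integral_le_up_to_boundary[where \<kappa>="\<lambda>_. 0" and \<Psi>="\<lambda>x. (x - m) / \<beta> * f x"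
        and \<psi>="\<lambda>x. f x / \<beta> + (x - m) / \<beta> * f' x" and a=a and b=b and ?k0.0=k0
        and e="\<lambda>k. \<bar>f' (b k)\<bar> + \<bar>f' (a k)\<bar>"])
    show "continuous_on UNIV (\<lambda>x. f x / \<beta>)" using \<beta> by (auto intro!: continuous_intros cont)
    show "continuous_on UNIV (\<lambda>x. (f' x)\<^sup>2 / f x)"
      using pos by (auto intro!: continuous_intros cont cont' simp: less_imp_neq[THEN not_sym])
    show "0 \<le> f x / \<beta>" "0 \<le> (f' x)\<^sup>2 / f x" for x using \<beta> pos[of x] by simp_all
    show "((\<lambda>x. (x - m) / \<beta> * f x) has_real_derivative f x / \<beta> + (x - m) / \<beta> * f' x) (at x)" for x
      using \<beta> by (auto intro!: derivative_eq_intros deriv simp: field_simps)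
    \<comment> \<open>It suffices that p and p + (x - m) / \<beta> have the same sign, which holds
      on each side of m.\<close>
    show "f x / \<beta> \<le> f x / \<beta> + (x - m) / \<beta> * f' x + (f' x)\<^sup>2 / f x + 0" for x
    proof -
      have "0 \<le> p x * (p x + (x - m) / \<beta>)"
      proof (cases "m \<le> x")
        case True
        then show ?thesis using right[of x] \<beta>
          by (intro mult_nonpos_nonpos) (auto intro: order_trans[OF right])
      next
        case False
        then show ?thesis using left[of x] \<beta>
          by (intro mult_nonneg_nonneg) (auto intro: order_trans[OF _ left] simp: divide_nonpos_pos)
      qed
      then have "0 \<le> f x * (p x * (p x + (x - m) / \<beta>))" using pos[of x] by simp
      also have "\<dots> = (x - m) / \<beta> * f' x + (f' x)\<^sup>2 / f x"
        using pos[of x] by (simp add: p_def field_simps power2_eq_square)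
      finally show ?thesis by simp
    qed
    \<comment> \<open>From \<open>k0\<close> on, \<open>a k\<close> and \<open>b k\<close> lie on
      opposite sides of m, where |x - m| f / \<beta> is at most |f'|.\<close>
    show "(b k - m) / \<beta> * f (b k) - (a k - m) / \<beta> * f (a k) \<le> \<bar>f' (b k)\<bar> + \<bar>f' (a k)\<bar>" if "k \<ge> k0" for k
    proof -
      have k: "real k0 \<le> real k" using that by simp
      have "(b k - m) / \<beta> \<le> - p (b k)" using right[of "b k"] k b(1)[of k] k0 by linarith
      then have "(b k - m) / \<beta> * f (b k) \<le> - p (b k) * f (b k)"
        using mult_right_mono[OF _ less_imp_le[OF pos]] by blast
      moreover have "- ((a k - m) / \<beta>) \<le> p (a k)" using left[of "a k"] k a(1)[of k] k0 by linarith
      then have "- ((a k - m) / \<beta>) * f (a k) \<le> p (a k) * f (a k)"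
        using mult_right_mono[OF _ less_imp_le[OF pos]] by blast
      ultimately show ?thesis using f'p[of "a k"] f'p[of "b k"] by (simp add: mult.commute)
    qed
    show "(\<lambda>k. \<bar>f' (b k)\<bar> + \<bar>f' (a k)\<bar>) \<longlonglongrightarrow> 0"
      using a(2) b(2) by (auto intro!: tendsto_eq_intros)
  qed (use a b in auto)
qed

section \<open>The logarithmic Sobolev inequality on products\<close>


lemma integral_pos:
  fixes f :: "'a \<Rightarrow> real"
  assumes "integrable M f" "\<And>x. x \<in> space M \<Longrightarrow> f x > 0" "emeasure M (space M) \<noteq> 0"
  shows "(\<integral>x. f x \<partial>M) > 0"
proof -
  have nn: "AE x in M. 0 \<le> f x" using assms(2) by (auto intro!: AE_I2 less_imp_le)
  have "(\<integral>x. f x \<partial>M) \<noteq> 0"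
  proof
    assume "(\<integral>x. f x \<partial>M) = 0"
    then have "AE x in M. f x = 0" using integral_nonneg_eq_0_iff_AE[OF assms(1) nn] by simp
    then have "AE x in M. False" using AE_space by eventually_elim (use assms(2) in force)
    then show False using assms(3) by (auto elim!: AE_E simp: emeasure_eq_0 subset_antisym)
  qed
  moreover have "(\<integral>x. f x \<partial>M) \<ge> 0" using nn by (rule integral_nonneg_AE)
  ultimately show ?thesis by simp
qed

text \<open>\<open>ennreal\<close> sends negative numbers to 0, so the right side is the integral of
  the positive part.\<close>

lemma ennreal_integral_le_nn_integral:
  fixes X :: "'a \<Rightarrow> real"
  assumes "integrable M X"
  shows "ennreal (\<integral>x. X x \<partial>M) \<le> (\<integral>\<^sup>+x. ennreal (X x) \<partial>M)"
proof -
  have "(\<integral>x. X x \<partial>M) \<le> (\<integral>x. max 0 (X x) \<partial>M)"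
    using assms by (intro integral_mono) auto
  then have "ennreal (\<integral>x. X x \<partial>M) \<le> ennreal (\<integral>x. max 0 (X x) \<partial>M)" by (rule ennreal_leI)
  also have "\<dots> = (\<integral>\<^sup>+x. ennreal (max 0 (X x)) \<partial>M)"
    using assms by (intro nn_integral_eq_integral[symmetric]) auto
  also have "\<dots> = (\<integral>\<^sup>+x. ennreal (X x) \<partial>M)"
    by (intro nn_integral_cong) (auto simp: max_def ennreal_neg)
  finally show ?thesis .
qed

text \<open>Meant for a remainder B of varying sign that is nonnegative only in the mean. If A has
  infinite integral the bound is trivial; otherwise A is integrable and integration is
  additive.\<close>

lemma nn_integral_add_integrable_le:
  fixes A B :: "'a \<Rightarrow> real"
  assumes A: "A \<in> borel_measurable M" "\<And>x. x \<in> space M \<Longrightarrow> 0 \<le> A x"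
    and B: "integrable M B" "0 \<le> (\<integral>x. B x \<partial>M)"
    and AB: "\<And>x. x \<in> space M \<Longrightarrow> 0 \<le> A x + B x"
  shows "(\<integral>\<^sup>+x. ennreal (A x + B x) \<partial>M) \<le> (\<integral>\<^sup>+x. ennreal (A x) \<partial>M) + ennreal (\<integral>x. B x \<partial>M)"
proof (cases "(\<integral>\<^sup>+x. ennreal (A x) \<partial>M) = \<infinity>")
  case False
  then have iA: "integrable M A"
    using A by (intro integrableI_nonneg) (auto simp: less_top)
  have "(\<integral>\<^sup>+x. ennreal (A x + B x) \<partial>M) = ennreal (\<integral>x. A x + B x \<partial>M)"
    using AB iA B by (intro nn_integral_eq_integral) auto
  also have "\<dots> = ennreal (\<integral>x. A x \<partial>M) + ennreal (\<integral>x. B x \<partial>M)"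
    using iA B A by (simp add: ennreal_plus integral_nonneg_AE)
  also have "ennreal (\<integral>x. A x \<partial>M) = (\<integral>\<^sup>+x. ennreal (A x) \<partial>M)"
    using iA A by (intro nn_integral_eq_integral[symmetric]) auto
  finally show ?thesis by simp
qed simp

lemma product_sigma_finite_lborel: "product_sigma_finite (\<lambda>_. lborel :: real measure)"
  by standard

lemma emeasure_PiM_lborel_nonzero:
  assumes "finite I"
  shows "emeasure (PiM I (\<lambda>_. lborel :: real measure)) (space (PiM I (\<lambda>_. lborel :: real measure))) \<noteq> 0"
proof -
  interpret product_sigma_finite "\<lambda>_. lborel :: real measure" by (rule product_sigma_finite_lborel)
  show ?thesis
    using emeasure_PiM[OF assms, of "\<lambda>_. UNIV"] assms by (simp add: space_PiM)
qed

text \<open>The bracket on the right integrates to \<open>kl m (M * G)\<close> whenever w has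
  integral m and g has integral 1. Pointwise it has no sign.\<close>

lemma kl_chain_rule:
  assumes "w > 0" "m > 0" "M > 0" "g > 0" "G > 0"
  shows "kl w (M * (g * G)) = kl w (m * g) + (w * ln (m / (M * G)) - m * g + M * (g * G))"
  using assms by (simp add: kl_def ln_div ln_mult algebra_simps)

text \<open>On lines in the new direction the chain rule leaves the entropy of the marginal
  \<open>m\<close>. By \<open>kl_ge_tangent\<close> it is at most the integral over \<open>s\<close>
  of the integrands \<open>kl (W y s) (n s * \<Gamma> y)\<close>, and for fixed \<open>s\<close>
  this is the relative entropy of a slice of mass \<open>n s\<close>, to which the induction
  hypothesis applies.\<close>

lemma gaussian_log_sobolev_PiM:
  fixes V :: "('i \<Rightarrow> real) \<Rightarrow> real" and dV :: "'i \<Rightarrow> ('i \<Rightarrow> real) \<Rightarrow> real"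
  assumes "finite I" and \<beta>: "\<beta> > 0" and "\<And>x. V x > 0"
    and "\<And>i x t. i \<in> I \<Longrightarrow> ((\<lambda>t. V (x(i := t))) has_real_derivative dV i (x(i := t))) (at t)"
    and "\<And>i x. i \<in> I \<Longrightarrow> continuous_on UNIV (\<lambda>t. dV i (x(i := t)))"
    and "integrable (PiM I (\<lambda>_. lborel)) V"
    and "\<And>i. i \<in> I \<Longrightarrow> dV i \<in> borel_measurable (PiM I (\<lambda>_. lborel))"
  shows "(\<integral>\<^sup>+x. ennreal (kl (V x) ((\<integral>x. V x \<partial>PiM I (\<lambda>_. lborel)) * (\<Prod>i\<in>I. centered_normal \<beta> (x i)))) \<partial>PiM I (\<lambda>_. lborel))
    \<le> (\<Sum>i\<in>I. \<integral>\<^sup>+x. ennreal (\<beta> / 2 * ((dV i x + x i * V x / \<beta>)\<^sup>2 / V x)) \<partial>PiM I (\<lambda>_. lborel))"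
  using assms(1,3-)
proof (induction I arbitrary: V dV)
  case empty
  then show ?case
    by (simp add: PiM_empty lebesgue_integral_count_space_finite nn_integral_count_space_finite kl_def
        less_imp_neq[THEN not_sym])
next
  case (insert j I)
  interpret product_sigma_finite "\<lambda>_::'i. lborel :: real measure" by (rule product_sigma_finite_lborel)
  let ?P = "PiM I (\<lambda>_. lborel :: real measure)" and ?Q = "PiM (insert j I) (\<lambda>_. lborel :: real measure)"
  interpret P: finite_product_sigma_finite "\<lambda>_::'i. lborel :: real measure" I by standard (rule insert.hyps)
  interpret PL: pair_sigma_finite ?P "lborel :: real measure"
    by (intro pair_sigma_finite.intro P.sigma_finite_measure_axioms lborel.sigma_finite_measure_axioms)
  have Vpos: "\<And>x. V x > 0" by fact
  have Vint: "integrable ?Q V" by fact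
  note [measurable] = borel_measurable_integrable[OF Vint]
  have dVm[measurable]: "dV j \<in> borel_measurable ?Q" "\<And>i. i \<in> I \<Longrightarrow> dV i \<in> borel_measurable ?Q"
    using insert.prems(5) by auto
  define W where "W y s = V (y(j := s))" for y s
  define \<Gamma> where "\<Gamma> y = (\<Prod>i\<in>I. centered_normal \<beta> (y i))" for y
  define M where "M = (\<integral>x. V x \<partial>?Q)"
  define m where "m y = (\<integral>s. W y s \<partial>lborel)" for y
  define n where "n s = (\<integral>y. W y s \<partial>?P)" for s
  have upd[measurable]: "(\<lambda>(y, s). y(j := s)) \<in> measurable (?P \<Otimes>\<^sub>M lborel) ?Q"
    by (rule measurable_add_dim)
  have updm: "case_prod (\<lambda>y s. u (y(j := s))) \<in> borel_measurable (?P \<Otimes>\<^sub>M lborel)"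
    if "u \<in> borel_measurable ?Q" for u :: "_ \<Rightarrow> real"
    using measurable_compose[OF upd that] by (simp add: case_prod_beta')
  have Wm[measurable]: "case_prod W \<in> borel_measurable (?P \<Otimes>\<^sub>M lborel)"
    unfolding W_def by (rule updm) measurable
  have Wpos: "W y s > 0" for y s by (simp add: W_def Vpos)
  have \<Gamma>pos: "\<Gamma> y > 0" for y unfolding \<Gamma>_def using \<beta> by (intro prod_pos) (simp add: normal_density_pos)
  have \<gamma>pos: "centered_normal \<beta> s > 0" for s using \<beta> by (simp add: normal_density_pos)
  have \<Gamma>m[measurable]: "\<Gamma> \<in> borel_measurable ?P" unfolding \<Gamma>_def by measurable
  have Wint: "integrable (?P \<Otimes>\<^sub>M lborel) (case_prod W)"
  proof (rule integrableI_nonneg)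
    have "(\<integral>\<^sup>+z. ennreal (case_prod W z) \<partial>(?P \<Otimes>\<^sub>M lborel)) = (\<integral>\<^sup>+y. \<integral>\<^sup>+s. ennreal (W y s) \<partial>lborel \<partial>?P)"
      by (subst lborel.nn_integral_fst[symmetric]) (auto simp: case_prod_beta')
    also have "\<dots> = (\<integral>\<^sup>+x. ennreal (V x) \<partial>?Q)"
      unfolding W_def using insert.hyps by (subst product_nn_integral_insert) auto
    also have "\<dots> < \<infinity>" using Vint Vpos by (simp add: nn_integral_eq_integral less_imp_le)
    finally show "(\<integral>\<^sup>+z. ennreal (case_prod W z) \<partial>(?P \<Otimes>\<^sub>M lborel)) < \<infinity>" .
  qed (use Wpos in \<open>auto simp: less_imp_le\<close>)
  have goody: "AE y in ?P. integrable lborel (W y)" and "integrable ?P m" and "(\<integral>y. m y \<partial>?P) = (\<integral>z. case_prod W z \<partial>(?P \<Otimes>\<^sub>M lborel))"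
    unfolding m_def using PL.AE_integrable_fst[OF Wint] PL.integrable_fst[OF Wint] PL.integral_fst[OF Wint] by auto
  have goods: "AE s in lborel. integrable ?P (\<lambda>y. W y s)" and nint: "integrable lborel n" and nM: "(\<integral>s. n s \<partial>lborel) = (\<integral>z. case_prod W z \<partial>(?P \<Otimes>\<^sub>M lborel))"
    unfolding n_def using PL.AE_integrable_snd[OF Wint] PL.integrable_snd[OF Wint] PL.integral_snd[OF Wint] by auto
  have "M = (\<integral>y. m y \<partial>?P)"
    unfolding M_def m_def W_def using product_integral_insert[OF insert.hyps Vint] .
  then have nM: "(\<integral>s. n s \<partial>lborel) = M" using nM \<open>(\<integral>y. m y \<partial>?P) = _\<close> by simp
  have Mpos: "M > 0"
    unfolding M_def using Vint Vpos emeasure_PiM_lborel_nonzero[of "insert j I"] insert.hyps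
    by (intro integral_pos) auto
  \<comment> \<open>A slice that is not integrable has Bochner integral 0 by convention, so
    positivity of \<open>n\<close> is available only for the other slices, which is almost
    everywhere.\<close>
  have npos: "n s > 0" if "integrable ?P (\<lambda>y. W y s)" for s
    unfolding n_def using that Wpos emeasure_PiM_lborel_nonzero[of I] insert.hyps by (intro integral_pos) auto
  have nm[measurable]: "n \<in> borel_measurable lborel" using nint by auto
  define F where "F i x = ennreal (\<beta> / 2 * ((dV i x + x i * V x / \<beta>)\<^sup>2 / V x))" for i x
  have Fm[measurable]: "F i \<in> borel_measurable ?Q" if "i \<in> insert j I" for i
    unfolding F_def using that dVm by (cases "i = j") (auto intro!: measurable_compose[OF _ measurable_ennreal] borel_measurable_divide borel_measurable_power borel_measurable_add borel_measurable_times measurable_component_singleton)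
  have step: "(\<integral>\<^sup>+s. ennreal (kl (W y s) (M * (centered_normal \<beta> s * \<Gamma> y))) \<partial>lborel)
      \<le> (\<integral>\<^sup>+s. F j (y(j := s)) \<partial>lborel) + (\<integral>\<^sup>+s. ennreal (kl (W y s) (n s * \<Gamma> y)) \<partial>lborel)"
    if y: "y \<in> space ?P" and int: "integrable lborel (W y)" for y
  proof -
    have [measurable]: "W y \<in> borel_measurable lborel" using int by auto
    have mpos: "m y > 0" unfolding m_def using int Wpos by (intro integral_pos) auto
    have g1: "integrable lborel (centered_normal \<beta>)" "(\<integral>s. centered_normal \<beta> s \<partial>lborel) = 1" using \<beta> by auto
    let ?c = "ln (m y / (M * \<Gamma> y))"
    let ?B = "\<lambda>s. W y s * ?c - m y * centered_normal \<beta> s + M * (centered_normal \<beta> s * \<Gamma> y)"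
    have Bi: "integrable lborel ?B" using int g1 by auto
    have "(\<integral>s. ?B s \<partial>lborel) = m y * ?c - m y + M * \<Gamma> y"
      using int g1 by (simp add: m_def)
    then have Bkl: "(\<integral>s. ?B s \<partial>lborel) = kl (m y) (M * \<Gamma> y)" by (simp add: kl_def)
    have klB: "0 \<le> kl (m y) (M * \<Gamma> y)" using mpos Mpos \<Gamma>pos by (intro kl_nonneg) auto
    have chain: "kl (W y s) (M * (centered_normal \<beta> s * \<Gamma> y)) = kl (W y s) (m y * centered_normal \<beta> s) + ?B s" for s
      by (rule kl_chain_rule) (use Wpos mpos Mpos \<gamma>pos \<Gamma>pos in auto)
    have "(\<integral>\<^sup>+s. ennreal (kl (W y s) (M * (centered_normal \<beta> s * \<Gamma> y))) \<partial>lborel)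
        \<le> (\<integral>\<^sup>+s. ennreal (kl (W y s) (m y * centered_normal \<beta> s)) \<partial>lborel) + ennreal (kl (m y) (M * \<Gamma> y))"
      unfolding chain Bkl[symmetric]
    proof (rule nn_integral_add_integrable_le[OF _ _ Bi])
      show "0 \<le> kl (W y s) (m y * centered_normal \<beta> s) + ?B s" for s
        unfolding chain[symmetric] using Wpos Mpos \<gamma>pos \<Gamma>pos by (intro kl_nonneg) auto
      show "0 \<le> kl (W y s) (m y * centered_normal \<beta> s)" for s
        using Wpos mpos \<gamma>pos by (intro kl_nonneg) auto
    qed (use Bkl klB in auto)
    also have "(\<integral>\<^sup>+s. ennreal (kl (W y s) (m y * centered_normal \<beta> s)) \<partial>lborel) \<le> (\<integral>\<^sup>+s. F j (y(j := s)) \<partial>lborel)"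
      using gaussian_log_sobolev_real[OF \<beta>, of "W y" "\<lambda>s. dV j (y(j := s))"] insert.prems(2,3) int Wpos
      unfolding F_def m_def W_def by simp
    also have "ennreal (kl (m y) (M * \<Gamma> y)) \<le> (\<integral>\<^sup>+s. ennreal (kl (W y s) (n s * \<Gamma> y)) \<partial>lborel)"
    proof -
      \<comment> \<open>The tangent plane of \<open>kl\<close> at (m y, M * \<Gamma> y), evaluated
        at (W y s, n s * \<Gamma> y). The latter integrates over s to the point of tangency, so the
        plane integrates to the value of \<open>kl\<close> there.\<close>
      let ?X = "\<lambda>s. W y s * ?c + n s * (\<Gamma> y * (1 - m y / (M * \<Gamma> y)))"
      have "(\<integral>s. ?X s \<partial>lborel) = kl (m y) (M * \<Gamma> y)"
        using int nint nM Mpos \<Gamma>pos[of y] by (simp add: m_def kl_def field_simps)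
      then have "ennreal (kl (m y) (M * \<Gamma> y)) = ennreal (\<integral>s. ?X s \<partial>lborel)" by simp
      also have "\<dots> \<le> (\<integral>\<^sup>+s. ennreal (?X s) \<partial>lborel)"
        by (rule ennreal_integral_le_nn_integral) (use int nint in auto)
      also have "\<dots> \<le> (\<integral>\<^sup>+s. ennreal (kl (W y s) (n s * \<Gamma> y)) \<partial>lborel)"
      proof (rule nn_integral_mono_AE)
        show "AE s in lborel. ennreal (?X s) \<le> ennreal (kl (W y s) (n s * \<Gamma> y))"
          using goods
        proof eventually_elim
          case (elim s)
          show ?case
            using kl_ge_tangent[of "W y s" "n s * \<Gamma> y" "m y" "M * \<Gamma> y"] Wpos npos[OF elim] \<Gamma>pos mpos Mpos
            by (intro ennreal_leI) (simp add: mult.assoc)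
        qed
      qed
      finally show ?thesis .
    qed
    finally show ?thesis by (simp add: add_mono del: fun_upd_apply)
  qed
  have "(\<integral>\<^sup>+x. ennreal (kl (V x) (M * (\<Prod>i\<in>insert j I. centered_normal \<beta> (x i)))) \<partial>?Q)
      = (\<integral>\<^sup>+y. \<integral>\<^sup>+s. ennreal (kl (W y s) (M * (centered_normal \<beta> s * \<Gamma> y))) \<partial>lborel \<partial>?P)"
  proof -
    have eq: "(\<Prod>i\<in>insert j I. centered_normal \<beta> ((y(j := s)) i)) = centered_normal \<beta> s * \<Gamma> y" for y s
    proof -
      have "(\<Prod>i\<in>I. centered_normal \<beta> ((y(j := s)) i)) = \<Gamma> y"
        unfolding \<Gamma>_def using insert.hyps by (intro prod.cong) auto
      then show ?thesis using insert.hyps by simp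
    qed
    show ?thesis
      using insert.hyps by (subst product_nn_integral_insert) (auto simp: W_def eq simp del: prod.insert fun_upd_apply)
  qed
  also have "\<dots> \<le> (\<integral>\<^sup>+y. (\<integral>\<^sup>+s. F j (y(j := s)) \<partial>lborel) + (\<integral>\<^sup>+s. ennreal (kl (W y s) (n s * \<Gamma> y)) \<partial>lborel) \<partial>?P)"
    by (rule nn_integral_mono_AE) (use goody AE_space in \<open>eventually_elim, simp add: step\<close>)
  also have "\<dots> = (\<integral>\<^sup>+y. \<integral>\<^sup>+s. F j (y(j := s)) \<partial>lborel \<partial>?P) + (\<integral>\<^sup>+y. \<integral>\<^sup>+s. ennreal (kl (W y s) (n s * \<Gamma> y)) \<partial>lborel \<partial>?P)"
  proof (rule nn_integral_add)
    have "(\<lambda>z. F j ((\<lambda>(y, s). y(j := s)) z)) \<in> borel_measurable (?P \<Otimes>\<^sub>M lborel)"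
      by (rule measurable_compose[OF upd Fm]) simp
    then show "(\<lambda>y. \<integral>\<^sup>+s. F j (y(j := s)) \<partial>lborel) \<in> borel_measurable ?P"
      by (intro lborel.borel_measurable_nn_integral) (simp add: case_prod_beta')
  qed measurable
  also have "(\<integral>\<^sup>+y. \<integral>\<^sup>+s. F j (y(j := s)) \<partial>lborel \<partial>?P) = (\<integral>\<^sup>+x. F j x \<partial>?Q)"
    using insert.hyps by (intro product_nn_integral_insert[symmetric] Fm) auto
  also have "(\<integral>\<^sup>+y. \<integral>\<^sup>+s. ennreal (kl (W y s) (n s * \<Gamma> y)) \<partial>lborel \<partial>?P)
      = (\<integral>\<^sup>+s. \<integral>\<^sup>+y. ennreal (kl (W y s) (n s * \<Gamma> y)) \<partial>?P \<partial>lborel)"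
    by (rule PL.Fubini'[symmetric]) measurable
  also have "\<dots> \<le> (\<integral>\<^sup>+s. (\<Sum>i\<in>I. \<integral>\<^sup>+y. F i (y(j := s)) \<partial>?P) \<partial>lborel)"
  proof (rule nn_integral_mono_AE)
    show "AE s in lborel. (\<integral>\<^sup>+y. ennreal (kl (W y s) (n s * \<Gamma> y)) \<partial>?P) \<le> (\<Sum>i\<in>I. \<integral>\<^sup>+y. F i (y(j := s)) \<partial>?P)"
      using goods
    proof eventually_elim
      case (elim s)
      have tw: "x(i := t, j := s) = x(j := s, i := t)" if "i \<in> I" for x :: "'i \<Rightarrow> real" and i t
        using that insert.hyps by (intro fun_upd_twist) auto
      have comp: "(y(j := s)) i = y i" if "i \<in> I" for y :: "'i \<Rightarrow> real" and i
        using that insert.hyps by auto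
      have "(\<integral>\<^sup>+y. ennreal (kl (W y s) (n s * (\<Prod>i\<in>I. centered_normal \<beta> (y i)))) \<partial>?P)
         \<le> (\<Sum>i\<in>I. \<integral>\<^sup>+y. ennreal (\<beta> / 2 * ((dV i (y(j := s)) + y i * W y s / \<beta>)\<^sup>2 / W y s)) \<partial>?P)"
        unfolding n_def
      proof (rule insert.IH)
        show "(\<lambda>y. dV i (y(j := s))) \<in> borel_measurable ?P" if "i \<in> I" for i
          using measurable_compose[OF _ updm[OF dVm(2)[OF that]], of "\<lambda>y. (y, s)"] by simp
        show "((\<lambda>t. W (y(i := t)) s) has_real_derivative dV i (y(i := t, j := s))) (at t)" if "i \<in> I" for i y t
          unfolding W_def tw[OF that] using insert.prems(2) that by (blast intro: insertI2)
        show "continuous_on UNIV (\<lambda>t. dV i (y(i := t, j := s)))" if "i \<in> I" for i y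
          unfolding tw[OF that] using insert.prems(3) that by (blast intro: insertI2)
      qed (use Wpos elim in auto)
      also have "\<dots> = (\<Sum>i\<in>I. \<integral>\<^sup>+y. F i (y(j := s)) \<partial>?P)"
        by (intro sum.cong nn_integral_cong) (auto simp: F_def W_def comp simp del: fun_upd_apply)
      finally show ?case by (simp add: \<Gamma>_def)
    qed
  qed
  also have "\<dots> = (\<Sum>i\<in>I. \<integral>\<^sup>+s. \<integral>\<^sup>+y. F i (y(j := s)) \<partial>?P \<partial>lborel)"
  proof (rule nn_integral_sum)
    fix i assume "i \<in> I"
    then have "(\<lambda>z. F i ((\<lambda>(y, s). y(j := s)) z)) \<in> borel_measurable (?P \<Otimes>\<^sub>M lborel)"
      by (intro measurable_compose[OF upd Fm]) simp
    then have "case_prod (\<lambda>s y. F i (y(j := s))) \<in> borel_measurable (lborel \<Otimes>\<^sub>M ?P)"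
      by (subst measurable_pair_swap_iff) (simp add: case_prod_beta')
    then show "(\<lambda>s. \<integral>\<^sup>+y. F i (y(j := s)) \<partial>?P) \<in> borel_measurable lborel"
      by (rule P.borel_measurable_nn_integral)
  qed
  also have "\<dots> = (\<Sum>i\<in>I. \<integral>\<^sup>+x. F i x \<partial>?Q)"
    using insert.hyps by (intro sum.cong product_nn_integral_insert_rev[symmetric] Fm) auto
  finally show ?case
    using insert.hyps by (simp add: F_def M_def add_mono)
qed

section \<open>Cartesian coordinates\<close>


lemma measurable_vec_lambda[measurable]:
  "vec_lambda \<in> measurable (PiM UNIV (\<lambda>_::'n::finite. lborel :: real measure)) (borel :: (real ^ 'n) measure)"
  unfolding borel_measurable_euclidean_space[of vec_lambda]
  by (auto simp: Basis_vec_def inner_axis)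

lemma measurable_vec_nth[measurable (raw)]:
  fixes f :: "'a \<Rightarrow> real ^ 'n"
  shows "f \<in> borel_measurable M \<Longrightarrow> (\<lambda>x. f x $ i) \<in> borel_measurable M"
  by (simp add: cart_eq_inner_axis)

lemma norm_cart_power2: "(norm (x :: real ^ 'n))\<^sup>2 = (\<Sum>i\<in>UNIV. (x $ i)\<^sup>2)"
  unfolding power2_norm_eq_inner inner_vec_def by (simp add: power2_eq_square)

lemma prod_Basis_cart: "(\<Prod>b\<in>(Basis :: (real ^ 'n) set). f b) = (\<Prod>i\<in>UNIV. f (axis i 1))"
proof -
  have B: "(Basis :: (real ^ 'n) set) = range (\<lambda>i. axis i 1)" by (auto simp: Basis_vec_def)
  have "inj (\<lambda>i. axis i (1::real) :: real ^ 'n)" by (auto intro!: injI simp: axis_eq_axis)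
  then show ?thesis unfolding B by (simp add: prod.reindex)
qed

text \<open>Boxes pull back to products of intervals, and Lebesgue measure is determined by its
  values on boxes.\<close>

lemma lborel_eq_PiM_cart:
  "(lborel :: (real ^ 'n) measure) = distr (PiM UNIV (\<lambda>_. lborel)) borel vec_lambda"
proof (rule lborel_eqI)
  interpret product_sigma_finite "\<lambda>_::'n. lborel :: real measure" by (rule product_sigma_finite_lborel)
  fix l u :: "real ^ 'n" assume le: "\<And>b. b \<in> Basis \<Longrightarrow> l \<bullet> b \<le> u \<bullet> b"
  have le': "l $ i \<le> u $ i" for i using le[of "axis i 1"] by (auto simp: Basis_vec_def inner_axis)
  have "vec_lambda -` box l u \<inter> space (PiM UNIV (\<lambda>_::'n. lborel :: real measure)) = PiE UNIV (\<lambda>i. {l $ i <..< u $ i})"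
    by (auto simp: mem_box_cart space_PiM PiE_def extensional_def Pi_def)
  then have "emeasure (distr (PiM UNIV (\<lambda>_. lborel)) borel vec_lambda) (box l u)
      = emeasure (PiM UNIV (\<lambda>_::'n. lborel :: real measure)) (PiE UNIV (\<lambda>i. {l $ i <..< u $ i}))"
    by (subst emeasure_distr) auto
  also have "\<dots> = (\<Prod>i\<in>UNIV. ennreal (u $ i - l $ i))"
    by (subst emeasure_PiM) (auto simp: le')
  also have "\<dots> = ennreal (\<Prod>i\<in>UNIV. u $ i - l $ i)"
    by (rule prod_ennreal) (simp add: le')
  also have "(\<Prod>i\<in>UNIV. u $ i - l $ i) = (\<Prod>b\<in>Basis. (u - l) \<bullet> b)"
    by (simp add: prod_Basis_cart inner_axis)
  finally show "emeasure (distr (PiM UNIV (\<lambda>_. lborel)) borel vec_lambda) (box l u) = (\<Prod>b\<in>Basis. (u - l) \<bullet> b)" .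
qed simp

lemma nn_integral_lborel_cart:
  fixes f :: "real ^ 'n \<Rightarrow> ennreal"
  assumes "f \<in> borel_measurable borel"
  shows "(\<integral>\<^sup>+x. f x \<partial>lborel) = (\<integral>\<^sup>+x. f (vec_lambda x) \<partial>PiM UNIV (\<lambda>_. lborel))"
  by (subst lborel_eq_PiM_cart, subst nn_integral_distr) (use assms in auto)

lemma integral_lborel_cart:
  fixes f :: "real ^ 'n \<Rightarrow> real"
  assumes "f \<in> borel_measurable borel"
  shows "(\<integral>x. f x \<partial>lborel) = (\<integral>x. f (vec_lambda x) \<partial>PiM UNIV (\<lambda>_. lborel))"
  by (subst lborel_eq_PiM_cart, subst integral_distr) (use assms in auto)

lemma integrable_lborel_cart_iff:
  fixes f :: "real ^ 'n \<Rightarrow> real"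
  assumes "f \<in> borel_measurable borel"
  shows "integrable lborel f \<longleftrightarrow> integrable (PiM UNIV (\<lambda>_. lborel)) (\<lambda>x. f (vec_lambda x))"
  by (subst lborel_eq_PiM_cart, subst integrable_distr_eq) (use assms in auto)

lemma gauss_vec_lambda:
  assumes "\<beta> > 0"
  shows "gauss \<beta> (vec_lambda x :: real ^ 'n) = (\<Prod>i\<in>UNIV. centered_normal \<beta> (x i))"
proof -
  have "(2 * pi * \<beta>) powr (- real CARD('n) / 2) = (1 / sqrt (2 * pi * \<beta>)) ^ CARD('n)"
  proof -
    have "1 / sqrt (2 * pi * \<beta>) = (2 * pi * \<beta>) powr (- (1 / 2))"
      using assms by (simp add: powr_half_sqrt[symmetric] powr_minus_divide)
    then show ?thesis using assms by (simp add: powr_power)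
  qed
  moreover have "- (norm (vec_lambda x :: real ^ 'n))\<^sup>2 / (2 * \<beta>) = (\<Sum>i\<in>UNIV. - (x i)\<^sup>2 / (2 * \<beta>))"
    by (simp add: norm_cart_power2 sum_negf sum_divide_distrib)
  ultimately show ?thesis
    using assms by (simp add: gauss_def normal_density_def exp_sum prod.distrib[symmetric] prod_dividef power_one_over divide_simps)
qed

section \<open>Restriction to lines parallel to an axis\<close>

lemma vec_lambda_upd_eq: "(vec_lambda (x(i := t)) :: real ^ 'n) = vec_lambda x + (t - x i) *\<^sub>R axis i 1"
  by (simp add: vec_eq_iff axis_def)

lemma has_derivative_vec_lambda_upd:
  "((\<lambda>t. vec_lambda (x(i := t)) :: real ^ 'n) has_derivative (\<lambda>h. h *\<^sub>R axis i 1)) (at t)"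
  unfolding vec_lambda_upd_eq by (auto intro!: derivative_eq_intros)

lemma continuous_on_vec_lambda_upd:
  "continuous_on UNIV (\<lambda>t. vec_lambda (x(i := t)) :: real ^ 'n)"
  unfolding vec_lambda_upd_eq by (intro continuous_intros)

lemma gderiv_vec_lambda_upd:
  assumes "GDERIV v (vec_lambda (x(i := t)) :: real ^ 'n) :> g"
  shows "((\<lambda>t. v (vec_lambda (x(i := t)))) has_real_derivative g $ i) (at t)"
proof -
  have "((\<lambda>t. v (vec_lambda (x(i := t)))) has_derivative (\<lambda>h. (h *\<^sub>R axis i 1) \<bullet> g)) (at t)"
    using has_derivative_compose[OF has_derivative_vec_lambda_upd] assms unfolding gderiv_def by blast
  then show ?thesis
    unfolding has_field_derivative_def by (rule has_derivative_eq_rhs) (auto simp: inner_axis' mult.commute)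
qed

lemma gaussian_log_sobolev:
  fixes v :: "real ^ 'n \<Rightarrow> real"
  assumes \<beta>: "\<beta> > 0" and pos: "\<And>x. v x > 0" and deriv: "\<And>x. GDERIV v x :> G x"
    and G: "continuous_on UNIV G" and int: "integrable lborel v"
  shows "(\<integral>\<^sup>+x. ennreal (kl (v x) ((\<integral>x. v x \<partial>lborel) * gauss \<beta> x)) \<partial>lborel)
    \<le> (\<integral>\<^sup>+x. ennreal (\<beta> / 2 * ((norm (G x + (v x / \<beta>) *\<^sub>R x))\<^sup>2 / v x)) \<partial>lborel)"
proof -
  have Gm[measurable]: "G \<in> borel_measurable borel" using G by (rule borel_measurable_continuous_onI)
  have vm[measurable]: "v \<in> borel_measurable borel" using int by auto
  have gm[measurable]: "gauss \<beta> \<in> borel_measurable (borel :: (real ^ 'n) measure)" unfolding gauss_def by measurable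
  have "(\<integral>\<^sup>+x. ennreal (kl (v x) ((\<integral>x. v x \<partial>lborel) * gauss \<beta> x)) \<partial>lborel)
    = (\<integral>\<^sup>+x. ennreal (kl (v (vec_lambda x)) ((\<integral>x. v (vec_lambda x) \<partial>PiM UNIV (\<lambda>_. lborel)) * (\<Prod>i\<in>UNIV. centered_normal \<beta> (x i)))) \<partial>PiM UNIV (\<lambda>_. lborel))"
    by (subst nn_integral_lborel_cart) (auto simp: integral_lborel_cart gauss_vec_lambda[OF \<beta>])
  also have "\<dots> \<le> (\<Sum>i\<in>UNIV. \<integral>\<^sup>+x. ennreal (\<beta> / 2 * ((G (vec_lambda x) $ i + x i * v (vec_lambda x) / \<beta>)\<^sup>2 / v (vec_lambda x))) \<partial>PiM UNIV (\<lambda>_. lborel))"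
  proof (rule gaussian_log_sobolev_PiM[OF _ \<beta>])
    show "((\<lambda>t. v (vec_lambda (x(i := t)))) has_real_derivative G (vec_lambda (x(i := t))) $ i) (at t)" for i x t
      by (rule gderiv_vec_lambda_upd[OF deriv])
    show "continuous_on UNIV (\<lambda>t. G (vec_lambda (x(i := t))) $ i)" for i x
      by (intro continuous_intros continuous_on_compose2[OF G continuous_on_vec_lambda_upd]) auto
    show "integrable (PiM UNIV (\<lambda>_. lborel)) (\<lambda>x. v (vec_lambda x))"
      using int integrable_lborel_cart_iff[OF vm] by simp
    show "(\<lambda>x. G (vec_lambda x) $ i) \<in> borel_measurable (PiM UNIV (\<lambda>_. lborel))" for i
      by (rule measurable_compose[OF measurable_vec_lambda]) measurable
  qed (use pos in auto)
  also have "\<dots> = (\<Sum>i\<in>UNIV. \<integral>\<^sup>+x. ennreal (\<beta> / 2 * ((G x $ i + x $ i * v x / \<beta>)\<^sup>2 / v x)) \<partial>lborel)"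
    by (intro sum.cong refl, subst nn_integral_lborel_cart) auto
  also have "\<dots> = (\<integral>\<^sup>+x. (\<Sum>i\<in>UNIV. ennreal (\<beta> / 2 * ((G x $ i + x $ i * v x / \<beta>)\<^sup>2 / v x))) \<partial>lborel)"
    by (rule nn_integral_sum[symmetric]) measurable
  also have "\<dots> = (\<integral>\<^sup>+x. ennreal (\<beta> / 2 * ((norm (G x + (v x / \<beta>) *\<^sub>R x))\<^sup>2 / v x)) \<partial>lborel)"
  proof (rule nn_integral_cong)
    fix x
    have "(norm (G x + (v x / \<beta>) *\<^sub>R x))\<^sup>2 = (\<Sum>i\<in>UNIV. (G x $ i + x $ i * v x / \<beta>)\<^sup>2)"
      by (simp add: norm_cart_power2 mult.commute)
    then have "\<beta> / 2 * ((norm (G x + (v x / \<beta>) *\<^sub>R x))\<^sup>2 / v x) = (\<Sum>i\<in>UNIV. \<beta> / 2 * ((G x $ i + x $ i * v x / \<beta>)\<^sup>2 / v x))"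
      by (simp add: sum_divide_distrib sum_distrib_left)
    then show "(\<Sum>i\<in>UNIV. ennreal (\<beta> / 2 * ((G x $ i + x $ i * v x / \<beta>)\<^sup>2 / v x))) = ennreal (\<beta> / 2 * ((norm (G x + (v x / \<beta>) *\<^sub>R x))\<^sup>2 / v x))"
      using \<beta> pos[of x] by (simp add: less_imp_le)
  qed
  finally show ?thesis .
qed

text \<open>\<open>dec\<close> expresses concavity of ln v + t^2 / (2 \<beta>) along axis lines
  through a decreasing derivative. The line inequality is integrated over the other variables for
  each direction; adding the results gives the factor \<open>CARD('n)\<close>.\<close>

lemma fisher_lower_bound:
  fixes v :: "real ^ 'n \<Rightarrow> real"
  assumes \<beta>: "\<beta> > 0" and pos: "\<And>x. v x > 0" and deriv: "\<And>x. GDERIV v x :> G x"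
    and G: "continuous_on UNIV G" and vm[measurable]: "v \<in> borel_measurable borel"
    and dec: "\<And>x i s t. s \<le> t \<Longrightarrow> G (vec_lambda (x(i := t))) $ i / v (vec_lambda (x(i := t))) + t / \<beta>
                 \<le> G (vec_lambda (x(i := s))) $ i / v (vec_lambda (x(i := s))) + s / \<beta>"
  shows "of_nat CARD('n) * (\<integral>\<^sup>+x. ennreal (v x / \<beta>) \<partial>lborel) \<le> (\<integral>\<^sup>+x. ennreal ((norm (G x))\<^sup>2 / v x) \<partial>lborel)"
proof -
  interpret product_sigma_finite "\<lambda>_::'n. lborel :: real measure" by (rule product_sigma_finite_lborel)
  have Gm[measurable]: "G \<in> borel_measurable borel" using G by (rule borel_measurable_continuous_onI)
  have "(\<integral>\<^sup>+x. ennreal (v x / \<beta>) \<partial>lborel) \<le> (\<integral>\<^sup>+x. ennreal ((G x $ i)\<^sup>2 / v x) \<partial>lborel)" for i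
  proof -
    have split: "(\<integral>\<^sup>+x. f x \<partial>lborel) = (\<integral>\<^sup>+y. \<integral>\<^sup>+t. f (vec_lambda (y(i := t))) \<partial>lborel \<partial>PiM (UNIV - {i}) (\<lambda>_. lborel))"
      if [measurable]: "f \<in> borel_measurable borel" for f :: "real ^ 'n \<Rightarrow> ennreal"
      using product_nn_integral_insert[of "UNIV - {i}" i "\<lambda>x. f (vec_lambda x)"]
      by (simp add: nn_integral_lborel_cart insert_UNIV)
    have m1: "(\<lambda>x. ennreal (v x / \<beta>)) \<in> borel_measurable borel"
      by measurable
    have m2: "(\<lambda>x. ennreal ((G x $ i)\<^sup>2 / v x)) \<in> borel_measurable borel"
      by measurable
    show ?thesis
      unfolding split[OF m1] split[OF m2]
    proof (rule nn_integral_mono)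
      fix y
      show "(\<integral>\<^sup>+t. ennreal (v (vec_lambda (y(i := t))) / \<beta>) \<partial>lborel)
        \<le> (\<integral>\<^sup>+t. ennreal ((G (vec_lambda (y(i := t))) $ i)\<^sup>2 / v (vec_lambda (y(i := t)))) \<partial>lborel)"
      proof (rule fisher_lower_bound_real[OF \<beta> pos gderiv_vec_lambda_upd[OF deriv]])
        show "continuous_on UNIV (\<lambda>t. G (vec_lambda (y(i := t))) $ i)"
          by (intro continuous_intros continuous_on_compose2[OF G continuous_on_vec_lambda_upd]) auto
      qed (rule dec)
    qed
  qed
  then have "(\<Sum>i\<in>(UNIV::'n set). \<integral>\<^sup>+x. ennreal (v x / \<beta>) \<partial>(lborel :: (real^'n) measure)) \<le> (\<Sum>i\<in>UNIV. \<integral>\<^sup>+x. ennreal ((G x $ i)\<^sup>2 / v x) \<partial>lborel)"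
    by (rule sum_mono)
  also have "\<dots> = (\<integral>\<^sup>+x. (\<Sum>i\<in>UNIV. ennreal ((G x $ i)\<^sup>2 / v x)) \<partial>lborel)"
    by (rule nn_integral_sum[symmetric]) measurable
  also have "\<dots> = (\<integral>\<^sup>+x. ennreal ((norm (G x))\<^sup>2 / v x) \<partial>lborel)"
  proof (rule nn_integral_cong)
    fix x
    have "(norm (G x))\<^sup>2 / v x = (\<Sum>i\<in>UNIV. (G x $ i)\<^sup>2 / v x)"
      by (simp add: norm_cart_power2 sum_divide_distrib)
    then show "(\<Sum>i\<in>UNIV. ennreal ((G x $ i)\<^sup>2 / v x)) = ennreal ((norm (G x))\<^sup>2 / v x)"
      using pos[of x] by (simp add: less_imp_le)
  qed
  finally show ?thesis by simp
qed

section \<open>Quadratic B-splines\<close>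


text \<open>The cardinal quadratic B-spline, supported on \<open>[0, 3]\<close>. Two properties matter: the bound
  \<open>spline'\<^sup>2 \<le> 2 \<cdot> spline\<close>, and refinability, i.e. it is a positive combination of
  translates of its own dilation by two.\<close>

definition spline :: "real \<Rightarrow> real" where
  "spline t = ((max 0 t)\<^sup>2 - 3 * (max 0 (t - 1))\<^sup>2 + 3 * (max 0 (t - 2))\<^sup>2 - (max 0 (t - 3))\<^sup>2) / 2"

definition spline' :: "real \<Rightarrow> real" where
  "spline' t = max 0 t - 3 * max 0 (t - 1) + 3 * max 0 (t - 2) - max 0 (t - 3)"

lemma has_real_derivative_pos_part_power2:
  "((\<lambda>t::real. (max 0 t)\<^sup>2) has_real_derivative 2 * max 0 t) (at t)"
proof -
  consider "t < 0" | "t = 0" | "t > 0" by linarith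
  then show ?thesis
  proof cases
    case 1
    show ?thesis
      by (rule has_field_derivative_transform_within_open[of "\<lambda>_. 0" _ _ "{..<0}"]) (use 1 in auto)
  next
    case 2
    have "(\<lambda>y::real. ((max 0 y)\<^sup>2 - (max 0 0)\<^sup>2) / (y - 0)) = max 0"
      by (auto simp: fun_eq_iff max_def power2_eq_square)
    moreover have "max (0::real) \<midarrow>0\<rightarrow> max 0 0"
      by (intro tendsto_intros)
    ultimately show ?thesis using 2 by (simp add: has_field_derivative_iff)
  next
    case 3
    show ?thesis
      by (rule has_field_derivative_transform_within_open[of "\<lambda>t. t\<^sup>2" _ _ "{0<..}"])
        (use 3 in \<open>auto intro!: derivative_eq_intros\<close>)
  qed
qed

lemma spline_deriv: "(spline has_real_derivative spline' t) (at t)"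
proof -
  have *: "((\<lambda>t. (max 0 (t - c))\<^sup>2) has_real_derivative 2 * max 0 (t - c)) (at t)" for c
    using DERIV_chain2[OF has_real_derivative_pos_part_power2 DERIV_diff[OF DERIV_ident DERIV_const], of c t]
    by simp
  have "(spline has_real_derivative
      (2 * max 0 t - 3 * (2 * max 0 (t - 1)) + 3 * (2 * max 0 (t - 2)) - 2 * max 0 (t - 3)) / 2) (at t)"
    unfolding spline_def[abs_def]
    by (intro DERIV_cdivide DERIV_diff DERIV_add DERIV_cmult * has_real_derivative_pos_part_power2)
  then show ?thesis by (rule DERIV_cong) (simp add: spline'_def field_simps)
qed

lemma continuous_on_spline[continuous_intros]:
  "continuous_on S f \<Longrightarrow> continuous_on S (\<lambda>x. spline (f x))"
  unfolding spline_def by (intro continuous_intros) auto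

lemma continuous_on_spline'[continuous_intros]:
  "continuous_on S f \<Longrightarrow> continuous_on S (\<lambda>x. spline' (f x))"
  unfolding spline'_def by (intro continuous_intros)

lemma spline_cases:
  obtains "t \<notin> {0<..<3}" "spline t = 0" "spline' t = 0"
  | "0 \<le> t" "t \<le> 1" "spline t = t\<^sup>2 / 2" "spline' t = t"
  | "1 \<le> t" "t \<le> 2" "spline t = 3 / 4 - (t - 3 / 2)\<^sup>2" "spline' t = 3 - 2 * t"
  | "2 \<le> t" "t \<le> 3" "spline t = (3 - t)\<^sup>2 / 2" "spline' t = t - 3"
proof -
  consider "t \<le> 0" | "0 \<le> t" "t \<le> 1" | "1 \<le> t" "t \<le> 2" | "2 \<le> t" "t \<le> 3" | "3 \<le> t" by linarith
  then show ?thesis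
  proof cases
    case 1 then show ?thesis by (intro that(1)) (auto simp: spline_def spline'_def)
  next
    case 2 then show ?thesis by (intro that(2)) (auto simp: spline_def spline'_def)
  next
    case 3 then show ?thesis
      by (intro that(3)) (auto simp: spline_def spline'_def max_def power2_eq_square field_simps)
  next
    case 4 then show ?thesis
      by (intro that(4)) (auto simp: spline_def spline'_def max_def power2_eq_square field_simps)
  next
    case 5 then show ?thesis
      by (intro that(1)) (auto simp: spline_def spline'_def max_def power2_eq_square field_simps)
  qed
qed

lemma spline_nonneg: "0 \<le> spline t"
proof (cases t rule: spline_cases)
  case 3
  then show ?thesis using mult_nonneg_nonneg[of "t - 1" "2 - t"]
    by (simp add: power2_eq_square algebra_simps)
next
  case 2 show ?thesis unfolding 2(3) by simp
next
  case 4 show ?thesis unfolding 4(3) by simp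
qed simp

lemma spline_le: "spline t \<le> 3 / 4"
proof (cases t rule: spline_cases)
  case 2
  have "t\<^sup>2 \<le> 1\<^sup>2" using 2 by (intro power_mono) auto
  then show ?thesis using 2 by simp
next
  case 4
  have "(3 - t)\<^sup>2 \<le> 1\<^sup>2" using 4 by (intro power_mono) auto
  then show ?thesis using 4 by simp
qed auto

lemma spline_ge: "1 \<le> t \<Longrightarrow> t \<le> 2 \<Longrightarrow> 1 / 2 \<le> spline t"
proof (cases t rule: spline_cases)
  case 3
  then show ?thesis using mult_nonneg_nonneg[of "t - 1" "2 - t"]
    by (simp add: power2_eq_square algebra_simps)
qed (auto simp: power2_eq_square)

lemma spline_mid: "spline (3 / 2) = 3 / 4"
  by (simp add: spline_def max_def power2_eq_square)

lemma abs_spline'_le: "\<bar>spline' t\<bar> \<le> 1"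
  by (cases t rule: spline_cases) (auto simp: abs_le_iff)

text \<open>On the outer pieces there is equality, since the spline vanishes quadratically at the
  ends of its support; on the middle piece the difference is 6 (t - 1) (2 - t).\<close>

lemma spline'_power2_le: "(spline' t)\<^sup>2 \<le> 2 * spline t"
proof (cases t rule: spline_cases)
  case 3
  then show ?thesis using mult_nonneg_nonneg[of "t - 1" "2 - t"]
    by (simp only: power2_eq_square) (simp add: algebra_simps)
next
  case 2 show ?thesis unfolding 2(3,4) by simp
next
  case 4 show ?thesis unfolding 4(3,4) by (simp add: power2_commute)
qed simp

lemma spline_outside: "t \<notin> {0..3} \<Longrightarrow> spline t = 0" "t \<notin> {0..3} \<Longrightarrow> spline' t = 0"
  by (cases t rule: spline_cases; auto)+

text \<open>Binomial coefficients (3 choose k) divided by 4, the mask of the two-scale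
  relation.\<close>

definition refinement_weight :: "nat \<Rightarrow> real" where
  "refinement_weight k = (if k = 0 \<or> k = 3 then 1 / 4 else 3 / 4)"

text \<open>The spline is half a third difference of q(t) = (max 0 t)^2, and q(2t) = 4 q(t). With z
  for the unit shift, the identity is (1 - z^2)^3 = (1 + z)^3 (1 - z)^3, and (1 + z)^3 produces the
  weights.\<close>

lemma spline_refinement: "spline t = (\<Sum>k<4. refinement_weight k * spline (2 * t - real k))"
proof -
  have *: "(max 0 (2 * t - 2 * c))\<^sup>2 = 4 * (max 0 (t - c))\<^sup>2" for c :: real
  proof -
    have "max 0 (2 * t - 2 * c) = 2 * max 0 (t - c)" by (simp add: max_def)
    then show ?thesis by (simp add: power2_eq_square)
  qed
  define q where "q t = (max 0 t)\<^sup>2" for t :: real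
  have sp: "spline u = (q u - 3 * q (u - 1) + 3 * q (u - 2) - q (u - 3)) / 2" for u
    by (simp add: spline_def q_def)
  have q: "q (2 * t) = 4 * q t" "q (2 * t - 2) = 4 * q (t - 1)" "q (2 * t - 4) = 4 * q (t - 2)" "q (2 * t - 6) = 4 * q (t - 3)"
    using *[of 0] *[of 1] *[of 2] *[of 3] by (simp_all add: q_def)
  have "(\<Sum>k<4. refinement_weight k * spline (2 * t - real k))
    = 1 / 4 * spline (2 * t) + 3 / 4 * spline (2 * t - 1) + 3 / 4 * spline (2 * t - 2) + 1 / 4 * spline (2 * t - 3)"
    by (simp add: refinement_weight_def eval_nat_numeral)
  moreover have "spline (2 * t - 1) = (q (2 * t - 1) - 3 * q (2 * t - 2) + 3 * q (2 * t - 3) - q (2 * t - 4)) / 2"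
    "spline (2 * t - 2) = (q (2 * t - 2) - 3 * q (2 * t - 3) + 3 * q (2 * t - 4) - q (2 * t - 5)) / 2"
    "spline (2 * t - 3) = (q (2 * t - 3) - 3 * q (2 * t - 4) + 3 * q (2 * t - 5) - q (2 * t - 6)) / 2"
    by (simp_all add: sp)
  ultimately show ?thesis using q sp[of t] sp[of "2 * t"] by (simp add: field_simps)
qed

text \<open>The tensor-product B-spline. \<open>a\<close> is the lower corner of its support, a cube
  of side 3r, and not the centre.\<close>

definition bump :: "real ^ 'n \<Rightarrow> real \<Rightarrow> real ^ 'n \<Rightarrow> real" where
  "bump a r x = (\<Prod>i\<in>UNIV. spline ((x $ i - a $ i) / r))"

definition bump_grad :: "real ^ 'n \<Rightarrow> real \<Rightarrow> real ^ 'n \<Rightarrow> real ^ 'n" where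
  "bump_grad a r x = (\<chi> i. spline' ((x $ i - a $ i) / r) / r * (\<Prod>j\<in>UNIV - {i}. spline ((x $ j - a $ j) / r)))"

lemma bump_gderiv:
  fixes a x :: "real ^ 'n"
  shows "GDERIV (bump a r) x :> bump_grad a r x"
proof -
  have 1: "((\<lambda>x. spline ((x $ i - a $ i) / r)) has_derivative (\<lambda>h. h $ i / r * spline' ((x $ i - a $ i) / r))) (at x)" for i
  proof (rule has_derivative_compose[where g=spline, THEN has_derivative_eq_rhs])
    show "((\<lambda>x. (x $ i - a $ i) / r) has_derivative (\<lambda>h. h $ i / r)) (at x)"
      by (rule bounded_linear.has_derivative[OF bounded_linear_divide])
        (auto intro!: derivative_eq_intros bounded_linear_imp_has_derivative)
    show "(spline has_derivative (\<lambda>h. spline' ((x $ i - a $ i) / r) * h)) (at ((x $ i - a $ i) / r))"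
      using spline_deriv unfolding has_field_derivative_def .
  qed (simp add: mult.commute)
  have "((\<lambda>x. \<Prod>i\<in>UNIV. spline ((x $ i - a $ i) / r)) has_derivative
      (\<lambda>h. \<Sum>i\<in>UNIV. h $ i / r * spline' ((x $ i - a $ i) / r) * (\<Prod>j\<in>UNIV - {i}. spline ((x $ j - a $ j) / r)))) (at x)"
    by (rule has_derivative_prod) (rule 1)
  then show ?thesis
    unfolding gderiv_def bump_def[abs_def] bump_grad_def
    by (rule has_derivative_eq_rhs) (auto simp: inner_vec_def fun_eq_iff intro!: sum.cong)
qed

lemma continuous_on_bump: "continuous_on UNIV (bump a r)"
  unfolding bump_def[abs_def] by (cases "r = 0") (auto intro!: continuous_intros)

lemma continuous_on_bump_grad: "continuous_on UNIV (bump_grad a r)"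
  unfolding bump_grad_def[abs_def] by (cases "r = 0") (auto intro!: continuous_intros)

lemma bump_outside:
  assumes "r > 0" "x \<notin> cbox a (a + vec (3 * r))"
  shows "bump a r x = 0" "bump_grad a r x = 0"
proof -
  obtain i where i: "\<not> (a $ i \<le> x $ i \<and> x $ i \<le> a $ i + 3 * r)"
    using assms(2) by (auto simp: mem_box_cart)
  then have *: "(x $ i - a $ i) / r \<notin> {0..3}"
    using assms(1) by (auto simp: field_simps)
  then show "bump a r x = 0"
    unfolding bump_def by (auto intro!: prod_zero exI[of _ i] simp: spline_outside)
  have "bump_grad a r x $ j = 0" for j
  proof (cases "j = i")
    case True then show ?thesis using * by (simp add: bump_grad_def spline_outside)
  next
    case False
    then have "(\<Prod>j\<in>UNIV - {j}. spline ((x $ j - a $ j) / r)) = 0"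
      using * by (intro prod_zero) (auto intro!: bexI[of _ i] simp: spline_outside)
    then show ?thesis by (simp add: bump_grad_def)
  qed
  then show "bump_grad a r x = 0" by (simp add: vec_eq_iff)
qed

lemma bump_nonneg: "0 \<le> bump a r x"
  unfolding bump_def by (intro prod_nonneg) (simp add: spline_nonneg)

lemma norm_bump_grad_le:
  fixes a x :: "real ^ 'n"
  assumes "r > 0"
  shows "norm (bump_grad a r x) \<le> real CARD('n) / r"
proof -
  have "\<bar>bump_grad a r x $ i\<bar> \<le> 1 / r" for i
  proof -
    have "\<bar>spline' ((x $ i - a $ i) / r)\<bar> * \<bar>\<Prod>j\<in>UNIV - {i}. spline ((x $ j - a $ j) / r)\<bar> \<le> 1 * 1"
      unfolding abs_prod
      using spline_nonneg spline_le
      by (intro mult_mono abs_spline'_le prod_le_1) (auto intro: order_trans[OF spline_le] prod_nonneg)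
    then show ?thesis using assms by (simp add: bump_grad_def abs_mult field_simps)
  qed
  then have "(\<Sum>i\<in>UNIV. \<bar>bump_grad a r x $ i\<bar>) \<le> (\<Sum>i\<in>(UNIV::'n set). 1 / r)" by (intro sum_mono)
  then show ?thesis using norm_le_l1_cart[of "bump_grad a r x"] by simp
qed

text \<open>Lower corner of one of the 4^n overlapping half-size cubes that refine the bump with
  corner \<open>a\<close> and scale \<open>r\<close>.\<close>

definition child :: "real ^ 'n \<Rightarrow> real \<Rightarrow> ('n \<Rightarrow> nat) \<Rightarrow> real ^ 'n" where
  "child a r k = a + (\<chi> i. r / 2 * real (k i))"

lemma bump_refinement:
  fixes a x :: "real ^ 'n"
  assumes "r > 0"
  shows "bump a r x = (\<Sum>k\<in>UNIV \<rightarrow>\<^sub>E {..<4}. (\<Prod>i\<in>UNIV. refinement_weight (k i)) * bump (child a r k) (r / 2) x)"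
proof -
  have arg: "(x $ i - child a r k $ i) / (r / 2) = 2 * ((x $ i - a $ i) / r) - real (k i)" for k i
    using assms by (simp add: child_def field_simps)
  have "bump a r x = (\<Prod>i\<in>UNIV. \<Sum>k<4. refinement_weight k * spline (2 * ((x $ i - a $ i) / r) - real k))"
    unfolding bump_def by (subst spline_refinement) simp
  also have "\<dots> = (\<Sum>k\<in>UNIV \<rightarrow>\<^sub>E {..<4}. \<Prod>i\<in>UNIV. refinement_weight (k i) * spline (2 * ((x $ i - a $ i) / r) - real (k i)))"
    by (rule prod_sum_PiE) auto
  finally show ?thesis by (simp only: bump_def arg prod.distrib)
qed

lemma GDERIV_unique: "GDERIV f x :> D \<Longrightarrow> GDERIV f x :> E \<Longrightarrow> D = E"
proof -
  assume "GDERIV f x :> D" "GDERIV f x :> E"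
  then have "(\<lambda>h. h \<bullet> D) = (\<lambda>h. h \<bullet> E)" unfolding gderiv_def by (rule has_derivative_unique)
  then have "(D - E) \<bullet> D = (D - E) \<bullet> E" by meson
  then have "(D - E) \<bullet> (D - E) = 0" by (simp add: inner_diff_right)
  then show "D = E" by simp
qed

lemma GDERIV_sum:
  "(\<And>i. i \<in> I \<Longrightarrow> GDERIV (f i) x :> D i) \<Longrightarrow> GDERIV (\<lambda>x. \<Sum>i\<in>I. f i x) x :> (\<Sum>i\<in>I. D i)"
  unfolding gderiv_def inner_sum_right by (rule has_derivative_sum)

text \<open>Differentiating \<open>bump_refinement\<close> and using uniqueness of gradients avoids
  a separate computation with \<open>spline'\<close>.\<close>

lemma bump_grad_refinement:
  fixes a x :: "real ^ 'n"
  assumes "r > 0"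
  shows "bump_grad a r x = (\<Sum>k\<in>UNIV \<rightarrow>\<^sub>E {..<4}. (\<Prod>i\<in>UNIV. refinement_weight (k i)) *\<^sub>R bump_grad (child a r k) (r / 2) x)"
proof (rule GDERIV_unique[OF bump_gderiv])
  have "bump a r = (\<lambda>x. \<Sum>k\<in>UNIV \<rightarrow>\<^sub>E {..<4}. (\<Prod>i\<in>UNIV. refinement_weight (k i)) * bump (child a r k) (r / 2) x)"
    using bump_refinement[OF assms] by blast
  moreover have "GDERIV (\<lambda>x. c * bump b s x) x :> c *\<^sub>R bump_grad b s x" for c b s and x :: "real ^ 'n"
    using GDERIV_mult[OF GDERIV_const bump_gderiv, of c b s x] by simp
  ultimately show "GDERIV (bump a r) x :> (\<Sum>k\<in>UNIV \<rightarrow>\<^sub>E {..<4}. (\<Prod>i\<in>UNIV. refinement_weight (k i)) *\<^sub>R bump_grad (child a r k) (r / 2) x)"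
    by (auto intro: GDERIV_sum)
qed

lemma child_cbox_subset:
  fixes a :: "real ^ 'n"
  assumes "r > 0" "k \<in> UNIV \<rightarrow>\<^sub>E {..<4}"
  shows "cbox (child a r k) (child a r k + vec (3 * (r / 2))) \<subseteq> cbox a (a + vec (3 * r))"
proof -
  have up: "r / 2 * real (k i) \<le> r / 2 * 3" for i
  proof -
    have "k i < 4" using assms(2) by (auto simp: PiE_def Pi_def)
    then show ?thesis using assms(1) by (intro mult_left_mono) auto
  qed
  have low: "0 \<le> r / 2 * real (k i)" for i using assms(1) by simp
  show ?thesis
  proof
    fix x assume "x \<in> cbox (child a r k) (child a r k + vec (3 * (r / 2)))"
    then have x: "a $ i + r / 2 * real (k i) \<le> x $ i" "x $ i \<le> a $ i + r / 2 * real (k i) + 3 * (r / 2)" for i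
      by (auto simp: mem_box_cart child_def)
    have "a $ i \<le> x $ i \<and> x $ i \<le> a $ i + 3 * r" for i
      using x[of i] up[of i] low[of i] by linarith
    then show "x \<in> cbox a (a + vec (3 * r))" by (simp add: mem_box_cart)
  qed
qed

section \<open>Integrals of compactly supported functions\<close>

lemma integrable_compact_support:
  fixes f :: "real ^ 'n \<Rightarrow> real"
  assumes "continuous_on UNIV f" "\<And>x. x \<notin> cbox l u \<Longrightarrow> f x = 0"
  shows "integrable lborel f"
proof -
  have "integrable lborel (\<lambda>x. indicator (cbox l u) x *\<^sub>R f x)"
    using assms(1) by (intro borel_integrable_compact) (auto intro: continuous_on_subset)
  moreover have "(\<lambda>x. indicator (cbox l u) x *\<^sub>R f x) = f"
    using assms(2) by (auto simp: fun_eq_iff indicator_def)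
  ultimately show ?thesis by simp
qed

text \<open>By Fubini's theorem it is enough to integrate over lines in direction i, where the
  result is a difference of two values of \<open>\<psi>\<close> outside the box.\<close>

lemma integral_partial_derivative_eq_0:
  fixes \<psi> :: "real ^ 'n \<Rightarrow> real"
  assumes deriv: "\<And>x. GDERIV \<psi> x :> g x" and g: "continuous_on UNIV g"
    and supp: "\<And>x. x \<notin> cbox l u \<Longrightarrow> \<psi> x = 0" "\<And>x. x \<notin> cbox l u \<Longrightarrow> g x = 0"
  shows "(\<integral>x. g x $ i \<partial>lborel) = 0"
proof -
  interpret product_sigma_finite "\<lambda>_::'n. lborel :: real measure" by (rule product_sigma_finite_lborel)
  have gi: "continuous_on UNIV (\<lambda>x. g x $ i)" using g by (intro continuous_intros)
  have gm: "(\<lambda>x. g x $ i) \<in> borel_measurable borel" using gi by (rule borel_measurable_continuous_onI)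
  have int: "integrable lborel (\<lambda>x. g x $ i)"
    using supp by (intro integrable_compact_support[OF gi, of l u]) auto
  have inner: "(\<integral>t. g (vec_lambda (y(i := t))) $ i \<partial>lborel) = 0" for y
  proof -
    let ?h = "\<lambda>t. g (vec_lambda (y(i := t))) $ i" and ?\<psi> = "\<lambda>t. \<psi> (vec_lambda (y(i := t)))"
    \<comment> \<open>The offsets by 1 put both endpoints strictly outside the box and keep A <= B
      even if the box is empty.\<close>
    define A where "A = l $ i - 1" define B where "B = max A (u $ i) + 1"
    have out: "vec_lambda (y(i := t)) \<notin> cbox l u" if "t \<le> A \<or> B \<le> t" for t
      using that unfolding mem_box_cart not_all by (intro exI[of _ i]) (auto simp: A_def B_def)
    have "?h t = indicator {A..B} t *\<^sub>R ?h t" for t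
      using supp(2)[OF out[of t]] by (cases "t \<in> {A..B}") auto
    then have "(\<integral>t. ?h t \<partial>lborel) = (\<integral>t. indicator {A..B} t *\<^sub>R ?h t \<partial>lborel)"
      by (intro Bochner_Integration.integral_cong) auto
    also have "\<dots> = ?\<psi> B - ?\<psi> A"
    proof (rule integral_FTC_atLeastAtMost)
      show "A \<le> B" by (simp add: B_def)
      show "(?\<psi> has_vector_derivative ?h t) (at t within {A..B})" for t
        using gderiv_vec_lambda_upd[OF deriv, of y i t]
        by (simp add: has_real_derivative_iff_has_vector_derivative has_vector_derivative_at_within)
      show "continuous_on {A..B} ?h"
        by (rule continuous_on_subset[OF continuous_on_compose2[OF gi continuous_on_vec_lambda_upd]]) auto
    qed
    also have "\<dots> = 0" using supp(1) out by simp
    finally show ?thesis .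
  qed
  have "(\<integral>x. g x $ i \<partial>lborel) = (\<integral>x. g (vec_lambda x) $ i \<partial>PiM UNIV (\<lambda>_. lborel))"
    by (rule integral_lborel_cart[OF gm])
  also have "\<dots> = (\<integral>y. \<integral>t. g (vec_lambda (y(i := t))) $ i \<partial>lborel \<partial>PiM (UNIV - {i}) (\<lambda>_. lborel))"
    using product_integral_insert[of "UNIV - {i}" i "\<lambda>x. g (vec_lambda x) $ i"] int integrable_lborel_cart_iff[OF gm]
    by (simp add: insert_UNIV)
  finally show ?thesis by (simp add: inner)
qed

section \<open>Divergence of differentiable vector fields\<close>


text \<open>On the middle cube of side r every factor is at least 1 / 2. This makes the volume of
  the support comparable with the mass at every scale, as the error estimate of the bisection
  requires.\<close>

lemma bump_integral_ge:
  fixes a :: "real ^ 'n"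
  assumes r: "r > 0"
  shows "(r / 2) ^ CARD('n) \<le> (\<integral>x. bump a r x \<partial>lborel)"
proof -
  let ?C = "cbox (a + vec r) (a + vec (2 * r))"
  have "measure lborel ?C = r ^ CARD('n)"
    using r by (subst content_cbox_cart) (auto simp: interval_ne_empty_cart)
  then have "(r / 2) ^ CARD('n) = (\<integral>x. (1 / 2) ^ CARD('n) * indicator ?C x \<partial>lborel)"
    by (simp add: power_divide)
  also have "\<dots> \<le> (\<integral>x. bump a r x \<partial>lborel)"
  proof (rule integral_mono)
    show "integrable lborel (\<lambda>x. (1 / 2) ^ CARD('n) * indicat_real ?C x)"
      by (intro integrable_mult_right integrable_real_indicator) (auto simp: emeasure_lborel_cbox_eq)
    show "integrable lborel (bump a r)"
      by (rule integrable_compact_support[OF continuous_on_bump bump_outside(1)[OF r]])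
    show "(1 / 2) ^ CARD('n) * indicat_real ?C x \<le> bump a r x" for x
    proof (cases "x \<in> ?C")
      case True
      have "1 / 2 \<le> spline ((x $ i - a $ i) / r)" for i
      proof (rule spline_ge)
        have "a $ i + r \<le> x $ i" "x $ i \<le> a $ i + 2 * r" using True by (auto simp: mem_box_cart)
        then show "1 \<le> (x $ i - a $ i) / r" "(x $ i - a $ i) / r \<le> 2" using r by (auto simp: field_simps)
      qed
      then have "(\<Prod>i\<in>(UNIV :: 'n set). 1 / 2) \<le> bump a r x"
        unfolding bump_def by (intro prod_mono) auto
      then show ?thesis using True by simp
    qed (simp add: bump_nonneg)
  qed
  finally show ?thesis .
qed

lemma integrable_bump_times:
  fixes a :: "real ^ 'n"
  assumes "r > 0" "continuous_on UNIV g"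
  shows "integrable lborel (\<lambda>x. bump a r x * g x)"
  by (rule integrable_compact_support[of _ a "a + vec (3 * r)"])
    (auto intro!: continuous_intros continuous_on_bump assms simp: bump_outside(1)[OF assms(1)])

lemma integrable_inner_bump_grad:
  fixes a :: "real ^ 'n"
  assumes "r > 0" "continuous_on UNIV F"
  shows "integrable lborel (\<lambda>x. F x \<bullet> bump_grad a r x)"
  by (rule integrable_compact_support[of _ a "a + vec (3 * r)"])
    (auto intro!: continuous_intros continuous_on_bump_grad assms simp: bump_outside(2)[OF assms(1)])

text \<open>For affine fields the divergence is the constant trace of \<open>L\<close>, and
  integration by parts is elementary. This handles the main term once a field is replaced by its
  linearisation at \<open>z\<close>.\<close>

lemma integral_affine_inner_bump_grad:
  fixes a :: "real ^ 'n" and L :: "real ^ 'n \<Rightarrow> real ^ 'n"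
  assumes r: "r > 0" and L: "linear L"
  shows "(\<integral>x. (c + L (x - z)) \<bullet> bump_grad a r x \<partial>lborel)
    = - (\<integral>x. bump a r x * (\<Sum>i\<in>UNIV. L (axis i 1) $ i) \<partial>lborel)"
proof -
  have Lb: "bounded_linear L" using L linear_conv_bounded_linear by blast
  have contL: "continuous_on UNIV (\<lambda>x. L (x - z))"
    by (intro bounded_linear.continuous_on[OF Lb] continuous_intros)
  then have contA: "continuous_on UNIV (\<lambda>x. c + L (x - z))" by (intro continuous_intros)
  have i0: "(\<integral>x. (c + L (x - z)) $ i * bump_grad a r x $ i + bump a r x * L (axis i 1) $ i \<partial>lborel) = 0" for i
  proof -
    define D where "D = (\<chi> j. L (axis j 1) $ i)"
    have "L h $ i = h \<bullet> D" for h
    proof -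
      have "L h = L (\<Sum>j\<in>UNIV. h $ j *\<^sub>R axis j 1)" using basis_expansion[of h] by (simp add: scalar_mult_eq_scaleR)
      also have "\<dots> = (\<Sum>j\<in>UNIV. h $ j *\<^sub>R L (axis j 1))" using L by (simp add: linear_sum linear_scale)
      finally show ?thesis by (simp add: D_def inner_vec_def)
    qed
    then have G: "GDERIV (\<lambda>x. (c + L (x - z)) $ i) x :> D" for x
      unfolding gderiv_def using bounded_linear_imp_has_derivative[OF Lb]
      by (auto intro!: derivative_eq_intros simp: inner_diff_left)
    have "GDERIV (\<lambda>x. (c + L (x - z)) $ i * bump a r x) x :> (c + L (x - z)) $ i *\<^sub>R bump_grad a r x + bump a r x *\<^sub>R D" for x
      by (rule GDERIV_mult[OF G bump_gderiv])
    then have "(\<integral>x. ((c + L (x - z)) $ i *\<^sub>R bump_grad a r x + bump a r x *\<^sub>R D) $ i \<partial>lborel) = 0"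
      by (rule integral_partial_derivative_eq_0[of _ _ a "a + vec (3 * r)"])
        (auto intro!: continuous_intros contL continuous_on_bump continuous_on_bump_grad simp: bump_outside[OF r])
    then show ?thesis by (simp add: D_def)
  qed
  have int1: "integrable lborel (\<lambda>x. bump a r x * d)" for d
    by (rule integrable_bump_times[OF r]) (intro continuous_intros)
  have int2: "integrable lborel (\<lambda>x. (c + L (x - z)) $ i * bump_grad a r x $ i)" for i
    by (rule integrable_compact_support[of _ a "a + vec (3 * r)"])
      (auto intro!: continuous_intros contL continuous_on_bump_grad simp: bump_outside(2)[OF r])
  have "(\<integral>x. (c + L (x - z)) \<bullet> bump_grad a r x + bump a r x * (\<Sum>i\<in>UNIV. L (axis i 1) $ i) \<partial>lborel)
     = (\<integral>x. (\<Sum>i\<in>UNIV. (c + L (x - z)) $ i * bump_grad a r x $ i + bump a r x * L (axis i 1) $ i) \<partial>lborel)"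
    by (simp add: inner_vec_def sum.distrib sum_distrib_left)
  also have "\<dots> = (\<Sum>i\<in>UNIV. \<integral>x. (c + L (x - z)) $ i * bump_grad a r x $ i + bump a r x * L (axis i 1) $ i \<partial>lborel)"
    by (rule Bochner_Integration.integral_sum) (intro Bochner_Integration.integrable_add int1 int2)
  also have "\<dots> = 0" by (simp only: i0) simp
  finally show ?thesis
    using Bochner_Integration.integral_add[OF integrable_inner_bump_grad[OF r contA, of a] int1]
    by (simp add: eq_neg_iff_add_eq_0)
qed

text \<open>A violated inequality is inherited by one of the refined bumps, hence by arbitrarily
  small bumps around a single point, where it contradicts differentiability there.\<close>

lemma weak_divergence_inequality:
  fixes F :: "real ^ 'n \<Rightarrow> real ^ 'n" and g :: "real ^ 'n \<Rightarrow> real"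
  assumes F: "\<And>x. (F has_derivative F' x) (at x)" and g: "continuous_on UNIV g"
    and le: "\<And>x. g x \<le> (\<Sum>i\<in>UNIV. F' x (axis i 1) $ i)" and r0: "r0 > 0"
  shows "(\<integral>x. bump a0 r0 x * g x \<partial>lborel) \<le> - (\<integral>x. F x \<bullet> bump_grad a0 r0 x \<partial>lborel)"
proof (rule ccontr)
  have contF: "continuous_on UNIV F"
    using has_derivative_continuous[OF F] by (simp add: continuous_on_eq_continuous_at)
  \<comment> \<open>\<open>N\<close> is the amount by which the asserted inequality fails. It
    refines with the same nonnegative weights as the mass \<open>M\<close>, so a strict inequality N
    > \<epsilon> M passes to at least one child.\<close>
  define N where "N a r = (\<integral>x. bump a r x * g x \<partial>lborel) + (\<integral>x. F x \<bullet> bump_grad a r x \<partial>lborel)" for a r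
  define M where "M a r = (\<integral>x. bump a r x \<partial>lborel)" for a :: "real ^ 'n" and r
  let ?K = "UNIV \<rightarrow>\<^sub>E {..<4} :: ('n \<Rightarrow> nat) set"
  let ?w = "\<lambda>k :: 'n \<Rightarrow> nat. \<Prod>i\<in>UNIV. refinement_weight (k i)"
  have wpos: "?w k \<ge> 0" for k by (intro prod_nonneg) (simp add: refinement_weight_def)
  have Nsum: "N a r = (\<Sum>k\<in>?K. ?w k * N (child a r k) (r / 2))" if r: "r > 0" for a r
  proof -
    have r2: "r / 2 > 0" using r by simp
    have "(\<integral>x. bump a r x * g x \<partial>lborel) = (\<integral>x. (\<Sum>k\<in>?K. ?w k * (bump (child a r k) (r / 2) x * g x)) \<partial>lborel)"
      by (subst bump_refinement[OF r]) (simp add: sum_distrib_right mult.assoc)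
    also have "\<dots> = (\<Sum>k\<in>?K. ?w k * (\<integral>x. bump (child a r k) (r / 2) x * g x \<partial>lborel))"
      using integrable_bump_times[OF r2 g] by (subst Bochner_Integration.integral_sum) auto
    finally have 1: "(\<integral>x. bump a r x * g x \<partial>lborel) = \<dots>" .
    have "(\<integral>x. F x \<bullet> bump_grad a r x \<partial>lborel) = (\<integral>x. (\<Sum>k\<in>?K. ?w k * (F x \<bullet> bump_grad (child a r k) (r / 2) x)) \<partial>lborel)"
      by (subst bump_grad_refinement[OF r]) (simp add: inner_sum_right)
    also have "\<dots> = (\<Sum>k\<in>?K. ?w k * (\<integral>x. F x \<bullet> bump_grad (child a r k) (r / 2) x \<partial>lborel))"
      using integrable_inner_bump_grad[OF r2 contF] by (subst Bochner_Integration.integral_sum) auto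
    finally show ?thesis using 1 by (simp add: N_def sum.distrib distrib_left)
  qed
  have Mint: "integrable lborel (bump a r)" if r: "r > 0" for a :: "real ^ 'n" and r
    by (rule integrable_compact_support[OF continuous_on_bump bump_outside(1)[OF r]])
  have Msum: "M a r = (\<Sum>k\<in>?K. ?w k * M (child a r k) (r / 2))" if r: "r > 0" for a r
  proof -
    have r2: "r / 2 > 0" using r by simp
    have "M a r = (\<integral>x. (\<Sum>k\<in>?K. ?w k * bump (child a r k) (r / 2) x) \<partial>lborel)"
      unfolding M_def by (intro Bochner_Integration.integral_cong refl bump_refinement r)
    also have "\<dots> = (\<Sum>k\<in>?K. ?w k * M (child a r k) (r / 2))"
      unfolding M_def using Mint[OF r2] by (subst Bochner_Integration.integral_sum) auto
    finally show ?thesis .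
  qed
  have Mge: "(r / 2) ^ CARD('n) \<le> M a r" if "r > 0" for a r
    unfolding M_def using bump_integral_ge[OF that] .
  have Mpos: "M a r > 0" if "r > 0" for a r
    using Mge[OF that, of a] that by (smt (verit) zero_less_power half_gt_zero)
  assume "\<not> ?thesis"
  then have N0: "N a0 r0 > 0" by (simp add: N_def)
  define \<epsilon> where "\<epsilon> = N a0 r0 / (2 * M a0 r0)"
  have \<epsilon>: "\<epsilon> > 0" using N0 Mpos[OF r0, of a0] by (simp add: \<epsilon>_def)
  have bad0: "N a0 r0 > \<epsilon> * M a0 r0" using N0 Mpos[OF r0, of a0] by (simp add: \<epsilon>_def)
  define \<rho> where "\<rho> n = r0 / 2 ^ n" for n
  have \<rho>pos: "\<rho> n > 0" for n using r0 by (simp add: \<rho>_def)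
  have \<rho>Suc: "\<rho> (Suc n) = \<rho> n / 2" for n by (simp add: \<rho>_def)
  let ?box = "\<lambda>a r. cbox a (a + vec (3 * r)) :: (real ^ 'n) set"
  have "\<exists>a. \<forall>n. N (a n) (\<rho> n) > \<epsilon> * M (a n) (\<rho> n) \<and> ?box (a (Suc n)) (\<rho> (Suc n)) \<subseteq> ?box (a n) (\<rho> n)"
  proof (rule dependent_nat_choice)
    show "\<exists>x. N x (\<rho> 0) > \<epsilon> * M x (\<rho> 0)" using bad0 by (auto simp: \<rho>_def)
    fix x n assume bad: "N x (\<rho> n) > \<epsilon> * M x (\<rho> n)"
    have "\<exists>k\<in>?K. N (child x (\<rho> n) k) (\<rho> n / 2) > \<epsilon> * M (child x (\<rho> n) k) (\<rho> n / 2)"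
    proof (rule ccontr)
      assume "\<not> ?thesis"
      then have "N x (\<rho> n) \<le> (\<Sum>k\<in>?K. ?w k * (\<epsilon> * M (child x (\<rho> n) k) (\<rho> n / 2)))"
        unfolding Nsum[OF \<rho>pos] by (intro sum_mono mult_left_mono wpos) force
      also have "\<dots> = \<epsilon> * M x (\<rho> n)"
        unfolding Msum[OF \<rho>pos, of x] sum_distrib_left by (simp add: mult_ac)
      finally show False using bad by simp
    qed
    then show "\<exists>y. N y (\<rho> (Suc n)) > \<epsilon> * M y (\<rho> (Suc n)) \<and> ?box y (\<rho> (Suc n)) \<subseteq> ?box x (\<rho> n)"
      unfolding \<rho>Suc using child_cbox_subset[OF \<rho>pos] by blast
  qed
  then obtain a where bad: "\<And>n. N (a n) (\<rho> n) > \<epsilon> * M (a n) (\<rho> n)"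
    and nest: "\<And>n. ?box (a (Suc n)) (\<rho> (Suc n)) \<subseteq> ?box (a n) (\<rho> n)" by blast
  have ne: "a n \<in> ?box (a n) (\<rho> n)" for n using \<rho>pos[of n] by (simp add: mem_box_cart)
  \<comment> \<open>The nested supports shrink to a point z. Differentiability of F and continuity
    of g at this single point control all sufficiently small bumps.\<close>
  have "\<Inter>(range (\<lambda>n. ?box (a n) (\<rho> n))) \<noteq> {}"
  proof (rule compact_nest)
    show "?box (a n) (\<rho> n) \<subseteq> ?box (a m) (\<rho> m)" if "m \<le> n" for m n
      using that nest by (rule lift_Suc_antimono_le[where f="\<lambda>n. ?box (a n) (\<rho> n)", rotated])
  qed (use ne in auto)
  then obtain z where z: "\<And>n. z \<in> ?box (a n) (\<rho> n)" by auto
  define d where "d = real CARD('n)"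
  have d: "d > 0" by (simp add: d_def)
  \<comment> \<open>The total error below is at most
    \<open>\<eta> * (1 + 3 * d\<^sup>2 * 6 ^ CARD('n))\<close> times the mass; this choice turns it
    into \<epsilon> / 2 times the mass.\<close>
  define \<eta> where "\<eta> = \<epsilon> / (2 * (1 + 3 * d\<^sup>2 * 6 ^ CARD('n)))"
  have \<eta>: "\<eta> > 0" using \<epsilon> by (simp add: \<eta>_def add_pos_nonneg)
  have "\<exists>\<delta>>0. \<forall>y. norm (y - z) < \<delta> \<longrightarrow> norm (F y - F z - F' z (y - z)) \<le> \<eta> * norm (y - z)"
    using F[of z] \<eta> unfolding has_derivative_at_alt by blast
  then obtain \<delta>1 where \<delta>1: "\<delta>1 > 0" "\<And>y. norm (y - z) < \<delta>1 \<Longrightarrow> norm (F y - F z - F' z (y - z)) \<le> \<eta> * norm (y - z)"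
    by blast
  have "isCont g z" using g by (simp add: continuous_on_eq_continuous_at)
  then obtain \<delta>2 where \<delta>2: "\<delta>2 > 0" "\<And>y. norm (y - z) < \<delta>2 \<Longrightarrow> \<bar>g y - g z\<bar> < \<eta>"
    using \<eta> unfolding continuous_at_eps_delta by (metis dist_norm real_norm_def)
  have "\<rho> \<longlonglongrightarrow> 0" unfolding \<rho>_def by real_asymp
  then have "eventually (\<lambda>n. \<rho> n < min \<delta>1 \<delta>2 / (3 * d)) sequentially"
    by (rule order_tendstoD) (use \<delta>1 \<delta>2 d in auto)
  then obtain n where n: "3 * d * \<rho> n < min \<delta>1 \<delta>2"
    using d by (auto simp: eventually_sequentially field_simps)
  define r where "r = \<rho> n"
  define b where "b = a n"
  have r: "r > 0" by (simp add: r_def \<rho>pos)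
  have dist: "norm (y - z) \<le> 3 * d * r" if "y \<in> ?box b r" for y
  proof -
    have "\<bar>(y - z) $ i\<bar> \<le> 3 * r" for i
    proof -
      have "b $ i \<le> y $ i \<and> y $ i \<le> b $ i + 3 * r" "b $ i \<le> z $ i \<and> z $ i \<le> b $ i + 3 * r"
        using that z[of n] by (auto simp: mem_box_cart b_def r_def)
      then show ?thesis by (auto simp: abs_le_iff)
    qed
    then have "(\<Sum>i\<in>UNIV. \<bar>(y - z) $ i\<bar>) \<le> (\<Sum>i\<in>(UNIV::'n set). 3 * r)" by (intro sum_mono)
    then show ?thesis using norm_le_l1_cart[of "y - z"] by (simp add: d_def mult_ac)
  qed
  define L where "L = F' z"
  have L: "linear L" using F[of z] has_derivative_linear unfolding L_def by blast
  have Lb: "bounded_linear L" using L linear_conv_bounded_linear by blast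
  define E where "E y = F y - (F z + L (y - z))" for y
  have contA: "continuous_on UNIV (\<lambda>y. F z + L (y - z))"
    by (intro bounded_linear.continuous_on[OF Lb] continuous_intros)
  have contE: "continuous_on UNIV E" unfolding E_def by (intro continuous_intros contF contA)
  let ?tr = "\<Sum>i\<in>UNIV. L (axis i 1) $ i"
  have "(\<integral>x. F x \<bullet> bump_grad b r x \<partial>lborel) = (\<integral>x. (F z + L (x - z)) \<bullet> bump_grad b r x + E x \<bullet> bump_grad b r x \<partial>lborel)"
    by (simp add: E_def inner_add_left[symmetric])
  also have "\<dots> = - (\<integral>x. bump b r x * ?tr \<partial>lborel) + (\<integral>x. E x \<bullet> bump_grad b r x \<partial>lborel)"
    by (subst Bochner_Integration.integral_add)
      (auto intro!: integrable_inner_bump_grad[OF r] contA contE simp: integral_affine_inner_bump_grad[OF r L])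
  finally have "N b r = (\<integral>x. bump b r x * g x \<partial>lborel) - (\<integral>x. bump b r x * ?tr \<partial>lborel) + (\<integral>x. E x \<bullet> bump_grad b r x \<partial>lborel)"
    by (simp add: N_def)
  then have Neq: "N b r = (\<integral>x. bump b r x * g x - bump b r x * ?tr + E x \<bullet> bump_grad b r x \<partial>lborel)"
    using integrable_bump_times[OF r g, of b] integrable_bump_times[OF r continuous_on_const, of b ?tr] integrable_inner_bump_grad[OF r contE, of b]
    by simp
  have ind: "integrable lborel (indicat_real (?box b r))"
    by (intro integrable_real_indicator) (auto simp: emeasure_lborel_cbox_eq)
  \<comment> \<open>The linearisation error is at most 3 \<eta> d r and the gradient of the bump at
    most d / r, so the scale cancels. Integration over the support costs its volume, at most 6^n
    times the mass.\<close>
  have "N b r \<le> (\<integral>x. \<eta> * bump b r x + 3 * \<eta> * d\<^sup>2 * indicator (?box b r) x \<partial>lborel)"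
    unfolding Neq
  proof (rule integral_mono)
    show "integrable lborel (\<lambda>x. bump b r x * g x - bump b r x * ?tr + E x \<bullet> bump_grad b r x)"
      using integrable_bump_times[OF r g, of b] integrable_bump_times[OF r continuous_on_const, of b ?tr] integrable_inner_bump_grad[OF r contE, of b]
      by simp
    show "integrable lborel (\<lambda>x. \<eta> * bump b r x + 3 * \<eta> * d\<^sup>2 * indicator (?box b r) x)"
      using Mint[OF r, of b] ind by (intro Bochner_Integration.integrable_add integrable_mult_right)
    show "bump b r x * g x - bump b r x * ?tr + E x \<bullet> bump_grad b r x
      \<le> \<eta> * bump b r x + 3 * \<eta> * d\<^sup>2 * indicator (?box b r) x" for x
    proof (cases "x \<in> ?box b r")
      case True
      have nx: "norm (x - z) < min \<delta>1 \<delta>2" using dist[OF True] n by (simp add: r_def)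
      have "g x - ?tr \<le> \<eta>" using \<delta>2(2)[of x] nx le[of z] by (simp add: L_def abs_less_iff)
      then have "bump b r x * (g x - ?tr) \<le> bump b r x * \<eta>" by (intro mult_left_mono bump_nonneg)
      moreover have "E x \<bullet> bump_grad b r x \<le> 3 * \<eta> * d\<^sup>2"
      proof -
        have "norm (E x) \<le> \<eta> * norm (x - z)" using \<delta>1(2)[of x] nx by (simp add: E_def L_def algebra_simps)
        also have "\<dots> \<le> \<eta> * (3 * d * r)" using \<eta> dist[OF True] by (intro mult_left_mono) auto
        finally have E: "norm (E x) \<le> \<eta> * (3 * d * r)" .
        have "E x \<bullet> bump_grad b r x \<le> norm (E x) * norm (bump_grad b r x)" by (rule norm_cauchy_schwarz)
        also have "\<dots> \<le> (\<eta> * (3 * d * r)) * (d / r)"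
          using E norm_bump_grad_le[OF r, of b x] \<eta> d r unfolding d_def[symmetric] by (intro mult_mono) auto
        also have "\<dots> = 3 * \<eta> * d\<^sup>2" using r by (simp add: power2_eq_square)
        finally show ?thesis .
      qed
      ultimately show ?thesis using True by (simp add: algebra_simps)
    qed (simp add: bump_outside[OF r])
  qed
  also have "\<dots> = \<eta> * M b r + 3 * \<eta> * d\<^sup>2 * measure lborel (?box b r)"
    using Mint[OF r, of b] ind by (simp add: M_def)
  also have "measure lborel (?box b r) = (3 * r) ^ CARD('n)"
    using r by (subst content_cbox_cart) (auto simp: interval_ne_empty_cart)
  also have "(3 * r) ^ CARD('n) = 6 ^ CARD('n) * (r / 2) ^ CARD('n)"
    by (subst power_mult_distrib[symmetric]) simp
  also have "\<eta> * M b r + 3 * \<eta> * d\<^sup>2 * (6 ^ CARD('n) * (r / 2) ^ CARD('n)) \<le> \<eta> * M b r + 3 * \<eta> * d\<^sup>2 * (6 ^ CARD('n) * M b r)"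
    using Mge[OF r, of b] \<eta> by (intro add_left_mono mult_left_mono) auto
  also have "\<dots> = (\<epsilon> / 2) * M b r"
  proof -
    have pos: "1 + 3 * d\<^sup>2 * 6 ^ CARD('n) > 0" by (simp add: add_pos_nonneg)
    have "\<epsilon> / (2 * q) * q = \<epsilon> / 2" if "q > 0" for q :: real using that by simp
    from this[OF pos] have "\<eta> * (1 + 3 * d\<^sup>2 * 6 ^ CARD('n)) = \<epsilon> / 2" by (simp only: \<eta>_def)
    then have "\<eta> * (1 + 3 * d\<^sup>2 * 6 ^ CARD('n)) * M b r = \<epsilon> / 2 * M b r" by (rule arg_cong)
    then show ?thesis by (simp add: algebra_simps)
  qed
  also have "\<dots> < \<epsilon> * M b r" using \<epsilon> Mpos[OF r, of b] by simp
  finally show False using bad[of n] by (simp add: b_def r_def)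
qed

section \<open>Upper bound for the Fisher information\<close>


text \<open>The undifferentiated factors lie in [0, 1], so their product satisfies P^2 <= P and
  \<open>spline'_power2_le\<close> carries over. The bound lets the cut-off absorb its own
  gradient.\<close>

lemma norm_bump_grad_power2_le:
  fixes a x :: "real ^ 'n"
  assumes "r > 0"
  shows "(norm (bump_grad a r x))\<^sup>2 \<le> 2 * real CARD('n) / r\<^sup>2 * bump a r x"
proof -
  have "(bump_grad a r x $ i)\<^sup>2 \<le> 2 / r\<^sup>2 * bump a r x" for i
  proof -
    define P where "P = (\<Prod>j\<in>UNIV - {i}. spline ((x $ j - a $ j) / r))"
    let ?t = "(x $ i - a $ i) / r"
    have P: "0 \<le> P" "P \<le> 1"
      unfolding P_def using spline_nonneg by (auto intro!: prod_nonneg prod_le_1 intro: order_trans[OF spline_le])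
    have "bump a r x = spline ?t * P"
      unfolding bump_def P_def by (subst prod.remove[of UNIV i]) auto
    moreover have "(spline' ?t)\<^sup>2 * P\<^sup>2 \<le> (2 * spline ?t) * P"
      using P mult_left_le[of P P] by (intro mult_mono spline'_power2_le) (auto simp: power2_eq_square spline_nonneg)
    ultimately show ?thesis
      using assms by (simp add: bump_grad_def P_def[symmetric] power_mult_distrib power_divide field_simps)
  qed
  then have "(\<Sum>i\<in>UNIV. (bump_grad a r x $ i)\<^sup>2) \<le> (\<Sum>i\<in>(UNIV::'n set). 2 / r\<^sup>2 * bump a r x)"
    by (rule sum_mono)
  then show ?thesis by (simp add: norm_cart_power2 mult_ac)
qed

lemma weighted_young:
  fixes a b s :: real
  assumes "s > 0"
  shows "a * b \<le> s / 2 * a\<^sup>2 + b\<^sup>2 / (2 * s)"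
proof -
  have "0 \<le> (s * a - b)\<^sup>2 / (2 * s)" using assms by simp
  also have "\<dots> = s / 2 * a\<^sup>2 + b\<^sup>2 / (2 * s) - a * b"
    using assms by (simp add: power2_eq_square field_simps)
  finally show ?thesis by simp
qed

text \<open>Testing with a cut-off phi of scale R leaves the error G . grad phi. Young's inequality
  with weight phi / (R v) bounds it by 1 / (2R) of the weighted Fisher integral, which is moved to
  the left, plus n / R times the mass, which vanishes as R grows.\<close>

lemma fisher_upper_bound:
  fixes v :: "real ^ 'n \<Rightarrow> real"
  assumes pos: "\<And>x. v x > 0" and deriv: "\<And>x. GDERIV v x :> G x"
    and deriv2: "\<And>x. (G has_derivative G' x) (at x)" and int: "integrable lborel v"
    and le: "\<And>x. (norm (G x))\<^sup>2 / v x - real CARD('n) / \<beta> * v x \<le> (\<Sum>i\<in>UNIV. G' x (axis i 1) $ i)"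
    and \<beta>: "\<beta> > 0"
  shows "(\<integral>\<^sup>+x. ennreal ((norm (G x))\<^sup>2 / v x) \<partial>lborel) \<le> ennreal (real CARD('n) / \<beta> * (\<integral>x. v x \<partial>lborel))"
proof -
  define n where "n = real CARD('n)"
  have contv: "continuous_on UNIV v"
    using deriv by (auto simp: continuous_on_eq_continuous_at gderiv_def intro: has_derivative_continuous)
  have contG: "continuous_on UNIV G"
    using has_derivative_continuous[OF deriv2] by (simp add: continuous_on_eq_continuous_at)
  define h where "h x = (norm (G x))\<^sup>2 / v x" for x
  have conth: "continuous_on UNIV h"
    unfolding h_def using pos by (auto intro!: continuous_intros contv contG simp: less_imp_neq[THEN not_sym])
  have hnn: "h x \<ge> 0" for x using pos[of x] by (simp add: h_def)
  have [measurable]: "h \<in> borel_measurable borel" using conth by (rule borel_measurable_continuous_onI)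
  define I where "I = (\<integral>x. v x \<partial>lborel)"
  have I: "I \<ge> 0" unfolding I_def using pos by (intro integral_nonneg_AE) (auto intro: less_imp_le)
  define R where "R k = real (Suc k)" for k
  have R: "R k > 0" "R k \<ge> 1" for k by (auto simp: R_def)
  \<comment> \<open>The corner with entries -3/2 R centres the cube of side 3R at the origin. The
    constant \<open>c\<close> is the reciprocal of the maximum (3/4)^n of the bump.\<close>
  define \<phi> where "\<phi> k = bump (vec (- (3 / 2) * R k) :: real ^ 'n) (R k)" for k
  define c where "c = (4 / 3 :: real) ^ CARD('n)"
  have c: "c > 0" by (simp add: c_def)
  have \<phi>cont: "continuous_on UNIV (\<phi> k)" for k unfolding \<phi>_def by (rule continuous_on_bump)
  have [measurable]: "\<phi> k \<in> borel_measurable borel" for k using \<phi>cont by (rule borel_measurable_continuous_onI)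
  have \<phi>nn: "\<phi> k x \<ge> 0" for k x unfolding \<phi>_def by (rule bump_nonneg)
  have \<phi>le: "c * \<phi> k x \<le> 1" for k x
  proof -
    have "\<phi> k x \<le> (\<Prod>i\<in>(UNIV::'n set). 3 / 4)"
      unfolding \<phi>_def bump_def by (intro prod_mono conjI spline_nonneg spline_le)
    then have "c * \<phi> k x \<le> c * (3 / 4) ^ CARD('n)" using c by simp
    also have "\<dots> = 1" unfolding c_def by (subst power_mult_distrib[symmetric]) simp
    finally show ?thesis .
  qed
  have \<phi>lim: "(\<lambda>k. c * \<phi> k x) \<longlonglongrightarrow> 1" for x
  proof -
    have "(\<lambda>k. spline (x $ i / R k + 3 / 2)) \<longlonglongrightarrow> spline (0 + 3 / 2)" for i
    proof (rule isCont_tendsto_compose[of _ spline])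
      show "isCont spline (0 + 3 / 2)" using spline_deriv DERIV_isCont by blast
      show "(\<lambda>k. x $ i / R k + 3 / 2) \<longlonglongrightarrow> 0 + 3 / 2"
        unfolding R_def by (intro tendsto_add tendsto_const LIMSEQ_Suc lim_const_over_n)
    qed
    then have "(\<lambda>k. c * (\<Prod>i\<in>UNIV. spline (x $ i / R k + 3 / 2))) \<longlonglongrightarrow> c * (\<Prod>i\<in>(UNIV::'n set). spline (0 + 3 / 2))"
      by (intro tendsto_mult tendsto_prod tendsto_const)
    moreover have "(x $ i - vec (- (3 / 2) * R k) $ i) / R k = x $ i / R k + 3 / 2" for i k
      using R[of k] by (simp add: field_simps)
    moreover have "c * (\<Prod>i\<in>(UNIV::'n set). spline (0 + 3 / 2)) = 1"
      by (simp add: spline_mid c_def) (subst power_mult_distrib[symmetric], simp)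
    ultimately show ?thesis by (simp only: \<phi>_def bump_def)
  qed
  have bound: "(1 - 1 / (2 * R k)) * (\<integral>x. c * \<phi> k x * h x \<partial>lborel) \<le> n / \<beta> * I + c * n / R k * I" for k
  proof -
    let ?g = "\<lambda>x. bump_grad (vec (- (3 / 2) * R k)) (R k) x"
    have ih: "integrable lborel (\<lambda>x. \<phi> k x * h x)" and iv: "integrable lborel (\<lambda>x. \<phi> k x * v x)"
      unfolding \<phi>_def using integrable_bump_times[OF R(1)] conth contv by blast+
    have iG: "integrable lborel (\<lambda>x. G x \<bullet> ?g x)" by (rule integrable_inner_bump_grad[OF R(1) contG])
    have "(\<integral>x. \<phi> k x * (h x - n / \<beta> * v x) \<partial>lborel) \<le> - (\<integral>x. G x \<bullet> ?g x \<partial>lborel)"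
      unfolding \<phi>_def
    proof (rule weak_divergence_inequality[OF deriv2 _ _ R(1)])
      show "continuous_on UNIV (\<lambda>x. h x - n / \<beta> * v x)" by (intro continuous_intros conth contv)
      show "h x - n / \<beta> * v x \<le> (\<Sum>i\<in>UNIV. G' x (axis i 1) $ i)" for x
        using le[of x] by (simp only: h_def n_def)
    qed
    also have "(\<integral>x. \<phi> k x * (h x - n / \<beta> * v x) \<partial>lborel) = (\<integral>x. \<phi> k x * h x \<partial>lborel) - n / \<beta> * (\<integral>x. \<phi> k x * v x \<partial>lborel)"
    proof -
      have "\<phi> k x * (h x - n / \<beta> * v x) = \<phi> k x * h x - n / \<beta> * (\<phi> k x * v x)" for x
        by (simp add: algebra_simps)
      then show ?thesis using ih iv by simp
    qed
    also have "- (\<integral>x. G x \<bullet> ?g x \<partial>lborel) = (\<integral>x. - (G x \<bullet> ?g x) \<partial>lborel)" by simp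
    also have "\<dots> \<le> (\<integral>x. 1 / (2 * R k) * (\<phi> k x * h x) + n / R k * v x \<partial>lborel)"
    proof (rule integral_mono)
      show "- (G x \<bullet> ?g x) \<le> 1 / (2 * R k) * (\<phi> k x * h x) + n / R k * v x" for x
      proof -
        have g2: "(norm (?g x))\<^sup>2 \<le> 2 * n / (R k)\<^sup>2 * \<phi> k x"
          unfolding n_def \<phi>_def by (rule norm_bump_grad_power2_le[OF R(1)])
        have CS: "- (G x \<bullet> ?g x) \<le> norm (G x) * norm (?g x)"
          using Cauchy_Schwarz_ineq2[of "G x" "?g x"] by linarith
        show ?thesis
        \<comment> \<open>Where the cut-off vanishes the weight of Young's inequality degenerates,
          but \<open>g2\<close> makes the gradient vanish as well.\<close>
        proof (cases "\<phi> k x = 0")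
          case True
          then have "norm (?g x) = 0" using g2 by simp
          then show ?thesis using CS True pos[of x] R[of k] by (simp add: n_def)
        next
          case False
          then have p: "\<phi> k x > 0" using \<phi>nn[of k x] by simp
          let ?s = "\<phi> k x / (R k * v x)"
          have s: "?s > 0" using p R[of k] pos[of x] by simp
          have "norm (G x) * norm (?g x) \<le> ?s / 2 * (norm (G x))\<^sup>2 + (norm (?g x))\<^sup>2 / (2 * ?s)"
            by (rule weighted_young[OF s])
          also have "?s / 2 * (norm (G x))\<^sup>2 = 1 / (2 * R k) * (\<phi> k x * h x)" by (simp add: h_def)
          also have "(norm (?g x))\<^sup>2 / (2 * ?s) \<le> (2 * n / (R k)\<^sup>2 * \<phi> k x) / (2 * ?s)"
            using g2 s by (intro divide_right_mono) auto
          also have "\<dots> = n / R k * v x" using p R[of k] pos[of x] by (simp add: power2_eq_square field_simps)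
          finally show ?thesis using CS by simp
        qed
      qed
    qed (use iG ih int in auto)
    also have "\<dots> = 1 / (2 * R k) * (\<integral>x. \<phi> k x * h x \<partial>lborel) + n / R k * I"
      using ih int by (simp add: I_def)
    finally have "(1 - 1 / (2 * R k)) * (\<integral>x. \<phi> k x * h x \<partial>lborel) \<le> n / \<beta> * (\<integral>x. \<phi> k x * v x \<partial>lborel) + n / R k * I"
      by (simp add: algebra_simps)
    then have "c * ((1 - 1 / (2 * R k)) * (\<integral>x. \<phi> k x * h x \<partial>lborel)) \<le> c * (n / \<beta> * (\<integral>x. \<phi> k x * v x \<partial>lborel) + n / R k * I)"
      using c by (intro mult_left_mono) auto
    moreover have "c * (\<integral>x. \<phi> k x * v x \<partial>lborel) \<le> I"
    proof -
      have "c * (\<integral>x. \<phi> k x * v x \<partial>lborel) = (\<integral>x. c * \<phi> k x * v x \<partial>lborel)"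
        by (simp add: mult.assoc)
      also have "\<dots> \<le> I" unfolding I_def
      proof (rule integral_mono)
        show "c * \<phi> k x * v x \<le> v x" for x using mult_right_mono[OF \<phi>le less_imp_le[OF pos]] by simp
      qed (use iv int in \<open>auto simp: mult.assoc\<close>)
      finally show ?thesis .
    qed
    then have "n / \<beta> * (c * (\<integral>x. \<phi> k x * v x \<partial>lborel)) \<le> n / \<beta> * I"
      using \<beta> by (intro mult_left_mono) (auto simp: n_def)
    ultimately show ?thesis by (simp add: algebra_simps)
  qed
  \<comment> \<open>The rescaled cut-offs tend to 1 pointwise, so Fatou's lemma transfers the bound
    to the full Fisher integral, whose finiteness is thereby proved.\<close>
  have "(\<integral>\<^sup>+x. ennreal (h x) \<partial>lborel) = (\<integral>\<^sup>+x. liminf (\<lambda>k. ennreal ((1 - 1 / (2 * R k)) * (c * \<phi> k x * h x))) \<partial>lborel)"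
  proof (rule nn_integral_cong)
    fix x
    have "(\<lambda>k. (1 - 1 / 2 * (1 / R k)) * (c * \<phi> k x * h x)) \<longlonglongrightarrow> (1 - 1 / 2 * 0) * (1 * h x)"
      unfolding R_def by (intro tendsto_mult \<phi>lim tendsto_const tendsto_diff LIMSEQ_Suc lim_const_over_n)
    then have "(\<lambda>k. ennreal ((1 - 1 / (2 * R k)) * (c * \<phi> k x * h x))) \<longlonglongrightarrow> ennreal (h x)"
      by (intro tendsto_ennrealI) simp
    then show "ennreal (h x) = liminf (\<lambda>k. ennreal ((1 - 1 / (2 * R k)) * (c * \<phi> k x * h x)))"
      by (simp add: lim_imp_Liminf)
  qed
  also have "\<dots> \<le> liminf (\<lambda>k. \<integral>\<^sup>+x. ennreal ((1 - 1 / (2 * R k)) * (c * \<phi> k x * h x)) \<partial>lborel)"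
    by (rule nn_integral_liminf) measurable
  also have "\<dots> \<le> liminf (\<lambda>k. ennreal (n / \<beta> * I + c * n / R k * I))"
  proof (rule Liminf_mono, rule always_eventually, rule allI)
    fix k
    have i: "integrable lborel (\<lambda>x. c * \<phi> k x * h x)"
      using integrable_bump_times[OF R(1) conth] unfolding \<phi>_def by (simp add: mult.assoc)
    have "1 - 1 / (2 * R k) \<ge> 0" using R[of k] by (simp add: field_simps)
    then have "(\<integral>\<^sup>+x. ennreal ((1 - 1 / (2 * R k)) * (c * \<phi> k x * h x)) \<partial>lborel)
      = ennreal (\<integral>x. (1 - 1 / (2 * R k)) * (c * \<phi> k x * h x) \<partial>lborel)"
      using i c \<phi>nn hnn by (intro nn_integral_eq_integral) auto
    also have "\<dots> \<le> ennreal (n / \<beta> * I + c * n / R k * I)"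
      using bound[of k] by (intro ennreal_leI) simp
    finally show "(\<integral>\<^sup>+x. ennreal ((1 - 1 / (2 * R k)) * (c * \<phi> k x * h x)) \<partial>lborel) \<le> ennreal (n / \<beta> * I + c * n / R k * I)" .
  qed
  also have "\<dots> = ennreal (n / \<beta> * I + 0 * I)"
  proof (rule lim_imp_Liminf)
    show "(\<lambda>k. ennreal (n / \<beta> * I + c * n / R k * I)) \<longlonglongrightarrow> ennreal (n / \<beta> * I + 0 * I)"
      unfolding R_def by (intro tendsto_ennrealI tendsto_intros LIMSEQ_Suc lim_const_over_n)
  qed simp
  finally show ?thesis by (simp add: h_def n_def I_def)
qed

section \<open>Entropy and Fisher information\<close>


lemma gradient_eq: "GDERIV f x :> D \<Longrightarrow> gradient f x = D"
  unfolding gradient_def by (rule the_equality) (auto intro: GDERIV_unique)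

lemma gderiv_gradient:
  fixes f :: "real ^ 'n \<Rightarrow> real"
  assumes "f differentiable (at x)"
  shows "GDERIV f x :> gradient f x"
proof -
  obtain f' where f': "(f has_derivative f') (at x)" using assms by (auto simp: differentiable_def)
  have lin: "linear f'" using f' has_derivative_linear by blast
  define D where "D = (\<chi> j. f' (axis j 1))"
  have "f' h = h \<bullet> D" for h
  proof -
    have "f' h = f' (\<Sum>j\<in>UNIV. h $ j *\<^sub>R axis j 1)" using basis_expansion[of h] by (simp add: scalar_mult_eq_scaleR)
    also have "\<dots> = (\<Sum>j\<in>UNIV. h $ j *\<^sub>R f' (axis j 1))" using lin by (simp add: linear_sum linear_scale)
    finally show ?thesis by (simp add: D_def inner_vec_def)
  qed
  then have "f' = (\<lambda>h. h \<bullet> D)" by blast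
  then have "GDERIV f x :> D" using f' by (simp add: gderiv_def)
  then show ?thesis using gradient_eq by metis
qed

lemma gderiv_ln:
  fixes v :: "real ^ 'n \<Rightarrow> real"
  assumes "GDERIV v x :> g" "v x > 0"
  shows "GDERIV (\<lambda>y. ln (v y)) x :> (1 / v x) *\<^sub>R g"
  using GDERIV_DERIV_compose[OF assms(1) DERIV_ln_divide[OF assms(2)]] .

text \<open>Quotient rule for grad (ln v) = grad v / v. The diagonal entries serve both cases: their
  sum is the Laplacian of ln v, and each one is the second derivative along an axis.\<close>

lemma hessian_ln_nth:
  fixes v :: "real ^ 'n \<Rightarrow> real"
  assumes pos: "\<And>x. v x > 0" and deriv: "\<And>x. GDERIV v x :> G x"
    and deriv2: "(G has_derivative G') (at x)"
  shows "((\<lambda>y. (1 / v y) *\<^sub>R G y) has_derivative (*v) (hessian (\<lambda>y. ln (v y)) x)) (at x)"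
    and "hessian (\<lambda>y. ln (v y)) x $ i $ i = G' (axis i 1) $ i / v x - (G x $ i)\<^sup>2 / (v x)\<^sup>2"
proof -
  have grad: "gradient (\<lambda>y. ln (v y)) = (\<lambda>y. (1 / v y) *\<^sub>R G y)"
    using gradient_eq[OF gderiv_ln[OF deriv pos]] by blast
  let ?D = "\<lambda>h. (1 / v x) *\<^sub>R G' h - ((h \<bullet> G x) / (v x)\<^sup>2) *\<^sub>R G x"
  have "GDERIV (\<lambda>y. inverse (v y)) x :> - (inverse (v x))\<^sup>2 *\<^sub>R G x"
    using pos[of x] by (intro GDERIV_inverse deriv) auto
  then have inv: "((\<lambda>y. 1 / v y) has_derivative (\<lambda>h. - ((h \<bullet> G x) / (v x)\<^sup>2))) (at x)"
    unfolding gderiv_def by (simp add: inverse_eq_divide power_one_over)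
  have D: "((\<lambda>y. (1 / v y) *\<^sub>R G y) has_derivative ?D) (at x)"
    by (rule has_derivative_eq_rhs[OF has_derivative_scaleR[OF inv deriv2]]) (simp add: fun_eq_iff)
  have H: "hessian (\<lambda>y. ln (v y)) x = matrix ?D"
    unfolding hessian_def grad using frechet_derivative_at[OF D] by simp
  have "linear ?D" using D has_derivative_linear by blast
  then have "(*v) (hessian (\<lambda>y. ln (v y)) x) = ?D"
    unfolding H by (simp add: matrix_works fun_eq_iff)
  then show "((\<lambda>y. (1 / v y) *\<^sub>R G y) has_derivative (*v) (hessian (\<lambda>y. ln (v y)) x)) (at x)"
    using D by simp
  show "hessian (\<lambda>y. ln (v y)) x $ i $ i = G' (axis i 1) $ i / v x - (G x $ i)\<^sup>2 / (v x)\<^sup>2"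
    unfolding H matrix_def by (simp add: inner_axis' power2_eq_square)
qed

section \<open>Gaussian densities and their moments\<close>

lemma gauss_pos: "\<beta> > 0 \<Longrightarrow> gauss \<beta> x > 0"
  by (simp add: gauss_def)

lemma gauss_measurable[measurable]: "gauss \<beta> \<in> borel_measurable borel"
  unfolding gauss_def by measurable

lemma ln_gauss:
  fixes x :: "real ^ 'n"
  shows "\<beta> > 0 \<Longrightarrow> ln (gauss \<beta> x) = - (real CARD('n) / 2) * ln (2 * pi * \<beta>) - (norm x)\<^sup>2 / (2 * \<beta>)"
  by (simp add: gauss_def ln_mult ln_powr)

lemma gauss_gderiv:
  assumes "\<beta> > 0"
  shows "GDERIV (gauss \<beta>) x :> - (gauss \<beta> x / \<beta>) *\<^sub>R x"
proof -
  have "((\<lambda>x. (norm x)\<^sup>2) has_derivative (\<lambda>h. 2 * (h \<bullet> x))) (at x)"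
    unfolding power2_norm_eq_inner by (auto intro!: derivative_eq_intros simp: inner_commute)
  then have "GDERIV (\<lambda>x. - (norm x)\<^sup>2 / (2 * \<beta>)) x :> - (1 / \<beta>) *\<^sub>R x"
    unfolding gderiv_def using assms by (auto intro!: derivative_eq_intros simp: fun_eq_iff field_simps inner_commute)
  from GDERIV_DERIV_compose[OF this DERIV_cmult[OF DERIV_exp]]
  show ?thesis unfolding gauss_def[abs_def] by simp
qed

lemma gauss_has_integral_1:
  assumes \<beta>: "\<beta> > 0"
  shows "has_bochner_integral lborel (gauss \<beta> :: real ^ 'n \<Rightarrow> real) 1"
proof -
  interpret product_sigma_finite "\<lambda>_::'n. lborel :: real measure" by (rule product_sigma_finite_lborel)
  have "integrable lborel (gauss \<beta> :: real ^ 'n \<Rightarrow> real)"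
    using product_integrable_prod[of UNIV "\<lambda>_. centered_normal \<beta>"] \<beta>
    by (simp add: integrable_lborel_cart_iff gauss_vec_lambda)
  moreover have "(\<integral>x. gauss \<beta> (x :: real ^ 'n) \<partial>lborel) = 1"
    using product_integral_prod[of UNIV "\<lambda>_. centered_normal \<beta>"] \<beta>
    by (simp add: integral_lborel_cart gauss_vec_lambda)
  ultimately show ?thesis by (simp add: has_bochner_integral_iff)
qed

lemma gauss_second_moment:
  assumes \<beta>: "\<beta> > 0"
  shows "has_bochner_integral lborel (\<lambda>x :: real ^ 'n. (norm x)\<^sup>2 * gauss \<beta> x) (real CARD('n) * \<beta>)"
proof -
  interpret product_sigma_finite "\<lambda>_::'n. lborel :: real measure" by (rule product_sigma_finite_lborel)
  have mom: "has_bochner_integral lborel (\<lambda>t. t\<^sup>2 * centered_normal \<beta> t) \<beta>"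
    using normal_moment_even[of "sqrt \<beta>" 0 1] \<beta> by (simp add: mult.commute fact_2 numeral_2_eq_2[symmetric])
  have "has_bochner_integral lborel (\<lambda>x :: real ^ 'n. (x $ i)\<^sup>2 * gauss \<beta> x) \<beta>" for i
  proof -
    \<comment> \<open>The square multiplies the i-th factor only, so the moment is a product of
      one-dimensional integrals, \<beta> once and 1 otherwise.\<close>
    define f where "f j t = (if j = i then t\<^sup>2 * centered_normal \<beta> t else centered_normal \<beta> t)" for j t
    have f: "integrable lborel (f j)" "(\<integral>t. f j t \<partial>lborel) = (if j = i then \<beta> else 1)" for j
    proof -
      have "f j = (if j = i then (\<lambda>t. t\<^sup>2 * centered_normal \<beta> t) else centered_normal \<beta>)"
        by (auto simp: f_def)
      then show "integrable lborel (f j)" "(\<integral>t. f j t \<partial>lborel) = (if j = i then \<beta> else 1)"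
        using mom \<beta> by (auto simp: has_bochner_integral_iff)
    qed
    have eq: "(vec_lambda x $ i)\<^sup>2 * gauss \<beta> (vec_lambda x :: real ^ 'n) = (\<Prod>j\<in>UNIV. f j (x j))" for x
    proof -
      have "(\<Prod>j\<in>UNIV. f j (x j)) = f i (x i) * (\<Prod>j\<in>UNIV - {i}. f j (x j))"
        by (rule prod.remove) auto
      also have "(\<Prod>j\<in>UNIV - {i}. f j (x j)) = (\<Prod>j\<in>UNIV - {i}. centered_normal \<beta> (x j))"
        by (rule prod.cong) (auto simp: f_def)
      also have "f i (x i) * \<dots> = (x i)\<^sup>2 * (centered_normal \<beta> (x i) * \<dots>)"
        by (simp add: f_def)
      also have "centered_normal \<beta> (x i) * (\<Prod>j\<in>UNIV - {i}. centered_normal \<beta> (x j)) = gauss \<beta> (vec_lambda x :: real ^ 'n)"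
        unfolding gauss_vec_lambda[OF \<beta>] by (rule prod.remove[symmetric]) auto
      finally show ?thesis by simp
    qed
    have m: "(\<lambda>x :: real ^ 'n. (x $ i)\<^sup>2 * gauss \<beta> x) \<in> borel_measurable borel" by measurable
    have "integrable lborel (\<lambda>x :: real ^ 'n. (x $ i)\<^sup>2 * gauss \<beta> x)"
      unfolding integrable_lborel_cart_iff[OF m] eq using f by (intro product_integrable_prod) auto
    moreover have "(\<integral>x. (x $ i)\<^sup>2 * gauss \<beta> x \<partial>(lborel :: (real ^ 'n) measure)) = \<beta>"
      unfolding integral_lborel_cart[OF m] eq
      by (subst product_integral_prod) (use f in \<open>auto simp: prod.delta\<close>)
    ultimately show ?thesis by (simp add: has_bochner_integral_iff)
  qed
  then have "has_bochner_integral lborel (\<lambda>x :: real ^ 'n. \<Sum>i\<in>UNIV. (x $ i)\<^sup>2 * gauss \<beta> x) (\<Sum>i\<in>(UNIV::'n set). \<beta>)"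
    by (rule has_bochner_integral_sum)
  then show ?thesis by (simp add: norm_cart_power2 sum_distrib_right)
qed

text \<open>As grad gamma = - x gamma, the gradient of v / gamma is (grad v + v x) / gamma, and all
  powers of gamma cancel against the density of the measure.\<close>

lemma Fisher_div_gauss:
  fixes v :: "real ^ 'n \<Rightarrow> real"
  assumes pos: "\<And>x. v x > 0" and deriv: "\<And>x. GDERIV v x :> G x" and G: "continuous_on UNIV G"
  shows "Fisher (\<lambda>x. v x / gauss 1 x) = (\<integral>\<^sup>+x. ennreal ((norm (G x + v x *\<^sub>R x))\<^sup>2 / v x) \<partial>lborel)"
proof -
  have contv: "continuous_on UNIV v"
    using deriv by (auto simp: continuous_on_eq_continuous_at gderiv_def intro: has_derivative_continuous)
  have [measurable]: "v \<in> borel_measurable borel" "G \<in> borel_measurable borel"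
    using contv G by (auto intro: borel_measurable_continuous_onI)
  have g: "gauss 1 x > 0" for x :: "real ^ 'n" by (rule gauss_pos) simp
  have grad: "gradient (\<lambda>x. v x / gauss 1 x) x = (1 / gauss 1 x) *\<^sub>R (G x + v x *\<^sub>R x)" for x
  proof (rule gradient_eq)
    have "GDERIV (\<lambda>x. v x * inverse (gauss 1 x)) x :>
        v x *\<^sub>R (- (inverse (gauss 1 x))\<^sup>2 *\<^sub>R (- (gauss 1 x / 1) *\<^sub>R x)) + inverse (gauss 1 x) *\<^sub>R G x"
      using g[of x] by (intro GDERIV_mult deriv GDERIV_inverse gauss_gderiv) auto
    then show "GDERIV (\<lambda>x. v x / gauss 1 x) x :> (1 / gauss 1 x) *\<^sub>R (G x + v x *\<^sub>R x)"
      unfolding divide_inverse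
      by (rule GDERIV_subst) (use g[of x] in \<open>simp add: algebra_simps power2_eq_square\<close>)
  qed
  have "Fisher (\<lambda>x. v x / gauss 1 x)
      = (\<integral>\<^sup>+x. ennreal (gauss 1 x) * ennreal ((norm ((1 / gauss 1 x) *\<^sub>R (G x + v x *\<^sub>R x)))\<^sup>2 / (v x / gauss 1 x)) \<partial>lborel)"
    unfolding Fisher_def gauss_measure_def grad by (subst nn_integral_density) auto
  also have "\<dots> = (\<integral>\<^sup>+x. ennreal ((norm (G x + v x *\<^sub>R x))\<^sup>2 / v x) \<partial>lborel)"
  proof (rule nn_integral_cong)
    fix x
    have "gauss 1 x * ((norm ((1 / gauss 1 x) *\<^sub>R (G x + v x *\<^sub>R x)))\<^sup>2 / (v x / gauss 1 x)) = (norm (G x + v x *\<^sub>R x))\<^sup>2 / v x"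
      using g[of x] pos[of x] by (simp add: power_mult_distrib power_divide) (simp add: power2_eq_square)
    moreover have "ennreal (gauss 1 x) * ennreal u = ennreal (gauss 1 x * u)" for u
      using g[of x] by (intro ennreal_mult'[symmetric]) simp
    ultimately show "ennreal (gauss 1 x) * ennreal ((norm ((1 / gauss 1 x) *\<^sub>R (G x + v x *\<^sub>R x)))\<^sup>2 / (v x / gauss 1 x))
      = ennreal ((norm (G x + v x *\<^sub>R x))\<^sup>2 / v x)"
      by (simp only:)
  qed
  finally show ?thesis .
qed

lemma Ent_div_gauss:
  fixes v :: "real ^ 'n \<Rightarrow> real"
  assumes pos: "\<And>x. v x > 0" and int: "has_bochner_integral lborel v 1"
    and ent: "integrable lborel (\<lambda>x. v x * ln (v x))" and mom: "integrable lborel (\<lambda>x. (norm x)\<^sup>2 * v x)"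
  shows "Ent (\<lambda>x. v x / gauss 1 x) = (\<integral>x. v x * ln (v x) \<partial>lborel)
    + real CARD('n) / 2 * ln (2 * pi) + (\<integral>x. (norm x)\<^sup>2 * v x \<partial>lborel) / 2"
proof -
  have iv: "integrable lborel v" "(\<integral>x. v x \<partial>lborel) = 1" using int by (auto simp: has_bochner_integral_iff)
  have [measurable]: "v \<in> borel_measurable borel" using iv(1) by auto
  have g: "gauss 1 x > 0" for x :: "real ^ 'n" by (rule gauss_pos) simp
  have "(\<integral>x. v x / gauss 1 x \<partial>gauss_measure) = (\<integral>x. v x \<partial>lborel)"
    unfolding gauss_measure_def using g by (subst integral_density) (auto simp: less_imp_le less_imp_neq[THEN not_sym])
  moreover have "(\<integral>x. v x / gauss 1 x * ln (v x / gauss 1 x) \<partial>gauss_measure)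
      = (\<integral>x. v x * ln (v x) + real CARD('n) / 2 * ln (2 * pi) * v x + (norm x)\<^sup>2 * v x / 2 \<partial>lborel)"
  proof -
    have "gauss 1 x * (v x / gauss 1 x * ln (v x / gauss 1 x))
        = v x * ln (v x) + real CARD('n) / 2 * ln (2 * pi) * v x + (norm x)\<^sup>2 * v x / 2" for x
      using g[of x] pos[of x] by (simp add: ln_div ln_gauss algebra_simps)
    then show ?thesis
      unfolding gauss_measure_def using g by (subst integral_density) (auto simp: less_imp_le)
  qed
  ultimately show ?thesis using iv ent mom by (simp add: Ent_def)
qed

text \<open>Used with s = 1 for the Fisher information relative to gamma and with s = 1 / \<beta>
  for the right side of the logarithmic Sobolev inequality.\<close>

lemma nn_integral_fisher_shift:
  fixes v :: "real ^ 'n \<Rightarrow> real"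
  assumes pos: "\<And>x. v x > 0"
    and J: "integrable lborel (\<lambda>x. (norm (G x))\<^sup>2 / v x)" and X: "integrable lborel (\<lambda>x. x \<bullet> G x)"
    and S: "integrable lborel (\<lambda>x. (norm x)\<^sup>2 * v x)"
  shows "(\<integral>\<^sup>+x. ennreal ((norm (G x + (s * v x) *\<^sub>R x))\<^sup>2 / v x) \<partial>lborel)
    = ennreal ((\<integral>x. (norm (G x))\<^sup>2 / v x \<partial>lborel) + 2 * s * (\<integral>x. x \<bullet> G x \<partial>lborel) + s\<^sup>2 * (\<integral>x. (norm x)\<^sup>2 * v x \<partial>lborel))"
    and "0 \<le> (\<integral>x. (norm (G x))\<^sup>2 / v x \<partial>lborel) + 2 * s * (\<integral>x. x \<bullet> G x \<partial>lborel) + s\<^sup>2 * (\<integral>x. (norm x)\<^sup>2 * v x \<partial>lborel)"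
proof -
  let ?r = "(\<integral>x. (norm (G x))\<^sup>2 / v x \<partial>lborel) + 2 * s * (\<integral>x. x \<bullet> G x \<partial>lborel) + s\<^sup>2 * (\<integral>x. (norm x)\<^sup>2 * v x \<partial>lborel)"
  have eq: "(norm (G x + (s * v x) *\<^sub>R x))\<^sup>2 / v x
      = (norm (G x))\<^sup>2 / v x + 2 * s * (x \<bullet> G x) + s\<^sup>2 * ((norm x)\<^sup>2 * v x)" for x
    using pos[of x] unfolding power2_norm_eq_inner
    by (simp add: inner_add_left inner_add_right inner_commute field_simps power2_eq_square)
  have r: "?r = (\<integral>x. (norm (G x + (s * v x) *\<^sub>R x))\<^sup>2 / v x \<partial>lborel)"
    unfolding eq using J X S by simp
  show "0 \<le> ?r" unfolding r by (rule integral_nonneg_AE) (use pos in \<open>auto simp: less_imp_le\<close>)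
  show "(\<integral>\<^sup>+x. ennreal ((norm (G x + (s * v x) *\<^sub>R x))\<^sup>2 / v x) \<partial>lborel) = ennreal ?r"
    unfolding r
  proof (rule nn_integral_eq_integral)
    show "integrable lborel (\<lambda>x. (norm (G x + (s * v x) *\<^sub>R x))\<^sup>2 / v x)" unfolding eq using J X S by simp
  qed (use pos in \<open>auto simp: less_imp_le\<close>)
qed

text \<open>The entropy contributes half the second moment, and half the Fisher information takes
  the same amount away.\<close>

lemma deficit_eq:
  fixes v :: "real ^ 'n \<Rightarrow> real"
  assumes pos: "\<And>x. v x > 0" and deriv: "\<And>x. GDERIV v x :> G x" and G: "continuous_on UNIV G"
    and int: "has_bochner_integral lborel v 1"
    and ent: "integrable lborel (\<lambda>x. v x * ln (v x))" and mom: "integrable lborel (\<lambda>x. (norm x)\<^sup>2 * v x)"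
    and J: "integrable lborel (\<lambda>x. (norm (G x))\<^sup>2 / v x)" and X: "integrable lborel (\<lambda>x. x \<bullet> G x)"
  shows "ereal (Ent (\<lambda>x. v x / gauss 1 x)) - ereal (1 / 2) * enn2ereal (Fisher (\<lambda>x. v x / gauss 1 x))
    = ereal ((\<integral>x. v x * ln (v x) \<partial>lborel) + real CARD('n) / 2 * ln (2 * pi)
        - (\<integral>x. (norm (G x))\<^sup>2 / v x \<partial>lborel) / 2 - (\<integral>x. x \<bullet> G x \<partial>lborel))"
  using nn_integral_fisher_shift[OF pos J X mom, of 1]
  by (simp add: Fisher_div_gauss[OF pos deriv G] Ent_div_gauss[OF pos int ent mom] enn2ereal_ennreal field_simps)

text \<open>For gamma_beta one has J = n / \<beta>, the integral of x . grad is - n, and the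
  integral of v ln v is - (n/2) ln (2 pi \<beta>) - n/2.\<close>

lemma deficit_gauss:
  assumes \<beta>: "\<beta> > 0"
  shows "ereal (Ent (\<lambda>x :: real ^ 'n. gauss \<beta> x / gauss 1 x)) - ereal (1 / 2) * enn2ereal (Fisher (\<lambda>x :: real ^ 'n. gauss \<beta> x / gauss 1 x))
    = ereal (real CARD('n) / 2 * (1 - 1 / \<beta> - ln \<beta>))"
proof -
  let ?g = "gauss \<beta> :: real ^ 'n \<Rightarrow> real" and ?G = "\<lambda>x :: real ^ 'n. - (gauss \<beta> x / \<beta>) *\<^sub>R x"
  note one = gauss_has_integral_1[OF \<beta>, where 'n='n] and two = gauss_second_moment[OF \<beta>, where 'n='n]
  have i: "integrable lborel ?g" "(\<integral>x. ?g x \<partial>lborel) = 1"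
    "integrable lborel (\<lambda>x. (norm x)\<^sup>2 * ?g x)" "(\<integral>x. (norm x)\<^sup>2 * ?g x \<partial>lborel) = real CARD('n) * \<beta>"
    using one two by (auto simp: has_bochner_integral_iff)
  have e: "?g x * ln (?g x) = - (real CARD('n) / 2) * ln (2 * pi * \<beta>) * ?g x - 1 / (2 * \<beta>) * ((norm x)\<^sup>2 * ?g x)" for x
    using \<beta> by (simp add: ln_gauss algebra_simps)
  have j: "(norm (?G x))\<^sup>2 / ?g x = 1 / \<beta>\<^sup>2 * ((norm x)\<^sup>2 * ?g x)" for x
    using gauss_pos[OF \<beta>, of x] \<beta> by (simp add: power_mult_distrib power_divide) (simp add: power2_eq_square)
  have x: "x \<bullet> ?G x = - (1 / \<beta>) * ((norm x)\<^sup>2 * ?g x)" for x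
    by (simp add: power2_norm_eq_inner)
  have ie: "integrable lborel (\<lambda>x. ?g x * ln (?g x))" unfolding e using i by simp
  have ij: "integrable lborel (\<lambda>x. (norm (?G x))\<^sup>2 / ?g x)" unfolding j using i by simp
  have ix: "integrable lborel (\<lambda>x. x \<bullet> ?G x)" unfolding x using i by simp
  have E: "(\<integral>x. ?g x * ln (?g x) \<partial>lborel) = - (real CARD('n) / 2) * ln (2 * pi * \<beta>) - real CARD('n) / 2"
    unfolding e using i \<beta> by simp
  have Jv: "(\<integral>x. (norm (?G x))\<^sup>2 / ?g x \<partial>lborel) = real CARD('n) / \<beta>"
    unfolding j using i \<beta> by (simp add: power2_eq_square)
  have Xv: "(\<integral>x. x \<bullet> ?G x \<partial>lborel) = - real CARD('n)"
    unfolding x using i \<beta> by simp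
  have cont: "continuous_on UNIV ?G"
    unfolding gauss_def using \<beta> by (auto intro!: continuous_intros)
  have "ln (2 * pi * \<beta>) = ln (2 * pi) + ln \<beta>" using \<beta> by (simp add: ln_mult)
  then show ?thesis
    unfolding deficit_eq[OF gauss_pos[OF \<beta>] gauss_gderiv[OF \<beta>] cont one ie i(3) ij ix] E Jv Xv
    using \<beta> by (simp add: field_simps)
qed

section \<open>Integrability from the weighted square bound\<close>

lemma gauss_fourth_moment_integrable:
  assumes \<beta>: "\<beta> > 0"
  shows "integrable lborel (\<lambda>x :: real ^ 'n. (norm x) ^ 4 * gauss \<beta> x)"
proof -
  \<comment> \<open>With t = |x|^2 / (4 \<beta>), the bound t^2 / 2 <= exp t reads |x|^4 <= 32
    \<beta>^2 exp t, and exp t turns the exponent of variance \<beta> into that of variance 2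
    \<beta>. The quotient compares the normalising constants.\<close>
  define c where "c = 32 * \<beta>\<^sup>2 * ((2 * pi * \<beta>) powr (- real CARD('n) / 2) / (2 * pi * (2 * \<beta>)) powr (- real CARD('n) / 2))"
  have "integrable lborel (\<lambda>x :: real ^ 'n. c * gauss (2 * \<beta>) x)"
    using gauss_has_integral_1[of "2 * \<beta>", where 'n='n] \<beta> by (auto simp: has_bochner_integral_iff)
  then show ?thesis
  proof (rule Bochner_Integration.integrable_bound)
    show "AE x in lborel. norm ((norm x) ^ 4 * gauss \<beta> x) \<le> norm (c * gauss (2 * \<beta>) (x :: real ^ 'n))"
    proof (rule AE_I2)
      fix x :: "real ^ 'n"
      define t where "t = (norm x)\<^sup>2 / (4 * \<beta>)"
      have t: "t \<ge> 0" using \<beta> by (simp add: t_def)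
      have "t\<^sup>2 / 2 \<le> exp t" using exp_lower_Taylor_quadratic[OF t] t by simp
      then have "32 * \<beta>\<^sup>2 * (t\<^sup>2 / 2) \<le> 32 * \<beta>\<^sup>2 * exp t" by (intro mult_left_mono) auto
      moreover have "32 * \<beta>\<^sup>2 * (t\<^sup>2 / 2) = (norm x) ^ 4"
        using \<beta> by (simp add: t_def power_divide power_mult_distrib power_mult[symmetric])
      ultimately have "(norm x) ^ 4 \<le> 32 * \<beta>\<^sup>2 * exp t" by (simp only:)
      then have "(norm x) ^ 4 * gauss \<beta> x \<le> 32 * \<beta>\<^sup>2 * exp t * gauss \<beta> x"
        using gauss_pos[OF \<beta>, of x] by (intro mult_right_mono) auto
      also have "\<dots> = c * gauss (2 * \<beta>) x"
      proof -
        have "exp t * exp (- (norm x)\<^sup>2 / (2 * \<beta>)) = exp (- (norm x)\<^sup>2 / (2 * (2 * \<beta>)))"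
          unfolding exp_add[symmetric] t_def using \<beta> by (simp add: field_simps)
        then show ?thesis using \<beta> by (simp add: gauss_def c_def)
      qed
      finally show "norm ((norm x) ^ 4 * gauss \<beta> x) \<le> norm (c * gauss (2 * \<beta>) x)"
        using gauss_pos[OF \<beta>, of x] by simp
    qed
  qed measurable
qed

text \<open>Young's inequality with weight \<open>gauss \<beta> x\<close> splits |x|^2 v into the
  weighted square of v and a fourth Gaussian moment.\<close>

lemma second_moment_integrable:
  fixes v :: "real ^ 'n \<Rightarrow> real"
  assumes \<beta>: "\<beta> > 0" and pos: "\<And>x. v x > 0" and [measurable]: "v \<in> borel_measurable borel"
    and L2: "integrable lborel (\<lambda>x. (v x)\<^sup>2 / gauss \<beta> x)"
  shows "integrable lborel (\<lambda>x. (norm x)\<^sup>2 * v x)"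
proof (rule Bochner_Integration.integrable_bound[OF Bochner_Integration.integrable_add[OF L2 gauss_fourth_moment_integrable[OF \<beta>]]])
  show "AE x in lborel. norm ((norm x)\<^sup>2 * v x) \<le> norm ((v x)\<^sup>2 / gauss \<beta> x + (norm x) ^ 4 * gauss \<beta> x)"
  proof (rule AE_I2)
    fix x :: "real ^ 'n"
    have g: "gauss \<beta> x > 0" by (rule gauss_pos[OF \<beta>])
    have "(norm x)\<^sup>2 * v x \<le> gauss \<beta> x / 2 * ((norm x)\<^sup>2)\<^sup>2 + (v x)\<^sup>2 / (2 * gauss \<beta> x)"
      by (rule weighted_young[OF g])
    also have "\<dots> \<le> (v x)\<^sup>2 / gauss \<beta> x + (norm x) ^ 4 * gauss \<beta> x"
    proof -
      have "0 \<le> (v x)\<^sup>2 / gauss \<beta> x" "0 \<le> (norm x) ^ 4 * gauss \<beta> x" using g by auto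
      then show ?thesis by (simp add: power_mult[symmetric] mult.commute)
    qed
    finally show "norm ((norm x)\<^sup>2 * v x) \<le> norm ((v x)\<^sup>2 / gauss \<beta> x + (norm x) ^ 4 * gauss \<beta> x)"
      using pos[of x] by simp
  qed
qed measurable

text \<open>From above, ln v <= v and boundedness of the Gaussian reduce v ln v to the weighted
  square. From below, \<open>kl (v x) (gauss \<beta> x)\<close> is nonnegative and the logarithm of
  the Gaussian is quadratic, so the second moment suffices.\<close>

lemma entropy_integrable:
  fixes v :: "real ^ 'n \<Rightarrow> real"
  assumes \<beta>: "\<beta> > 0" and pos: "\<And>x. v x > 0" and int: "integrable lborel v"
    and L2: "integrable lborel (\<lambda>x. (v x)\<^sup>2 / gauss \<beta> x)"
  shows "integrable lborel (\<lambda>x. v x * ln (v x))"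
proof -
  have [measurable]: "v \<in> borel_measurable borel" using int by auto
  define C where "C = (2 * pi * \<beta>) powr (- real CARD('n) / 2)"
  have C: "C > 0" using \<beta> by (simp add: C_def)
  have gC: "gauss \<beta> x \<le> C" for x :: "real ^ 'n"
    using \<beta> by (simp add: gauss_def C_def mult_left_le)
  have mom: "integrable lborel (\<lambda>x. (norm x)\<^sup>2 * v x)"
    by (rule second_moment_integrable[OF \<beta> pos _ L2]) measurable
  have gi: "integrable lborel (gauss \<beta> :: real ^ 'n \<Rightarrow> real)"
    using gauss_has_integral_1[OF \<beta>, where 'n='n] by (simp add: has_bochner_integral_iff)
  let ?B = "\<lambda>x. C * ((v x)\<^sup>2 / gauss \<beta> x) + \<bar>real CARD('n) / 2 * ln (2 * pi * \<beta>)\<bar> * v x + 1 / (2 * \<beta>) * ((norm x)\<^sup>2 * v x) + gauss \<beta> x"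
  have B: "integrable lborel ?B"
    by (intro Bochner_Integration.integrable_add integrable_mult_right L2 int mom gi)
  show ?thesis
  proof (rule Bochner_Integration.integrable_bound[OF B])
    show "AE x in lborel. norm (v x * ln (v x)) \<le> norm (?B x)"
    proof (rule AE_I2)
      fix x :: "real ^ 'n"
      have g: "gauss \<beta> x > 0" by (rule gauss_pos[OF \<beta>])
      have nn: "0 \<le> C * ((v x)\<^sup>2 / gauss \<beta> x)" "0 \<le> \<bar>real CARD('n) / 2 * ln (2 * pi * \<beta>)\<bar> * v x"
        "0 \<le> 1 / (2 * \<beta>) * ((norm x)\<^sup>2 * v x)"
        using C g pos[of x] \<beta> by (auto intro!: mult_nonneg_nonneg)
      have "v x * ln (v x) \<le> v x * v x" using pos[of x] ln_bound[of "v x"] by (intro mult_left_mono) auto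
      also have "\<dots> = gauss \<beta> x * ((v x)\<^sup>2 / gauss \<beta> x)" using g by (simp add: power2_eq_square)
      also have "\<dots> \<le> C * ((v x)\<^sup>2 / gauss \<beta> x)" using gC g by (intro mult_right_mono) auto
      finally have up: "v x * ln (v x) \<le> ?B x" using nn g by linarith
      have "0 \<le> kl (v x) (gauss \<beta> x)" using pos g by (rule kl_nonneg)
      then have "- (v x * ln (v x)) \<le> - (v x * ln (gauss \<beta> x)) - v x + gauss \<beta> x"
        using pos[of x] g by (simp add: kl_def ln_div algebra_simps)
      also have "- (v x * ln (gauss \<beta> x)) = real CARD('n) / 2 * ln (2 * pi * \<beta>) * v x + 1 / (2 * \<beta>) * ((norm x)\<^sup>2 * v x)"
        using \<beta> by (simp add: ln_gauss algebra_simps)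
      also have "real CARD('n) / 2 * ln (2 * pi * \<beta>) * v x \<le> \<bar>real CARD('n) / 2 * ln (2 * pi * \<beta>)\<bar> * v x"
        using pos[of x] by (intro mult_right_mono) auto
      finally have "- (v x * ln (v x)) \<le> ?B x" using nn pos[of x] by linarith
      with up show "norm (v x * ln (v x)) \<le> norm (?B x)" by (simp add: abs_le_iff)
    qed
  qed measurable
qed

lemma fisher_sign:
  fixes v :: "real ^ 'n \<Rightarrow> real"
  assumes \<beta>: "\<beta> > 0" and pos: "\<And>x. v x > 0" and td: "twice_differentiable v"
    and int: "has_bochner_integral lborel v 1"
    and hyp: "(\<beta> > 1 \<and> semi_log_subharmonic \<beta> v) \<or> (\<beta> < 1 \<and> semi_log_concave \<beta> v)"
    and J: "integrable lborel (\<lambda>x. (norm (gradient v x))\<^sup>2 / v x)"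
  shows "(\<beta> - 1) * (\<integral>x. (norm (gradient v x))\<^sup>2 / v x \<partial>lborel) \<le> (\<beta> - 1) * (real CARD('n) / \<beta>)"
proof -
  let ?G = "gradient v" and ?G' = "\<lambda>x. frechet_derivative (gradient v) (at x)"
  let ?J = "\<integral>x. (norm (gradient v x))\<^sup>2 / v x \<partial>lborel"
  have iv: "integrable lborel v" "(\<integral>x. v x \<partial>lborel) = 1" using int by (auto simp: has_bochner_integral_iff)
  have deriv: "GDERIV v x :> ?G x" for x using td gderiv_gradient by (auto simp: twice_differentiable_def)
  have deriv2: "(?G has_derivative ?G' x) (at x)" for x
    using td frechet_derivative_works by (auto simp: twice_differentiable_def)
  have contG: "continuous_on UNIV ?G"
    using has_derivative_continuous[OF deriv2] by (simp add: continuous_on_eq_continuous_at)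
  note hess = hessian_ln_nth[OF pos deriv deriv2]
  have JJ: "(\<integral>\<^sup>+x. ennreal ((norm (?G x))\<^sup>2 / v x) \<partial>lborel) = ennreal ?J"
    using J pos by (intro nn_integral_eq_integral) (auto simp: less_imp_le)
  have J0: "0 \<le> ?J" by (rule integral_nonneg_AE) (use pos in \<open>auto simp: less_imp_le\<close>)
  from hyp show ?thesis
  proof (elim disjE conjE)
    assume b: "\<beta> > 1" and sub: "semi_log_subharmonic \<beta> v"
    have "(\<integral>\<^sup>+x. ennreal ((norm (?G x))\<^sup>2 / v x) \<partial>lborel) \<le> ennreal (real CARD('n) / \<beta> * (\<integral>x. v x \<partial>lborel))"
    proof (rule fisher_upper_bound[OF pos deriv deriv2 iv(1) _ \<beta>])
      fix x
      \<comment> \<open>Multiplied by v, this bound on the trace of the Hessian becomes Laplace(v)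
        >= |grad v|^2 / v - (n / \<beta>) v.\<close>
      have "- real CARD('n) / \<beta> \<le> (\<Sum>i\<in>UNIV. ?G' x (axis i 1) $ i / v x - (?G x $ i)\<^sup>2 / (v x)\<^sup>2)"
        using sub unfolding semi_log_subharmonic_def laplacian_def trace_def by (simp add: hess(2))
      also have "\<dots> = (\<Sum>i\<in>UNIV. ?G' x (axis i 1) $ i) / v x - (norm (?G x))\<^sup>2 / (v x)\<^sup>2"
        by (simp add: sum_subtractf sum_divide_distrib norm_cart_power2)
      finally have "- real CARD('n) / \<beta> * v x \<le> ((\<Sum>i\<in>UNIV. ?G' x (axis i 1) $ i) / v x - (norm (?G x))\<^sup>2 / (v x)\<^sup>2) * v x"
        using pos[of x] by (intro mult_right_mono) auto
      also have "\<dots> = (\<Sum>i\<in>UNIV. ?G' x (axis i 1) $ i) - (norm (?G x))\<^sup>2 / v x"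
        using pos[of x] by (simp add: field_simps power2_eq_square)
      finally show "(norm (?G x))\<^sup>2 / v x - real CARD('n) / \<beta> * v x \<le> (\<Sum>i\<in>UNIV. ?G' x (axis i 1) $ i)"
        by simp
    qed
    then have "?J \<le> real CARD('n) / \<beta>" unfolding JJ iv(2) using \<beta> by simp
    then show ?thesis using b by (intro mult_left_mono) auto
  next
    assume b: "\<beta> < 1" and conc: "semi_log_concave \<beta> v"
    have "of_nat CARD('n) * (\<integral>\<^sup>+x. ennreal (v x / \<beta>) \<partial>lborel) \<le> (\<integral>\<^sup>+x. ennreal ((norm (?G x))\<^sup>2 / v x) \<partial>lborel)"
    proof (rule fisher_lower_bound[OF \<beta> pos deriv contG])
      show "v \<in> borel_measurable borel" using iv by auto
      fix x :: "'n \<Rightarrow> real" and i and s t :: real assume st: "s \<le> t"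
      let ?c = "\<lambda>t. vec_lambda (x(i := t)) :: real ^ 'n"
      let ?p = "\<lambda>t. ((1 / v (?c t)) *\<^sub>R ?G (?c t)) $ i"
      \<comment> \<open>\<open>?p\<close> is a partial derivative of ln v on an axis line. Its
        derivative is a diagonal entry of the Hessian, and testing the matrix inequality with the
        axis vector bounds it by - 1 / \<beta>.\<close>
      have "?p t + t / \<beta> \<le> ?p s + s / \<beta>"
      proof (rule DERIV_nonpos_imp_nonincreasing[OF st])
        fix u :: real
        let ?H = "hessian (\<lambda>y. ln (v y)) (?c u)"
        have "((\<lambda>t. (1 / v (?c t)) *\<^sub>R ?G (?c t)) has_derivative (\<lambda>h. ?H *v (h *\<^sub>R axis i 1))) (at u)"
          using has_derivative_compose[OF has_derivative_vec_lambda_upd hess(1)] .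
        then have "(?p has_derivative (\<lambda>h. (?H *v (h *\<^sub>R axis i 1)) $ i)) (at u)"
          by (rule bounded_linear.has_derivative[OF bounded_linear_vec_nth])
        moreover have "(\<lambda>h. (?H *v (h *\<^sub>R axis i 1)) $ i) = (*) (?H $ i $ i)"
          by (simp add: fun_eq_iff matrix_vector_mult_scaleR matrix_vector_mult_basis column_def mult.commute)
        ultimately have "(?p has_real_derivative ?H $ i $ i) (at u)"
          by (simp add: has_field_derivative_def)
        then have "((\<lambda>t. ?p t + t / \<beta>) has_real_derivative ?H $ i $ i + 1 / \<beta>) (at u)"
          by (rule DERIV_add[OF _ DERIV_cdivide[OF DERIV_ident]])
        moreover have "?H $ i $ i \<le> - 1 / \<beta>"
        proof -
          have "axis i 1 \<bullet> (?H *v axis i 1) \<le> axis i 1 \<bullet> ((mat (- 1 / \<beta>) :: real ^ 'n ^ 'n) *v axis i 1)"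
            using conc unfolding semi_log_concave_def loewner_le_def by blast
          then show ?thesis
            by (simp add: matrix_vector_mult_basis column_def inner_axis' mat_def)
        qed
        ultimately show "\<exists>y. ((\<lambda>t. ?p t + t / \<beta>) has_real_derivative y) (at u) \<and> y \<le> 0"
          by (intro exI[of _ "?H $ i $ i + 1 / \<beta>"]) auto
      qed
      then show "?G (?c t) $ i / v (?c t) + t / \<beta> \<le> ?G (?c s) $ i / v (?c s) + s / \<beta>" by simp
    qed
    also have "(\<integral>\<^sup>+x. ennreal (v x / \<beta>) \<partial>lborel) = ennreal (1 / \<beta>)"
      using iv pos \<beta> by (subst nn_integral_eq_integral) (auto simp: less_imp_le)
    finally have "real CARD('n) / \<beta> \<le> ?J"
      unfolding JJ using J0 \<beta> by (simp add: ennreal_of_nat_eq_real_of_nat ennreal_mult'[symmetric])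
    then show ?thesis using b by (intro mult_left_mono_neg) auto
  qed
qed

theorem theorem1p4:
  fixes v :: "real ^ 'n \<Rightarrow> real" and \<beta> :: real
  assumes "\<beta> > 0"
    and "\<And>x. v x > 0"
    and "twice_differentiable v"
    and "integrable lborel (\<lambda>x. (v x)\<^sup>2 / gauss \<beta> x)"
    and "has_bochner_integral lborel v 1"
    and "(\<beta> > 1 \<and> semi_log_subharmonic \<beta> v) \<or> (\<beta> < 1 \<and> semi_log_concave \<beta> v)"
  shows "ereal (Ent (\<lambda>x. v x / gauss 1 x))
           - ereal (1 / 2) * enn2ereal (Fisher (\<lambda>x. v x / gauss 1 x))
         \<le> ereal (Ent (\<lambda>x :: real ^ 'n. gauss \<beta> x / gauss 1 x))
           - ereal (1 / 2) * enn2ereal (Fisher (\<lambda>x :: real ^ 'n. gauss \<beta> x / gauss 1 x))"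
proof (cases "Fisher (\<lambda>x. v x / gauss 1 x) = \<infinity>")
  \<comment> \<open>The entropy is a real number, so infinite Fisher information makes the left side
    minus infinity.\<close>
  case True
  then show ?thesis by simp
next
  case False
  note \<beta> = assms(1) and pos = assms(2) and int = assms(5)
  let ?G = "gradient v"
  have iv: "integrable lborel v" "(\<integral>x. v x \<partial>lborel) = 1" using int by (auto simp: has_bochner_integral_iff)
  have [measurable]: "v \<in> borel_measurable borel" using iv by auto
  have deriv: "GDERIV v x :> ?G x" for x using assms(3) gderiv_gradient by (auto simp: twice_differentiable_def)
  have contG: "continuous_on UNIV ?G"
    using assms(3)
    by (auto simp: continuous_on_eq_continuous_at twice_differentiable_def intro: differentiable_imp_continuous_within)
  have Gm[measurable]: "?G \<in> borel_measurable borel" using contG by (rule borel_measurable_continuous_onI)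
  have mom: "integrable lborel (\<lambda>x. (norm x)\<^sup>2 * v x)"
    by (rule second_moment_integrable[OF \<beta> pos _ assms(4)]) measurable
  have ent: "integrable lborel (\<lambda>x. v x * ln (v x))"
    by (rule entropy_integrable[OF \<beta> pos iv(1) assms(4)])
  have F: "integrable lborel (\<lambda>x. (norm (?G x + v x *\<^sub>R x))\<^sup>2 / v x)"
    using False pos unfolding Fisher_div_gauss[OF pos deriv contG]
    by (intro integrableI_nonneg) (auto simp: less_imp_le less_top)
  \<comment> \<open>Finiteness is known for the shifted gradient grad v + v x; removing the shift
    costs a multiple of |x|^2 v, which is integrable.\<close>
  have J: "integrable lborel (\<lambda>x. (norm (?G x))\<^sup>2 / v x)"
  proof (rule Bochner_Integration.integrable_bound[OF Bochner_Integration.integrable_add[OF integrable_mult_right[OF F, of 2] integrable_mult_right[OF mom, of 2]]])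
    show "AE x in lborel. norm ((norm (?G x))\<^sup>2 / v x) \<le> norm (2 * ((norm (?G x + v x *\<^sub>R x))\<^sup>2 / v x) + 2 * ((norm x)\<^sup>2 * v x))"
    proof (rule AE_I2)
      fix x
      let ?a = "?G x + v x *\<^sub>R x" and ?b = "v x *\<^sub>R x"
      have "(norm (a - b))\<^sup>2 \<le> 2 * (norm a)\<^sup>2 + 2 * (norm b)\<^sup>2" for a b :: "real ^ 'n"
      proof -
        have "(norm (a - b))\<^sup>2 + (norm (a + b))\<^sup>2 = 2 * (norm a)\<^sup>2 + 2 * (norm b)\<^sup>2"
          unfolding power2_norm_eq_inner by (simp add: inner_add_left inner_add_right inner_diff_left inner_diff_right)
        then show ?thesis using zero_le_power2[of "norm (a + b)"] by linarith
      qed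
      from this[of ?a ?b] have "(norm (?G x))\<^sup>2 \<le> 2 * (norm ?a)\<^sup>2 + 2 * (norm ?b)\<^sup>2"
        by (simp only: add_diff_cancel_right')
      then have "(norm (?G x))\<^sup>2 / v x \<le> (2 * (norm ?a)\<^sup>2 + 2 * (norm ?b)\<^sup>2) / v x"
        using pos[of x] by (intro divide_right_mono) auto
      also have "\<dots> = 2 * ((norm ?a)\<^sup>2 / v x) + 2 * ((norm x)\<^sup>2 * v x)"
        using pos[of x] by (simp add: add_divide_distrib power_mult_distrib) (simp add: power2_eq_square)
      finally show "norm ((norm (?G x))\<^sup>2 / v x) \<le> norm (2 * ((norm ?a)\<^sup>2 / v x) + 2 * ((norm x)\<^sup>2 * v x))"
        using pos[of x] by simp
    qed
  qed measurable
  have X: "integrable lborel (\<lambda>x. x \<bullet> ?G x)"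
  proof (rule Bochner_Integration.integrable_bound[OF Bochner_Integration.integrable_add[OF mom J]])
    show "AE x in lborel. norm (x \<bullet> ?G x) \<le> norm ((norm x)\<^sup>2 * v x + (norm (?G x))\<^sup>2 / v x)"
    proof (rule AE_I2)
      fix x
      have "\<bar>x \<bullet> ?G x\<bar> \<le> norm x * norm (?G x)" by (rule Cauchy_Schwarz_ineq2)
      also have "\<dots> \<le> v x / 2 * (norm x)\<^sup>2 + (norm (?G x))\<^sup>2 / (2 * v x)" by (rule weighted_young[OF pos])
      also have "\<dots> \<le> (norm x)\<^sup>2 * v x + (norm (?G x))\<^sup>2 / v x"
      proof -
        have "0 \<le> (norm x)\<^sup>2 * v x" "0 \<le> (norm (?G x))\<^sup>2 / v x" using pos[of x] by auto
        then show ?thesis by (simp add: mult.commute)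
      qed
      finally show "norm (x \<bullet> ?G x) \<le> norm ((norm x)\<^sup>2 * v x + (norm (?G x))\<^sup>2 / v x)" by simp
    qed
  qed measurable
  define V where "V = (\<integral>x. v x * ln (v x) \<partial>lborel)"
  define S where "S = (\<integral>x. (norm x)\<^sup>2 * v x \<partial>lborel)"
  define j where "j = (\<integral>x. (norm (?G x))\<^sup>2 / v x \<partial>lborel)"
  define c where "c = (\<integral>x. x \<bullet> ?G x \<partial>lborel)"
  define d where "d = real CARD('n)"
  have gi: "integrable lborel (gauss \<beta> :: real ^ 'n \<Rightarrow> real)" "(\<integral>x. gauss \<beta> (x :: real ^ 'n) \<partial>lborel) = 1"
    using gauss_has_integral_1[OF \<beta>, where 'n='n] by (simp_all add: has_bochner_integral_iff)
  \<comment> \<open>All integrals are finite at this point, so the inequality in [0, inf] can be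
    read as one between real numbers.\<close>
  have lsi: "V + d / 2 * ln (2 * pi * \<beta>) + S / (2 * \<beta>) \<le> \<beta> / 2 * (j + 2 / \<beta> * c + 1 / \<beta>\<^sup>2 * S)"
  proof -
    have kl: "kl (v x) (gauss \<beta> x) = v x * ln (v x) + d / 2 * ln (2 * pi * \<beta>) * v x + 1 / (2 * \<beta>) * ((norm x)\<^sup>2 * v x) - v x + gauss \<beta> x" for x
      using pos[of x] gauss_pos[OF \<beta>, of x] by (simp add: kl_def ln_div ln_gauss[OF \<beta>] d_def algebra_simps)
    have "V + d / 2 * ln (2 * pi * \<beta>) + S / (2 * \<beta>) = (\<integral>x. kl (v x) (gauss \<beta> x) \<partial>lborel)"
      unfolding kl using ent iv mom gi by (simp add: V_def S_def)
    then have "ennreal (V + d / 2 * ln (2 * pi * \<beta>) + S / (2 * \<beta>)) = ennreal (\<integral>x. kl (v x) (gauss \<beta> x) \<partial>lborel)"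
      by simp
    also have "\<dots> \<le> (\<integral>\<^sup>+x. ennreal (kl (v x) (gauss \<beta> x)) \<partial>lborel)"
      by (rule ennreal_integral_le_nn_integral) (unfold kl, use ent iv mom gi in simp)
    also have "\<dots> \<le> (\<integral>\<^sup>+x. ennreal (\<beta> / 2 * ((norm (?G x + (v x / \<beta>) *\<^sub>R x))\<^sup>2 / v x)) \<partial>lborel)"
      using gaussian_log_sobolev[OF \<beta> pos deriv contG iv(1)] by (simp add: iv(2))
    also have "\<dots> = ennreal (\<beta> / 2) * (\<integral>\<^sup>+x. ennreal ((norm (?G x + (v x / \<beta>) *\<^sub>R x))\<^sup>2 / v x) \<partial>lborel)"
      using \<beta> pos by (subst nn_integral_cmult[symmetric]) (auto simp: ennreal_mult'[symmetric] less_imp_le)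
    also have "(\<integral>\<^sup>+x. ennreal ((norm (?G x + (v x / \<beta>) *\<^sub>R x))\<^sup>2 / v x) \<partial>lborel) = ennreal (j + 2 / \<beta> * c + 1 / \<beta>\<^sup>2 * S)"
      using nn_integral_fisher_shift(1)[OF pos J X mom, of "1 / \<beta>"] by (simp add: j_def c_def S_def power_one_over)
    also have "ennreal (\<beta> / 2) * \<dots> = ennreal (\<beta> / 2 * (j + 2 / \<beta> * c + 1 / \<beta>\<^sup>2 * S))"
      using \<beta> by (simp add: ennreal_mult'[symmetric])
    \<comment> \<open>Cancelling \<open>ennreal\<close> requires the right side to be nonnegative,
      which the second part of \<open>nn_integral_fisher_shift\<close> provides.\<close>
    finally show ?thesis
      using nn_integral_fisher_shift(2)[OF pos J X mom, of "1 / \<beta>"] \<beta>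
      by (subst (asm) ennreal_le_iff) (auto simp: j_def c_def S_def power_one_over)
  qed
  \<comment> \<open>The second moment appears as S / (2 \<beta>) on both sides of \<open>lsi\<close>
    and cancels. What is left of the Fisher terms is (\<beta> - 1) j / 2, which
    \<open>fisher_sign\<close> bounds.\<close>
  have "\<beta> / 2 * (j + 2 / \<beta> * c + 1 / \<beta>\<^sup>2 * S) = \<beta> / 2 * j + c + S / (2 * \<beta>)"
    using \<beta> by (simp add: field_simps power2_eq_square)
  moreover have "(\<beta> - 1) * j \<le> (\<beta> - 1) * (d / \<beta>)"
    unfolding j_def d_def by (rule fisher_sign[OF \<beta> pos assms(3) int assms(6) J[folded j_def]])
  moreover have "(\<beta> - 1) * (d / \<beta>) = d * (1 - 1 / \<beta>)" using \<beta> by (simp add: field_simps)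
  moreover have "ln (2 * pi * \<beta>) = ln (2 * pi) + ln \<beta>" using \<beta> by (simp add: ln_mult)
  ultimately have "V + d / 2 * ln (2 * pi) - j / 2 - c \<le> d / 2 * (1 - 1 / \<beta> - ln \<beta>)"
    using lsi by (simp add: algebra_simps)
  then show ?thesis
    unfolding deficit_gauss[OF \<beta>] deficit_eq[OF pos deriv contG int ent mom J X]
    by (simp add: V_def j_def c_def d_def)
qed

end
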